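(* Let $M$ be a smooth connected closed manifold with a Poisson structure $p\in C^\infty(\wedge^2TM)$ and associated Poisson bracket $\{\cdot,\cdot\}$ on $C^\infty(M)$. Let $P\in C^\infty(\wedge^2TP^\infty(M))$ be the skew bivector field on $P^\infty(M)$ whose bracket satisfies $$\{F_{\phi_1},F_{\phi_2}\}(\mu)=\int_M\{\phi_1,\phi_2\}\,d\mu$$ for all $\phi_1,\phi_2\in C^\infty(M)$ and $\mu\in P^\infty(M)$, i.e. $\{F_{\phi_1},F_{\phi_2}\}=F_{\{\phi_1,\phi_2\}}$. Then $P$ is a Poisson structure on $P^\infty(M)$.
   Context: $P^\infty(M)$ is the space of probability measures on $M$ with smooth, everywhere positive density, with the smooth topology. It is an infinite-dimensional smooth manifold (in the sense of Kriegl–Michor), being an open subset of an affine space modelled on the space of smooth densities with total integral zero. For $\phi\in C^\infty(M)$, the function $F_\phi\in C^\infty(P^\infty(M))$ is $F_\phi(\mu)=\int_M\phi\,d\mu$. The map $\phi\mapsto dF_\phi|_\mu$ identifies $C^\infty(M)/\mathbb{R}$ with the cotangent space $T^*_\mu P^\infty(M)$; skew bivector fields and trivector fields on $P^\infty(M)$ are determined by their values on the differentials $dF_\phi$. Since $\int_M\{\phi_1,\phi_2\}\,d\mu$ vanishes if $\phi_1$ or $\phi_2$ is constant, the displayed formula does define $P$, via $P(dF_{\phi_1}\otimes dF_{\phi_2})=\{F_{\phi_1},F_{\phi_2}\}$. For a skew bivector field $p$ on a manifold, with bracket $\{f_1,f_2\}=p(df_1\otimes df_2)$, $\partial p$ denotes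 the skew trivector field with $(\partial p)(df_1,df_2,df_3)=\{\{f_1,f_2\},f_3\}+\{\{f_2,f_3\},f_1\}+\{\{f_3,f_1\},f_2\}$. One says that $p$ is a Poisson structure if $\partial p=0$. The same definitions are used for $P$ on $P^\infty(M)$. *)

theory Defs
  imports "HOL-Analysis.Analysis" "HOL-Probability.Probability_Measure"
begin

section \<open>Smooth maps between open subsets of Euclidean spaces\<close>

text \<open>Iterated directional derivatives: \<open>iter_deriv [v\<^sub>1, \<dots>, v\<^sub>k] f\<close> is
  \<open>\<partial>\<^bsub>v\<^sub>k\<^esub> \<dots> \<partial>\<^bsub>v\<^sub>1\<^esub> f\<close>.\<close>

primrec iter_deriv ::
    "'e::euclidean_space list \<Rightarrow> ('e \<Rightarrow> 'f::euclidean_space) \<Rightarrow> 'e \<Rightarrow> 'f" where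
  "iter_deriv [] f = f"
| "iter_deriv (v # vs) f = iter_deriv vs (\<lambda>x. frechet_derivative f (at x) v)"

text \<open>Only used for open \<open>S\<close>.\<close>

definition smooth_on :: "'e::euclidean_space set \<Rightarrow> ('e \<Rightarrow> 'f::euclidean_space) \<Rightarrow> bool" where
  "smooth_on S f \<longleftrightarrow> (\<forall>vs. \<forall>x\<in>S. iter_deriv vs f differentiable (at x))"

section \<open>Closed manifolds\<close>

text \<open>A chart is a pair of its domain and its coordinate map.\<close>

type_synonym ('a, 'e) chart = "'a set \<times> ('a \<Rightarrow> 'e)"

definition is_chart :: "('a::topological_space, 'e::euclidean_space) chart \<Rightarrow> bool" where
  "is_chart = (\<lambda>(U, \<phi>). open U \<and> open (\<phi> ` U) \<and> homeomorphism U (\<phi> ` U) \<phi> (inv_into U \<phi>))"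

text \<open>The manifold is the whole type \<open>'a\<close>, with a smooth atlas \<open>A\<close>.  Every Euclidean space
  \<open>'e\<close> has positive dimension; the connected closed manifold of dimension zero, a point, is
  represented by the empty atlas (on a one-point type no nonempty chart exists).\<close>

definition smooth_atlas :: "('a::topological_space, 'e::euclidean_space) chart set \<Rightarrow> bool" where
  "smooth_atlas A \<longleftrightarrow>
     (\<forall>c\<in>A. is_chart c) \<and>
     (\<forall>(U, \<phi>)\<in>A. \<forall>(V, \<psi>)\<in>A. smooth_on (\<phi> ` (U \<inter> V)) (\<psi> \<circ> inv_into U \<phi>)) \<and>
     ((\<Union>(U, \<phi>)\<in>A. U) = UNIV \<or> A = {} \<and> (\<exists>x. (UNIV :: 'a set) = {x}))"

definition closed_connected_manifold ::
    "('a::t2_space, 'e::euclidean_space) chart set \<Rightarrow> bool" where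
  "closed_connected_manifold A \<longleftrightarrow>
     smooth_atlas A \<and> compact (UNIV :: 'a set) \<and> connected (UNIV :: 'a set)"

definition smooth_fun :: "('a, 'e::euclidean_space) chart set \<Rightarrow> ('a \<Rightarrow> real) \<Rightarrow> bool" where
  "smooth_fun A f \<longleftrightarrow> (\<forall>(U, \<phi>)\<in>A. smooth_on (\<phi> ` U) (f \<circ> inv_into U \<phi>))"

definition smooth_curve ::
    "('a::topological_space, 'e::euclidean_space) chart set \<Rightarrow> (real \<Rightarrow> 'a) \<Rightarrow> bool" where
  "smooth_curve A c \<longleftrightarrow>
     continuous_on UNIV c \<and> (\<forall>(U, \<phi>)\<in>A. smooth_on (c -` U) (\<phi> \<circ> c))"

section \<open>Multivector fields and Poisson structures\<close>

text \<open>The following notions are used both for \<open>M\<close> and for the infinite-dimensional manifold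
  \<open>P\<^sup>\<infinity>(M)\<close>.  They depend only on the points, the smooth curves and the smooth functions.\<close>

record 'x smooth_space =
  points :: "'x set"
  curves :: "(real \<Rightarrow> 'x) set"
  funs :: "('x \<Rightarrow> real) set"

text \<open>A tangent vector at \<open>x\<close> is the velocity at time 0 of a smooth curve through \<open>x\<close>.  A
  covector at \<open>x\<close> is a function of tangent vectors; it is represented as a function of the
  curves, and set to 0 on curves that are not smooth curves through \<open>x\<close>, so that equality of
  covectors is equality of functions.\<close>

type_synonym 'x covector = "(real \<Rightarrow> 'x) \<Rightarrow> real"

definition differential :: "'x smooth_space \<Rightarrow> ('x \<Rightarrow> real) \<Rightarrow> 'x \<Rightarrow> 'x covector" where
  "differential X f x = (\<lambda>c. if c \<in> curves X \<and> c 0 = x then deriv (f \<circ> c) 0 else 0)"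

definition cotangent_space :: "'x smooth_space \<Rightarrow> 'x \<Rightarrow> 'x covector set" where
  "cotangent_space X x = {differential X f x | f. f \<in> funs X}"

definition linear_form :: "'x smooth_space \<Rightarrow> 'x \<Rightarrow> ('x covector \<Rightarrow> real) \<Rightarrow> bool" where
  "linear_form X x l \<longleftrightarrow>
     (\<forall>\<alpha>\<in>cotangent_space X x. \<forall>\<beta>\<in>cotangent_space X x. \<forall>a b.
        l (\<lambda>c. a * \<alpha> c + b * \<beta> c) = a * l \<alpha> + b * l \<beta>)"

text \<open>A linear form on the cotangent space that is given by a tangent vector.  In finite dimension
  every linear form is; in infinite dimension an element of \<open>\<Lambda>\<^sup>2T\<^sub>x\<close> or \<open>\<Lambda>\<^sup>3T\<^sub>x\<close>
  is required to yield a tangent vector when contracted with one, respectively two, covectors.\<close>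

definition tangent_form :: "'x smooth_space \<Rightarrow> 'x \<Rightarrow> ('x covector \<Rightarrow> real) \<Rightarrow> bool" where
  "tangent_form X x l \<longleftrightarrow>
     (\<exists>c\<in>curves X. c 0 = x \<and> (\<forall>\<beta>\<in>cotangent_space X x. l \<beta> = \<beta> c))"

text \<open>Values of multivector fields outside the points of the space, or on arguments outside the
  cotangent spaces, are irrelevant.\<close>

type_synonym 'x bivector_field = "'x \<Rightarrow> 'x covector \<Rightarrow> 'x covector \<Rightarrow> real"
type_synonym 'x trivector_field = "'x \<Rightarrow> 'x covector \<Rightarrow> 'x covector \<Rightarrow> 'x covector \<Rightarrow> real"

definition bracket ::
    "'x smooth_space \<Rightarrow> 'x bivector_field \<Rightarrow> ('x \<Rightarrow> real) \<Rightarrow> ('x \<Rightarrow> real) \<Rightarrow> 'x \<Rightarrow> real" where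
  "bracket X p f g = (\<lambda>x. p x (differential X f x) (differential X g x))"

definition skew_bivector_field :: "'x smooth_space \<Rightarrow> 'x bivector_field \<Rightarrow> bool" where
  "skew_bivector_field X p \<longleftrightarrow>
     (\<forall>x\<in>points X. \<forall>\<alpha>\<in>cotangent_space X x. \<forall>\<beta>\<in>cotangent_space X x.
        p x \<alpha> \<beta> = - p x \<beta> \<alpha>) \<and>
     (\<forall>x\<in>points X. \<forall>\<alpha>\<in>cotangent_space X x.
        linear_form X x (p x \<alpha>) \<and> tangent_form X x (p x \<alpha>)) \<and>
     (\<forall>f\<in>funs X. \<forall>g\<in>funs X. bracket X p f g \<in> funs X)"

definition skew_trivector_field :: "'x smooth_space \<Rightarrow> 'x trivector_field \<Rightarrow> bool" where
  "skew_trivector_field X T \<longleftrightarrow>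
     (\<forall>x\<in>points X. \<forall>\<alpha>\<in>cotangent_space X x. \<forall>\<beta>\<in>cotangent_space X x. \<forall>\<gamma>\<in>cotangent_space X x.
        T x \<alpha> \<beta> \<gamma> = - T x \<beta> \<alpha> \<gamma> \<and> T x \<alpha> \<beta> \<gamma> = - T x \<alpha> \<gamma> \<beta>) \<and>
     (\<forall>x\<in>points X. \<forall>\<alpha>\<in>cotangent_space X x. \<forall>\<beta>\<in>cotangent_space X x.
        linear_form X x (T x \<alpha> \<beta>) \<and> tangent_form X x (T x \<alpha> \<beta>)) \<and>
     (\<forall>f\<in>funs X. \<forall>g\<in>funs X. \<forall>h\<in>funs X.
        (\<lambda>x. T x (differential X f x) (differential X g x) (differential X h x)) \<in> funs X)"

text \<open>\<open>is_boundary X p T\<close> says \<open>\<partial>p = T\<close>.  On the cotangent spaces \<open>T\<close> is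
  uniquely determined, as these consist of differentials of smooth functions.\<close>

definition is_boundary ::
    "'x smooth_space \<Rightarrow> 'x bivector_field \<Rightarrow> 'x trivector_field \<Rightarrow> bool" where
  "is_boundary X p T \<longleftrightarrow> skew_trivector_field X T \<and>
     (\<forall>f\<in>funs X. \<forall>g\<in>funs X. \<forall>h\<in>funs X. \<forall>x\<in>points X.
        T x (differential X f x) (differential X g x) (differential X h x) =
          bracket X p (bracket X p f g) h x
        + bracket X p (bracket X p g h) f x
        + bracket X p (bracket X p h f) g x)"

definition poisson_structure :: "'x smooth_space \<Rightarrow> 'x bivector_field \<Rightarrow> bool" where
  "poisson_structure X p \<longleftrightarrow> skew_bivector_field X p \<and> is_boundary X p (\<lambda>x \<alpha> \<beta> \<gamma>. 0)"

definition manifold_space ::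
    "('a::topological_space, 'e::euclidean_space) chart set \<Rightarrow> 'a smooth_space" where
  "manifold_space A =
     \<lparr>points = UNIV, curves = {c. smooth_curve A c}, funs = {f. smooth_fun A f}\<rparr>"

section \<open>The Frechet space of smooth functions\<close>

text \<open>Convergence in the smooth topology.  The first conjunct is redundant as soon as the charts
  cover the compact manifold; it gives the right topology for the point with its empty atlas.\<close>

definition smooth_tendsto :: "('a, 'e::euclidean_space) chart set \<Rightarrow>
    ('s \<Rightarrow> 'a \<Rightarrow> real) \<Rightarrow> ('a \<Rightarrow> real) \<Rightarrow> 's filter \<Rightarrow> bool" where
  "smooth_tendsto A g l F \<longleftrightarrow>
     uniform_limit UNIV g l F \<and>
     (\<forall>(U, \<phi>)\<in>A. \<forall>K vs. compact K \<and> K \<subseteq> \<phi> ` U \<longrightarrow>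
        uniform_limit K (\<lambda>s. iter_deriv vs (g s \<circ> inv_into U \<phi>))
          (iter_deriv vs (l \<circ> inv_into U \<phi>)) F)"

text \<open>Smooth curves in the locally convex space of smooth functions, in the sense of Kriegl and
  Michor: all derivatives \<open>D k\<close> exist as limits of difference quotients.\<close>

definition smooth_fun_curve ::
    "('a, 'e::euclidean_space) chart set \<Rightarrow> (real \<Rightarrow> 'a \<Rightarrow> real) \<Rightarrow> bool" where
  "smooth_fun_curve A r \<longleftrightarrow>
     (\<exists>D :: nat \<Rightarrow> real \<Rightarrow> 'a \<Rightarrow> real. D 0 = r \<and>
        (\<forall>k t. smooth_fun A (D k t) \<and>
           smooth_tendsto A (\<lambda>s x. (D k (t + s) x - D k t x) / s) (D (Suc k) t) (at 0)))"

section \<open>The manifold of smooth positive probability measures\<close>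

definition Pinf :: "('a::topological_space, 'e::euclidean_space) chart set \<Rightarrow> 'a measure set" where
  "Pinf A = {\<mu>. prob_space \<mu> \<and> sets \<mu> = sets borel \<and>
     (\<forall>(U, \<phi>)\<in>A. \<exists>\<rho>. smooth_on (\<phi> ` U) \<rho> \<and> (\<forall>x\<in>\<phi> ` U. \<rho> x > 0) \<and>
        (\<forall>B\<in>sets lborel. B \<subseteq> \<phi> ` U \<longrightarrow>
           emeasure \<mu> (U \<inter> \<phi> -` B) = (\<integral>\<^sup>+x\<in>B. ennreal (\<rho> x) \<partial>lborel)))}"

text \<open>A reference measure \<open>\<nu>\<close> in \<open>Pinf A\<close> identifies smooth densities with smooth
  functions \<open>r\<close> through \<open>r \<nu>\<close>, and thereby \<open>Pinf A\<close> with an open subset of the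
  affine subspace \<open>\<integral>r d\<nu> = 1\<close> of the Frechet space of smooth functions.  A change of
  \<open>\<nu>\<close> amounts to multiplication by a fixed positive smooth function, so the choice does not
  matter.\<close>

definition Pinf_curve ::
    "('a::topological_space, 'e::euclidean_space) chart set \<Rightarrow> (real \<Rightarrow> 'a measure) \<Rightarrow> bool" where
  "Pinf_curve A c \<longleftrightarrow>
     (\<exists>\<nu>\<in>Pinf A. \<exists>r. smooth_fun_curve A r \<and>
        (\<forall>t. (\<forall>x. r t x > 0) \<and> c t \<in> Pinf A \<and> c t = density \<nu> (\<lambda>x. ennreal (r t x))))"

definition F_fun :: "('a \<Rightarrow> real) \<Rightarrow> 'a measure \<Rightarrow> real" where
  "F_fun \<phi> \<mu> = (\<integral>x. \<phi> x \<partial>\<mu>)"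

text \<open>A function \<open>f\<close> is smooth if it is smooth along smooth curves, and its differential is a
  smooth section of the cotangent bundle, whose fibre at \<open>\<mu>\<close> consists of the covectors
  \<open>dF\<^sub>\<phi>\<close> at \<open>\<mu>\<close>, that is, of smooth functions \<open>\<phi>\<close> modulo constants (and not
  of all continuous linear forms on the tangent space, which are distributions): along a smooth
  curve \<open>c\<close>, the differential is represented by a smooth curve \<open>\<psi>\<close> of smooth functions.\<close>

definition Pinf_fun ::
    "('a::topological_space, 'e::euclidean_space) chart set \<Rightarrow> ('a measure \<Rightarrow> real) \<Rightarrow> bool" where
  "Pinf_fun A f \<longleftrightarrow>
     (\<forall>c. Pinf_curve A c \<longrightarrow> smooth_on UNIV (f \<circ> c)) \<and>
     (\<forall>c. Pinf_curve A c \<longrightarrow> (\<exists>\<psi>. smooth_fun_curve A \<psi> \<and>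
        (\<forall>t \<gamma>. Pinf_curve A \<gamma> \<and> \<gamma> 0 = c t \<longrightarrow>
           deriv (f \<circ> \<gamma>) 0 = deriv (F_fun (\<psi> t) \<circ> \<gamma>) 0)))"

definition Pinf_space ::
    "('a::topological_space, 'e::euclidean_space) chart set \<Rightarrow> 'a measure smooth_space" where
  "Pinf_space A =
     \<lparr>points = Pinf A, curves = {c. Pinf_curve A c}, funs = {f. Pinf_fun A f}\<rparr>"

end

theory Submission
  imports Defs
begin

text \<open>For a smooth function \<open>f\<close> on \<open>P\<^sup>\<infinity>(M)\<close> the differential at \<open>\<mu>\<close> is \<open>dF\<^sub>\<phi>\<close> for a smooth \<open>\<phi>\<close>,
  and along a smooth curve \<open>c\<close> it is represented by a smooth curve \<open>\<phi>(t)\<close>.  Hence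
  \<open>{f, g}(c(t))\<close> is the integral of \<open>{\<phi>(t), \<psi>(t)}\<close> with respect to \<open>c(t)\<close>.  Let \<open>c\<close> start at
  \<open>\<mu>\<close> in the direction \<open>X\<^sub>h\<close> of the Hamiltonian vector field of \<open>h\<close> and differentiate at 0.
  Differentiating the measure gives the integral of \<open>{\<chi>, {\<phi>, \<psi>}}\<close>, where \<open>\<chi>\<close> represents \<open>dh\<close>; these
  terms cancel cyclically by the Jacobi identity on \<open>M\<close>.  Differentiating \<open>\<phi>\<close> and \<open>\<psi>\<close> gives second
  derivatives of \<open>f\<close> in the directions \<open>X\<^sub>h, X\<^sub>g\<close> and of \<open>g\<close> in the directions \<open>X\<^sub>h, X\<^sub>f\<close>; these
  cancel cyclically by the symmetry of second derivatives.  As smoothness on \<open>P\<^sup>\<infinity>(M)\<close> means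
  smoothness along curves, this symmetry needs an argument in the spirit of Boman's theorem, applied
  to the restriction of \<open>f\<close> to the two-parameter families \<open>(1 + s a + t b) \<mu>\<close>.\<close>

section \<open>Smooth functions on open sets\<close>

text \<open>A smooth \<open>f\<close> on the space of measures is controlled along curves only, so
  joint regularity of u(s,t) = f((1 + s a + t b) \<mu>) is not given and the classical theorem on
  mixed derivatives does not apply. What helps is that the s-derivative of u is the integral of a
  representing function against a. Along any smooth curve in the plane the representing functions
  can be chosen smoothly, so this derivative is again smooth along curves. That forces its second
  derivative in t to be bounded near the origin, and the bound replaces continuity of the mixed
  derivatives. Curves are maps on the whole line, while 1 + s a + t b is positive only for small s
  and t. The parameter is therefore passed through a function \<sigma> with values in (-r, r) that
  is the identity near 0. The integral of {\<phi>', \<psi>} with respect to \<mu> is the bracket of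
  F_\<phi>' with g, that is, minus the pairing of \<phi>' with the Hamiltonian vector of g. This is
  how derivatives of representing functions become second derivatives. Representing functions are
  unique up to constants, which brackets on M ignore.\<close>

lemma frechet_derivative_cong_open:
  assumes "open S" "x \<in> S" "\<And>y. y \<in> S \<Longrightarrow> f y = g y"
  shows "frechet_derivative f (at x) = frechet_derivative g (at x)"
proof -
  have "(f has_derivative D) (at x) \<longleftrightarrow> (g has_derivative D) (at x)" for D
    using has_derivative_transform_within_open[OF _ assms(1,2)] assms(3) by metis
  then show ?thesis
    by (simp add: frechet_derivative_def)
qed

lemma differentiable_cong_open:
  assumes "open S" "x \<in> S" "\<And>y. y \<in> S \<Longrightarrow> f y = g y" "f differentiable (at x)"
  shows "g differentiable (at x)"
  using assms has_derivative_transform_within_open unfolding differentiable_def by blast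

lemma frechet_derivative_eq:
  "(f has_derivative D) (at x) \<Longrightarrow> frechet_derivative f (at x) = D"
  using frechet_derivative_at by metis

lemma has_derivative_frechet:
  "f differentiable (at x) \<Longrightarrow> (f has_derivative frechet_derivative f (at x)) (at x)"
  using frechet_derivative_works by blast

lemma iter_deriv_cong_open:
  assumes "open S" "x \<in> S" "\<And>y. y \<in> S \<Longrightarrow> f y = g y"
  shows "iter_deriv vs f x = iter_deriv vs g x"
  using assms(3)
proof (induction vs arbitrary: f g)
  case Nil
  then show ?case using assms(2) by simp
next
  case (Cons v vs)
  have "frechet_derivative f (at y) v = frechet_derivative g (at y) v" if "y \<in> S" for y
    using frechet_derivative_cong_open[OF assms(1) that Cons.prems] by simp
  from Cons.IH[OF this] show ?case by simp
qed

lemma smooth_on_differentiable: "smooth_on S f \<Longrightarrow> x \<in> S \<Longrightarrow> f differentiable (at x)"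
  unfolding smooth_on_def by (drule spec[of _ "[]"]) simp

lemma smooth_on_frechet: "smooth_on S f \<Longrightarrow> smooth_on S (\<lambda>x. frechet_derivative f (at x) v)"
  unfolding smooth_on_def
proof (intro allI)
  fix vs assume "\<forall>vs. \<forall>x\<in>S. iter_deriv vs f differentiable at x"
  from this[rule_format, of _ "v # vs"]
  show "\<forall>x\<in>S. iter_deriv vs (\<lambda>x. frechet_derivative f (at x) v) differentiable at x" by simp
qed

lemma smooth_on_iter_deriv: "smooth_on S f \<Longrightarrow> smooth_on S (iter_deriv vs f)"
  by (induction vs arbitrary: f) (simp_all add: smooth_on_frechet)

lemma smooth_on_continuous: "smooth_on S f \<Longrightarrow> continuous_on S f"
  by (meson continuous_at_imp_continuous_on differentiable_imp_continuous_within
      smooth_on_differentiable)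

lemma smooth_on_subset: "smooth_on S f \<Longrightarrow> T \<subseteq> S \<Longrightarrow> smooth_on T f"
  unfolding smooth_on_def by blast

lemma smooth_on_locally:
  "(\<And>x. x \<in> S \<Longrightarrow> \<exists>T. x \<in> T \<and> smooth_on T f) \<Longrightarrow> smooth_on S f"
  unfolding smooth_on_def by blast

lemma smooth_on_cong:
  assumes "open S" "\<And>x. x \<in> S \<Longrightarrow> f x = g x" "smooth_on S f"
  shows "smooth_on S g"
  unfolding smooth_on_def
proof (intro allI ballI)
  fix vs x assume x: "x \<in> S"
  have "iter_deriv vs f y = iter_deriv vs g y" if "y \<in> S" for y
    using iter_deriv_cong_open assms(1,2) that by blast
  moreover have "iter_deriv vs f differentiable (at x)"
    using assms(3) x by (simp add: smooth_on_def)
  ultimately show "iter_deriv vs g differentiable (at x)"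
    using differentiable_cong_open[OF assms(1) x] by blast
qed

text \<open>\<open>P\<close> is the invariant of an induction on the list of directions. A
  derivative has to lie in \<open>P\<close> only up to agreement on the open set \<open>S\<close>,
  so no formula for higher derivatives is ever needed.\<close>

lemma smooth_on_coinduct:
  assumes "open S" "P f"
    and diff: "\<And>f x. P f \<Longrightarrow> x \<in> S \<Longrightarrow> f differentiable (at x)"
    and step: "\<And>f v. P f \<Longrightarrow> \<exists>g. P g \<and> (\<forall>x\<in>S. frechet_derivative f (at x) v = g x)"
  shows "smooth_on S f"
  unfolding smooth_on_def
proof (intro allI ballI)
  fix vs x assume x: "x \<in> S"
  show "iter_deriv vs f differentiable (at x)" using \<open>P f\<close>
  proof (induction vs arbitrary: f)
    case Nil
    then show ?case using diff x by simp
  next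
    case (Cons v vs)
    obtain g where g: "P g" "\<forall>x\<in>S. frechet_derivative f (at x) v = g x"
      using step[OF Cons.prems] by blast
    have "iter_deriv vs g y = iter_deriv (v # vs) f y" if "y \<in> S" for y
      using iter_deriv_cong_open[OF assms(1) that, of "\<lambda>x. frechet_derivative f (at x) v" g] g(2)
      by simp
    then show ?case
      using differentiable_cong_open[OF assms(1) x] Cons.IH[OF g(1)] by blast
  qed
qed

text \<open>Sum, product and chain rules express a derivative as a polynomial in other functions.
  Closing the generators under polynomials gives a class that can serve as an invariant for
  \<open>smooth_on_coinduct\<close>.\<close>

inductive_set generated_algebra :: "('e \<Rightarrow> real) set \<Rightarrow> ('e \<Rightarrow> real) set" for G where
  gen: "g \<in> G \<Longrightarrow> g \<in> generated_algebra G"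
| const: "(\<lambda>x. c) \<in> generated_algebra G"
| add: "f \<in> generated_algebra G \<Longrightarrow> g \<in> generated_algebra G \<Longrightarrow>
    (\<lambda>x. f x + g x) \<in> generated_algebra G"
| mult: "f \<in> generated_algebra G \<Longrightarrow> g \<in> generated_algebra G \<Longrightarrow>
    (\<lambda>x. f x * g x) \<in> generated_algebra G"

lemma generated_algebra_sum:
  "(\<And>i. i \<in> I \<Longrightarrow> f i \<in> generated_algebra G) \<Longrightarrow> (\<lambda>x. \<Sum>i\<in>I. f i x) \<in> generated_algebra G"
  by (induction I rule: infinite_finite_induct) (auto intro: generated_algebra.intros)

text \<open>By the Leibniz rule, the derivatives of all polynomials in the generators stay in the
  algebra as soon as those of the generators do.\<close>

lemma generated_algebra_smooth_on:
  fixes f :: "'e::euclidean_space \<Rightarrow> real"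
  assumes "open S" "f \<in> generated_algebra G"
    and diff: "\<And>g x. g \<in> G \<Longrightarrow> x \<in> S \<Longrightarrow> g differentiable (at x)"
    and step: "\<And>g v. g \<in> G \<Longrightarrow>
      \<exists>h\<in>generated_algebra G. \<forall>x\<in>S. frechet_derivative g (at x) v = h x"
  shows "smooth_on S f"
proof (rule smooth_on_coinduct[OF assms(1), where P = "\<lambda>f. f \<in> generated_algebra G"])
  show d: "f differentiable (at x)" if "f \<in> generated_algebra G" "x \<in> S" for f x
    using that by induction (auto intro: diff)
  show "\<exists>g. g \<in> generated_algebra G \<and> (\<forall>x\<in>S. frechet_derivative f (at x) v = g x)"
    if "f \<in> generated_algebra G" for f v
    using that
  proof induction
    case (gen g)
    then show ?case using step by blast
  next
    case (const c)
    then show ?case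
      by (metis frechet_derivative_const generated_algebra.const)
  next
    case (add f g)
    then obtain f' g' where *: "f' \<in> generated_algebra G" "g' \<in> generated_algebra G"
      "\<forall>x\<in>S. frechet_derivative f (at x) v = f' x" "\<forall>x\<in>S. frechet_derivative g (at x) v = g' x"
      by blast
    have "frechet_derivative (\<lambda>x. f x + g x) (at x) v = f' x + g' x" if "x \<in> S" for x
      using frechet_derivative_eq[OF has_derivative_add[OF
          has_derivative_frechet[OF d[OF add(1) that]] has_derivative_frechet[OF d[OF add(2) that]]]]
        * that by simp
    with * show ?case
      by (intro exI[of _ "\<lambda>x. f' x + g' x"]) (auto intro: generated_algebra.intros)
  next
    case (mult f g)
    then obtain f' g' where *: "f' \<in> generated_algebra G" "g' \<in> generated_algebra G"
      "\<forall>x\<in>S. frechet_derivative f (at x) v = f' x" "\<forall>x\<in>S. frechet_derivative g (at x) v = g' x"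
      by blast
    have "frechet_derivative (\<lambda>x. f x * g x) (at x) v = f x * g' x + f' x * g x" if "x \<in> S" for x
      using frechet_derivative_eq[OF has_derivative_mult[OF
          has_derivative_frechet[OF d[OF mult(1) that]] has_derivative_frechet[OF d[OF mult(2) that]]]]
        * that by simp
    with * mult show ?case
      by (intro exI[of _ "\<lambda>x. f x * g' x + f' x * g x"]) (auto intro: generated_algebra.intros)
  qed
qed (use assms in auto)

lemma smooth_on_generated_algebra:
  fixes f :: "'e::euclidean_space \<Rightarrow> real"
  assumes "open S" "f \<in> generated_algebra {f. smooth_on S f}"
  shows "smooth_on S f"
proof (rule generated_algebra_smooth_on[OF assms])
  show "\<exists>h\<in>generated_algebra {f. smooth_on S f}. \<forall>x\<in>S. frechet_derivative g (at x) v = h x"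
    if "g \<in> {f. smooth_on S f}" for g v
    by (rule bexI[of _ "\<lambda>x. frechet_derivative g (at x) v"])
      (use that smooth_on_frechet in \<open>auto intro!: generated_algebra.gen\<close>)
qed (simp add: smooth_on_differentiable)

lemma smooth_on_const: "open S \<Longrightarrow> smooth_on S (\<lambda>x. c::real)"
  by (rule smooth_on_generated_algebra[OF _ generated_algebra.const])

lemma smooth_on_add:
  fixes f g :: "'e::euclidean_space \<Rightarrow> real"
  shows "open S \<Longrightarrow> smooth_on S f \<Longrightarrow> smooth_on S g \<Longrightarrow> smooth_on S (\<lambda>x. f x + g x)"
  by (rule smooth_on_generated_algebra[OF _
      generated_algebra.add[OF generated_algebra.gen generated_algebra.gen]]) auto

lemma smooth_on_mult:
  fixes f g :: "'e::euclidean_space \<Rightarrow> real"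
  shows "open S \<Longrightarrow> smooth_on S f \<Longrightarrow> smooth_on S g \<Longrightarrow> smooth_on S (\<lambda>x. f x * g x)"
  by (rule smooth_on_generated_algebra[OF _
      generated_algebra.mult[OF generated_algebra.gen generated_algebra.gen]]) auto

lemma smooth_on_sum:
  fixes f :: "'i \<Rightarrow> 'e::euclidean_space \<Rightarrow> real"
  shows "open S \<Longrightarrow> (\<And>i. i \<in> I \<Longrightarrow> smooth_on S (f i)) \<Longrightarrow> smooth_on S (\<lambda>x. \<Sum>i\<in>I. f i x)"
  by (rule smooth_on_generated_algebra[OF _ generated_algebra_sum[OF generated_algebra.gen]]) auto

lemma smooth_on_diff:
  fixes f g :: "'e::euclidean_space \<Rightarrow> real"
  assumes "open S" "smooth_on S f" "smooth_on S g"
  shows "smooth_on S (\<lambda>x. f x - g x)"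
  using smooth_on_add[OF assms(1,2) smooth_on_mult[OF assms(1) smooth_on_const[OF assms(1), of "-1"] assms(3)]]
  by simp

text \<open>Adjoining 1/f to the smooth functions gives suitable generators, since the derivative of
  1/f is -f' (1/f)^2.\<close>

lemma smooth_on_inverse:
  fixes f :: "'e::euclidean_space \<Rightarrow> real"
  assumes "open S" "smooth_on S f" "\<And>x. x \<in> S \<Longrightarrow> f x \<noteq> 0"
  shows "smooth_on S (\<lambda>x. inverse (f x))"
proof (rule generated_algebra_smooth_on[OF assms(1),
      where G = "insert (\<lambda>x. inverse (f x)) {f. smooth_on S f}"])
  let ?G = "insert (\<lambda>x. inverse (f x)) {f. smooth_on S f}"
  have df: "f differentiable (at x)" if "x \<in> S" for x
    using smooth_on_differentiable assms(2) that by blast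
  show "(\<lambda>x. inverse (f x)) \<in> generated_algebra ?G"
    by (simp add: generated_algebra.gen)
  show "g differentiable (at x)" if "g \<in> ?G" "x \<in> S" for g x
    using that assms(3) smooth_on_differentiable df
    by (auto intro: differentiable_inverse)
  show "\<exists>h\<in>generated_algebra ?G. \<forall>x\<in>S. frechet_derivative g (at x) v = h x"
    if "g \<in> ?G" for g v
  proof (cases "smooth_on S g")
    case True
    then show ?thesis
      by (intro bexI[of _ "\<lambda>x. frechet_derivative g (at x) v"])
        (auto intro!: generated_algebra.gen smooth_on_frechet)
  next
    case False
    then have g: "g = (\<lambda>x. inverse (f x))" using that by auto
    have "frechet_derivative g (at x) v =
        - 1 * (inverse (f x) * (frechet_derivative f (at x) v * inverse (f x)))" if "x \<in> S" for x
      unfolding g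
      by (subst frechet_derivative_eq[OF Deriv.has_derivative_inverse[OF assms(3)[OF that]
              has_derivative_frechet[OF df[OF that]]]]) simp
    then show ?thesis
      by (intro bexI[of _ "\<lambda>x. - 1 * (inverse (f x) * (frechet_derivative f (at x) v * inverse (f x)))"]
          generated_algebra.mult generated_algebra.const generated_algebra.gen)
        (auto intro: smooth_on_frechet assms)
  qed
qed

lemma smooth_on_inner_right:
  fixes T :: "'e::euclidean_space \<Rightarrow> 'f::euclidean_space"
  assumes "open S" "smooth_on S T"
  shows "smooth_on S (\<lambda>x. T x \<bullet> b)"
proof (rule smooth_on_coinduct[OF assms(1), where P = "\<lambda>f. \<exists>T::'e \<Rightarrow> 'f. smooth_on S T \<and> f = (\<lambda>x. T x \<bullet> b)"])
  show "\<exists>g. (\<exists>T::'e \<Rightarrow> 'f. smooth_on S T \<and> g = (\<lambda>x. T x \<bullet> b)) \<and>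
      (\<forall>x\<in>S. frechet_derivative f (at x) v = g x)"
    if f: "\<exists>T::'e \<Rightarrow> 'f. smooth_on S T \<and> f = (\<lambda>x. T x \<bullet> b)" for f v
  proof -
    obtain T :: "'e \<Rightarrow> 'f" where T: "smooth_on S T" "f = (\<lambda>x. T x \<bullet> b)"
      using f by blast
    have "frechet_derivative f (at x) v = frechet_derivative T (at x) v \<bullet> b" if "x \<in> S" for x
      unfolding T(2)
      by (subst frechet_derivative_eq[OF has_derivative_inner_left[OF
              has_derivative_frechet[OF smooth_on_differentiable[OF T(1) that]]]]) simp
    then show ?thesis using smooth_on_frechet[OF T(1)] by blast
  qed
  show "f differentiable (at x)"
    if f: "\<exists>T::'e \<Rightarrow> 'f. smooth_on S T \<and> f = (\<lambda>x. T x \<bullet> b)" "x \<in> S" for f x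
  proof -
    obtain T :: "'e \<Rightarrow> 'f" where T: "smooth_on S T" "f = (\<lambda>x. T x \<bullet> b)"
      using f(1) by blast
    show ?thesis
      unfolding T(2) differentiable_def
      by (rule exI, rule has_derivative_inner_left[OF
            has_derivative_frechet[OF smooth_on_differentiable[OF T(1) f(2)]]])
  qed
qed (use assms in auto)

lemma has_derivative_compose_frechet:
  fixes g :: "'f::euclidean_space \<Rightarrow> real"
  assumes "g differentiable (at (T x))" "T differentiable (at x)"
  shows "((\<lambda>x. g (T x)) has_derivative
    (\<lambda>v. \<Sum>i\<in>Basis. (frechet_derivative T (at x) v \<bullet> i) * frechet_derivative g (at (T x)) i)) (at x)"
proof -
  let ?g = "frechet_derivative g (at (T x))"
  let ?T = "frechet_derivative T (at x)"
  have g: "(g has_derivative ?g) (at (T x))"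
    by (rule has_derivative_frechet[OF assms(1)])
  have "linear ?g"
    by (rule has_derivative_linear[OF g])
  have "?g (?T v) = (\<Sum>i\<in>Basis. (?T v \<bullet> i) * ?g i)" for v
  proof -
    have "?g (?T v) = ?g (\<Sum>i\<in>Basis. (?T v \<bullet> i) *\<^sub>R i)" by (simp add: euclidean_representation)
    also have "\<dots> = (\<Sum>i\<in>Basis. (?T v \<bullet> i) * ?g i)"
      using \<open>linear ?g\<close> by (simp add: linear_sum linear_scale)
    finally show ?thesis .
  qed
  moreover have "((\<lambda>x. g (T x)) has_derivative (\<lambda>v. ?g (?T v))) (at x)"
    by (rule has_derivative_compose[OF has_derivative_frechet[OF assms(2)] g])
  ultimately show ?thesis by simp
qed

text \<open>The generators are all g \<circ> T, with g varying, together with the smooth functions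
  on \<open>S\<close>. By the chain rule the derivative of g \<circ> T is a sum of products of
  coordinates of the derivative of T with partial derivatives of g composed with T, again a
  polynomial in generators.\<close>

lemma smooth_on_compose:
  fixes g :: "'f::euclidean_space \<Rightarrow> real" and T :: "'e::euclidean_space \<Rightarrow> 'f"
  assumes "open S" "smooth_on S T" "smooth_on V g" "T ` S \<subseteq> V"
  shows "smooth_on S (\<lambda>x. g (T x))"
proof (rule generated_algebra_smooth_on[OF assms(1),
      where G = "{\<lambda>x. g (T x) | g. smooth_on V g} \<union> {f. smooth_on S f}"])
  let ?G = "{\<lambda>x. g (T x) | g. smooth_on V g} \<union> {f. smooth_on S f}"
  have dT: "T differentiable (at x)" if "x \<in> S" for x
    using smooth_on_differentiable assms(2) that by blast
  have dc: "((\<lambda>x. g (T x)) has_derivative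
    (\<lambda>v. \<Sum>i\<in>Basis. (frechet_derivative T (at x) v \<bullet> i) * frechet_derivative g (at (T x)) i)) (at x)"
    if "x \<in> S" "smooth_on V g" for g :: "'f \<Rightarrow> real" and x
    by (rule has_derivative_compose_frechet)
      (use smooth_on_differentiable[OF that(2)] assms(4) dT that in auto)
  show "(\<lambda>x. g (T x)) \<in> generated_algebra ?G"
    using assms by (auto intro: generated_algebra.gen)
  show "f differentiable (at x)" if f: "f \<in> ?G" "x \<in> S" for f :: "'e \<Rightarrow> real" and x
  proof (cases "smooth_on S f")
    case True
    then show ?thesis using f smooth_on_differentiable by blast
  next
    case False
    then obtain g :: "'f \<Rightarrow> real" where g: "f = (\<lambda>x. g (T x))" "smooth_on V g" using f by auto
    show ?thesis
      unfolding g(1) differentiable_def by (rule exI, rule dc[OF f(2) g(2)])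
  qed
  show "\<exists>h\<in>generated_algebra ?G. \<forall>x\<in>S. frechet_derivative f (at x) v = h x"
    if f: "f \<in> ?G" for f :: "'e \<Rightarrow> real" and v
  proof (cases "smooth_on S f")
    case True
    then show ?thesis
      by (intro bexI[of _ "\<lambda>x. frechet_derivative f (at x) v"])
        (auto intro!: generated_algebra.gen smooth_on_frechet)
  next
    case False
    then obtain g :: "'f \<Rightarrow> real" where g: "f = (\<lambda>x. g (T x))" "smooth_on V g" using f by auto
    have "frechet_derivative f (at x) v =
        (\<Sum>i\<in>Basis. (frechet_derivative T (at x) v \<bullet> i) * frechet_derivative g (at (T x)) i)"
      if "x \<in> S" for x
      unfolding g(1) by (subst frechet_derivative_eq[OF dc[OF that g(2)]]) simp
    moreover have "(\<lambda>x. \<Sum>i\<in>Basis. (frechet_derivative T (at x) v \<bullet> i) *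
        frechet_derivative g (at (T x)) i) \<in> generated_algebra ?G"
    proof (intro generated_algebra_sum generated_algebra.mult generated_algebra.gen)
      fix i :: 'f
      show "(\<lambda>x. frechet_derivative T (at x) v \<bullet> i) \<in> ?G"
        using smooth_on_inner_right[OF assms(1) smooth_on_frechet[OF assms(2)]] by simp
      show "(\<lambda>x. frechet_derivative g (at (T x)) i) \<in> ?G"
        using smooth_on_frechet[OF g(2), of i] by auto
    qed
    ultimately show ?thesis by (intro bexI) auto
  qed
qed

lemma iter_deriv_linear:
  fixes f g :: "'e::euclidean_space \<Rightarrow> real"
  assumes "open S" "smooth_on S f" "smooth_on S g" "x \<in> S"
  shows "iter_deriv vs (\<lambda>x. a * f x + b * g x) x = a * iter_deriv vs f x + b * iter_deriv vs g x"
  using assms(2,3)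
proof (induction vs arbitrary: f g)
  case (Cons v vs)
  have "frechet_derivative (\<lambda>x. a * f x + b * g x) (at y) v =
      a * frechet_derivative f (at y) v + b * frechet_derivative g (at y) v" if "y \<in> S" for y
    by (subst frechet_derivative_eq[OF has_derivative_add[OF
          has_derivative_mult_right[OF has_derivative_frechet[OF smooth_on_differentiable[OF Cons(2) that]]]
          has_derivative_mult_right[OF has_derivative_frechet[OF smooth_on_differentiable[OF Cons(3) that]]]]])
      simp
  then show ?case
    using iter_deriv_cong_open[OF assms(1,4), of "\<lambda>x. frechet_derivative (\<lambda>x. a * f x + b * g x) (at x) v"]
      Cons.IH[OF smooth_on_frechet[OF Cons(2), of v] smooth_on_frechet[OF Cons(3), of v]]
    by simp
qed simp

section \<open>Functions of one real variable and their ordinary derivatives\<close>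

lemma frechet_derivative_real:
  fixes f :: "real \<Rightarrow> real"
  shows "(f has_real_derivative d) (at x) \<Longrightarrow> frechet_derivative f (at x) v = d * v"
  by (subst frechet_derivative_eq[of f "\<lambda>v. d * v"]) (auto simp: has_field_derivative_def)

text \<open>A directional derivative carries the direction \<open>v\<close> as a real factor, so the
  invariant consists of all scalar multiples of the \<open>D k\<close>.\<close>

lemma smooth_on_derivative_tower:
  fixes D :: "nat \<Rightarrow> real \<Rightarrow> real"
  assumes "open S" "\<And>k t. t \<in> S \<Longrightarrow> (D k has_real_derivative D (Suc k) t) (at t)"
  shows "smooth_on S (D k)"
proof (rule smooth_on_coinduct[OF assms(1), where P = "\<lambda>f. \<exists>c k. f = (\<lambda>t. c * D k t)"])
  show "\<exists>c m. D k = (\<lambda>t. c * D m t)"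
    by (intro exI[of _ 1] exI[of _ k]) simp
  have d: "((\<lambda>t. c * D k t) has_real_derivative c * D (Suc k) t) (at t)" if "t \<in> S" for c k t
    by (rule DERIV_cmult[OF assms(2)[OF that]])
  show "f differentiable (at x)" if "\<exists>c k. f = (\<lambda>t. c * D k t)" "x \<in> S" for f x
    using that d by (metis real_differentiable_def)
  show "\<exists>g. (\<exists>c k. g = (\<lambda>t. c * D k t)) \<and> (\<forall>x\<in>S. frechet_derivative f (at x) v = g x)"
    if f: "\<exists>c k. f = (\<lambda>t. c * D k t)" for f v
  proof -
    obtain c k where "f = (\<lambda>t. c * D k t)" using f by blast
    then have "frechet_derivative f (at x) v = v * c * D (Suc k) x" if "x \<in> S" for x
      using frechet_derivative_real[OF d[OF that, of c k]] by simp
    then show ?thesis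
      by (intro exI[of _ "\<lambda>t. v * c * D (Suc k) t"]) auto
  qed
qed

lemma smooth_on_has_real_derivative:
  assumes "smooth_on S f" "t \<in> S"
  shows "(f has_real_derivative frechet_derivative f (at t) 1) (at t)"
proof -
  have "f differentiable (at t)" using smooth_on_differentiable assms by blast
  then obtain d where "(f has_real_derivative d) (at t)"
    using real_differentiable_def by blast
  then show ?thesis using frechet_derivative_real by force
qed

abbreviation nderiv :: "nat \<Rightarrow> (real \<Rightarrow> real) \<Rightarrow> real \<Rightarrow> real" where
  "nderiv k f \<equiv> iter_deriv (replicate k 1) f"

lemma iter_deriv_append: "iter_deriv (vs @ ws) f = iter_deriv ws (iter_deriv vs f)"
  by (induction vs arbitrary: f) simp_all

lemma nderiv_has_derivative:
  assumes "smooth_on S f" "t \<in> S"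
  shows "(nderiv k f has_real_derivative nderiv (Suc k) f t) (at t)"
proof -
  have "nderiv (Suc k) f = (\<lambda>x. frechet_derivative (nderiv k f) (at x) 1)"
    using iter_deriv_append[of "replicate k 1" "[1]" f] by (simp add: replicate_append_same)
  then show ?thesis
    using smooth_on_has_real_derivative[OF smooth_on_iter_deriv[OF assms(1)] assms(2)] by simp
qed

lemma smooth_on_id: "open S \<Longrightarrow> smooth_on S (\<lambda>x::'e::euclidean_space. x \<bullet> i)"
proof (rule smooth_on_coinduct[where P = "\<lambda>f. f = (\<lambda>x. x \<bullet> i) \<or> (\<exists>c. f = (\<lambda>x. c))"])
  show "\<exists>g. (g = (\<lambda>x. x \<bullet> i) \<or> (\<exists>c. g = (\<lambda>x. c))) \<and>
      (\<forall>x\<in>S. frechet_derivative f (at x) v = g x)"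
    if "f = (\<lambda>x. x \<bullet> i) \<or> (\<exists>c. f = (\<lambda>x. c))" for f and v :: 'e
    using that
  proof
    assume f: "f = (\<lambda>x. x \<bullet> i)"
    have "((\<lambda>x. x \<bullet> i) has_derivative (\<lambda>x. x \<bullet> i)) (at x)" for x :: 'e
      by (intro derivative_eq_intros) auto
    from frechet_derivative_eq[OF this] show ?thesis unfolding f by auto
  next
    assume "\<exists>c. f = (\<lambda>x. c)"
    then show ?thesis
      by (metis frechet_derivative_const)
  qed
qed auto

lemma smooth_on_ident: "smooth_on UNIV (\<lambda>x::real. x)"
  using smooth_on_id[OF open_UNIV, of "1::real"] by simp

text \<open>The derivatives of the flat function \<open>flat 0\<close> are linear combinations of the \<open>flat n\<close>.\<close>

definition flat :: "nat \<Rightarrow> real \<Rightarrow> real" where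
  "flat n x = (if x \<le> 0 then 0 else inverse x ^ n * exp (- inverse x))"

text \<open>A single term of the exponential series is at most its sum.\<close>

lemma power_le_fact_exp: "0 \<le> y \<Longrightarrow> y ^ n \<le> fact n * exp (y::real)"
proof -
  assume y: "0 \<le> y"
  have "(\<Sum>k\<in>{n}. y ^ k /\<^sub>R fact k) \<le> (\<Sum>k. y ^ k /\<^sub>R fact k)"
    using y by (intro sum_le_suminf summable_exp_generic) auto
  then have "y ^ n / fact n \<le> exp y" by (simp add: exp_def divide_inverse mult.commute)
  then show ?thesis by (simp add: field_simps)
qed

text \<open>This is \<open>power_le_fact_exp\<close> for 1/x and the exponent n + 2. The two extra
  powers leave a factor x^2, which makes the difference quotient at the delicate point 0 tend to
  0.\<close>

lemma flat_bound: "\<bar>flat n x\<bar> \<le> fact (n + 2) * x\<^sup>2"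
proof (cases "x \<le> 0")
  case False
  then have x: "x > 0" by simp
  have "inverse x ^ (n + 2) \<le> fact (n + 2) * exp (inverse x)"
    by (rule power_le_fact_exp) (use x in auto)
  then have "inverse x ^ (n + 2) * exp (- inverse x) * x\<^sup>2 \<le>
      fact (n + 2) * exp (inverse x) * exp (- inverse x) * x\<^sup>2"
    by (intro mult_right_mono) auto
  moreover have "inverse x ^ (n + 2) * exp (- inverse x) * x\<^sup>2 = flat n x"
    using x by (simp add: flat_def power_add power2_eq_square) (simp add: field_simps)
  moreover have "fact (n + 2) * exp (inverse x) * exp (- inverse x) * x\<^sup>2 = fact (n + 2) * x\<^sup>2"
    by (simp add: exp_minus)
  moreover have "flat n x \<ge> 0" using x by (simp add: flat_def)
  ultimately show ?thesis by linarith
qed (simp add: flat_def)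

lemma flat_has_derivative:
  "(flat n has_real_derivative flat (n + 2) x - real n * flat (n + 1) x) (at x)"
proof -
  consider "x < 0" | "x = 0" | "x > 0" by linarith
  then show ?thesis
  proof cases
    case 1
    have "(flat n has_real_derivative 0) (at x)"
      by (rule has_field_derivative_transform_within_open[OF DERIV_const[of 0], where S = "{..<0}"])
        (use 1 in \<open>auto simp: flat_def\<close>)
    then show ?thesis using 1 by (simp add: flat_def)
  next
    case 2
    have "((\<lambda>h. flat n h / h) \<longlongrightarrow> 0) (at 0)"
    proof (rule Lim_null_comparison)
      show "\<forall>\<^sub>F h in at 0. norm (flat n h / h) \<le> fact (n + 2) * \<bar>h\<bar>"
      proof (rule eventually_at_topological[THEN iffD2], intro exI[of _ UNIV] conjI ballI impI)
        fix h :: real assume "h \<noteq> 0"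
        then show "norm (flat n h / h) \<le> fact (n + 2) * \<bar>h\<bar>"
          using flat_bound[of n h]
          by (simp add: divide_le_eq abs_mult mult.assoc power2_eq_square del: fact_Suc)
      qed auto
      show "((\<lambda>h. fact (n + 2) * \<bar>h\<bar>) \<longlongrightarrow> 0) (at (0::real))"
        by (rule tendsto_eq_intros refl | simp)+
    qed
    then show ?thesis
      using 2 by (simp add: DERIV_def flat_def)
  next
    case 3
    have inv: "(inverse has_real_derivative - (inverse x)\<^sup>2) (at x)"
      using DERIV_inverse[of x UNIV] 3 by (simp add: numeral_2_eq_2)
    have "((\<lambda>x. inverse x ^ n * exp (- inverse x)) has_real_derivative
        real n * (inverse x ^ (n - 1) * - (inverse x)\<^sup>2) * exp (- inverse x) +
        inverse x ^ n * (exp (- inverse x) * (inverse x)\<^sup>2)) (at x)"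
      using 3 by (auto intro!: derivative_eq_intros inv simp: algebra_simps power2_eq_square)
    moreover have "real n * (inverse x ^ (n - 1) * - (inverse x)\<^sup>2) * exp (- inverse x) +
        inverse x ^ n * (exp (- inverse x) * (inverse x)\<^sup>2) =
        inverse x ^ (n + 2) * exp (- inverse x) - real n * (inverse x ^ (n + 1) * exp (- inverse x))"
      by (cases n) (auto simp: algebra_simps power2_eq_square)
    ultimately have "((\<lambda>x. inverse x ^ n * exp (- inverse x)) has_real_derivative
        inverse x ^ (n + 2) * exp (- inverse x) - real n * (inverse x ^ (n + 1) * exp (- inverse x))) (at x)"
      by simp
    then have "(flat n has_real_derivative
        inverse x ^ (n + 2) * exp (- inverse x) - real n * (inverse x ^ (n + 1) * exp (- inverse x))) (at x)"
      by (rule has_field_derivative_transform_within_open[where S = "{0<..}"])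
        (use 3 in \<open>auto simp: flat_def\<close>)
    then show ?thesis using 3 by (simp add: flat_def)
  qed
qed

lemma smooth_flat: "smooth_on UNIV (flat n)"
proof (rule generated_algebra_smooth_on[where G = "range flat"])
  show "flat n \<in> generated_algebra (range flat)" by (simp add: generated_algebra.gen)
  show "g differentiable (at x)" if "g \<in> range flat" for g and x :: real
    using that flat_has_derivative real_differentiable_def by auto
  show "\<exists>h\<in>generated_algebra (range flat). \<forall>x\<in>UNIV. frechet_derivative g (at x) v = h x"
    if g: "g \<in> range flat" for g and v :: real
  proof -
    obtain m where m: "g = flat m" using g by blast
    show ?thesis
      unfolding m
    proof (rule bexI[of _ "\<lambda>x. (flat (m + 2) x + (- real m) * flat (m + 1) x) * v"])
      show "(\<lambda>x. (flat (m + 2) x + (- real m) * flat (m + 1) x) * v) \<in> generated_algebra (range flat)"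
        by (rule generated_algebra.mult[OF generated_algebra.add[OF generated_algebra.gen
              generated_algebra.mult[OF generated_algebra.const generated_algebra.gen]]
              generated_algebra.const]) auto
    qed (auto simp: frechet_derivative_real[OF flat_has_derivative])
  qed
qed simp

text \<open>The usual plateau function: 1 for |x| \<le> 1/2 and 0 for |x| \<ge> 1. The summands of
  the denominator vanish for |x| \<ge> 1 and for |x| \<le> 1/2 respectively, hence never
  together.\<close>

definition bump :: "real \<Rightarrow> real" where
  "bump x = flat 0 (1 - x\<^sup>2) / (flat 0 (1 - x\<^sup>2) + flat 0 (x\<^sup>2 - 1 / 4))"

lemma flat_nonneg: "flat n x \<ge> 0"
  by (simp add: flat_def)

lemma bump_denominator_pos: "flat 0 (1 - x\<^sup>2) + flat 0 (x\<^sup>2 - 1 / 4) > 0"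
proof (cases "x\<^sup>2 < 1")
  case True
  then have "flat 0 (1 - x\<^sup>2) > 0" by (simp add: flat_def)
  then show ?thesis using flat_nonneg[of 0 "x\<^sup>2 - 1 / 4"] by linarith
next
  case False
  then have "flat 0 (x\<^sup>2 - 1 / 4) > 0" by (simp add: flat_def)
  then show ?thesis using flat_nonneg[of 0 "1 - x\<^sup>2"] by linarith
qed

lemma smooth_bump: "smooth_on UNIV bump"
proof -
  have sq: "smooth_on UNIV (\<lambda>x::real. x\<^sup>2)"
    using smooth_on_mult[OF open_UNIV smooth_on_ident smooth_on_ident]
    by (simp add: power2_eq_square)
  have flat: "smooth_on UNIV (\<lambda>x. flat 0 (g x))" if "smooth_on UNIV g" for g :: "real \<Rightarrow> real"
    by (rule smooth_on_compose[OF open_UNIV that smooth_flat]) simp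
  have 1: "smooth_on UNIV (\<lambda>x. flat 0 (1 - x\<^sup>2))"
    by (intro flat smooth_on_diff smooth_on_const sq open_UNIV)
  have 2: "smooth_on UNIV (\<lambda>x. flat 0 (x\<^sup>2 - 1 / 4))"
    by (intro flat smooth_on_diff smooth_on_const sq open_UNIV)
  have "smooth_on UNIV (\<lambda>x. inverse (flat 0 (1 - x\<^sup>2) + flat 0 (x\<^sup>2 - 1 / 4)))"
  proof (rule smooth_on_inverse[OF open_UNIV smooth_on_add[OF open_UNIV 1 2]])
    show "flat 0 (1 - x\<^sup>2) + flat 0 (x\<^sup>2 - 1 / 4) \<noteq> 0" for x
      using bump_denominator_pos[of x] by linarith
  qed
  from smooth_on_mult[OF open_UNIV 1 this] show ?thesis
    unfolding bump_def[abs_def] divide_inverse .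
qed

lemma bump_eq_0: "\<bar>x\<bar> \<ge> 1 \<Longrightarrow> bump x = 0"
  using abs_le_square_iff[of 1 x] by (simp add: bump_def flat_def)

lemma bump_eq_1: "\<bar>x\<bar> \<le> 1 / 2 \<Longrightarrow> bump x = 1"
proof -
  assume "\<bar>x\<bar> \<le> 1 / 2"
  then have "x\<^sup>2 \<le> 1 / 4"
    using abs_le_square_iff[of x "1/2"] by (simp add: power2_eq_square)
  then have "flat 0 (x\<^sup>2 - 1 / 4) = 0" "flat 0 (1 - x\<^sup>2) \<noteq> 0" by (auto simp: flat_def)
  then show ?thesis by (simp add: bump_def)
qed

lemma bump_nonneg: "0 \<le> bump x"
  using bump_denominator_pos[of x] flat_nonneg[of 0 "1 - x\<^sup>2"] by (simp add: bump_def)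

lemma bump_le_1: "bump x \<le> 1"
  using bump_denominator_pos[of x] flat_nonneg[of 0 "x\<^sup>2 - 1/4"]
  by (simp add: bump_def divide_le_eq)

section \<open>Functions of two variables that are smooth along curves\<close>

lemma smooth_on_affine_compose:
  fixes f :: "real \<Rightarrow> real"
  assumes "smooth_on UNIV f"
  shows "smooth_on UNIV (\<lambda>t. f (a * t + b))"
proof (rule smooth_on_compose[OF open_UNIV _ assms])
  show "smooth_on UNIV (\<lambda>t. a * t + b)"
    by (intro smooth_on_add smooth_on_mult smooth_on_const smooth_on_ident open_UNIV)
qed simp

text \<open>Continuity gives a bound on the compact interval [-1, 1]. The complement is open and
  \<open>f\<close> vanishes on it, so all derivatives vanish there as well.\<close>

lemma nderiv_bounded:
  assumes f: "smooth_on UNIV f" and supp: "\<And>z. \<bar>z\<bar> \<ge> 1 \<Longrightarrow> f z = 0"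
  shows "\<exists>M. \<forall>z. \<bar>nderiv k f z\<bar> \<le> M"
proof -
  have "continuous_on {-1..1} (nderiv k f)"
    using smooth_on_continuous[OF smooth_on_iter_deriv[OF f]] continuous_on_subset by blast
  then have "bounded (nderiv k f ` {-1..1})"
    by (intro compact_imp_bounded compact_continuous_image) auto
  then obtain M where M: "\<And>z. z \<in> {-1..1} \<Longrightarrow> \<bar>nderiv k f z\<bar> \<le> M"
    unfolding bounded_iff by (metis imageI real_norm_def)
  have "nderiv k f z = 0" if z: "z \<notin> {-1..1}" for z
  proof -
    have "nderiv k f z = nderiv k (\<lambda>x. 0) z"
      by (rule iter_deriv_cong_open[of "- {-1..1}"]) (use z supp in auto)
    also have "\<dots> = 0"
      using iter_deriv_linear[OF open_UNIV smooth_on_const[OF open_UNIV, of 0]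
          smooth_on_const[OF open_UNIV, of 0], of z "replicate k 1" 0 0] by simp
    finally show ?thesis .
  qed
  moreover have "0 \<le> M" using M[of 0] by simp
  ultimately show ?thesis using M by (metis abs_zero)
qed

text \<open>The n-th bump sits at t = 2^-n, where 2^(n+2) t = 4, and is squeezed by the factor
  2^(n+2). Its k-th derivative grows like (2^k)^n, which the 1/n! in the coefficients beats for
  every k. Hence all the termwise derivative series converge uniformly on the whole line, also at 0,
  where the bumps accumulate.\<close>

lemma smooth_on_bump_series:
  fixes c :: "nat \<Rightarrow> real" and f :: "real \<Rightarrow> real"
  assumes f: "smooth_on UNIV f" and supp: "\<And>z. \<bar>z\<bar> \<ge> 1 \<Longrightarrow> f z = 0"
    and c: "\<And>n. \<bar>c n\<bar> \<le> \<delta> / fact n"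
  shows "smooth_on UNIV (\<lambda>t. \<Sum>n. c n * f (2 ^ (n + 2) * t - 4))"
proof -
  define D where "D k t = (\<Sum>n. c n * (2 ^ (n + 2)) ^ k * nderiv k f (2 ^ (n + 2) * t - 4))" for k t
  have delta: "0 \<le> \<delta>" using c[of 0] by simp
  have bound: "\<exists>b. summable b \<and>
      (\<forall>n t. \<bar>c n * (2 ^ (n + 2)) ^ k * nderiv k f (2 ^ (n + 2) * t - 4)\<bar> \<le> b n)" for k
  proof -
    obtain M where M: "\<And>z. \<bar>nderiv k f z\<bar> \<le> M" using nderiv_bounded[OF f supp] by blast
    have "0 \<le> M" using M[of 0] by linarith
    define b where "b n = \<delta> * 4 ^ k * M * ((2 ^ k) ^ n /\<^sub>R fact n)" for n :: nat
    have "summable b"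
      unfolding b_def by (intro summable_mult summable_exp_generic)
    moreover have "\<bar>c n * (2 ^ (n + 2)) ^ k * nderiv k f (2 ^ (n + 2) * t - 4)\<bar> \<le> b n" for n t
    proof -
      have "\<bar>c n * (2 ^ (n + 2)) ^ k * nderiv k f (2 ^ (n + 2) * t - 4)\<bar>
          = \<bar>c n\<bar> * (2 ^ (n + 2)) ^ k * \<bar>nderiv k f (2 ^ (n + 2) * t - 4)\<bar>"
        by (simp add: abs_mult)
      also have "\<dots> \<le> \<delta> / fact n * (2 ^ (n + 2)) ^ k * M"
        using delta c[of n] M \<open>0 \<le> M\<close> by (intro mult_mono) auto
      also have "\<dots> = b n"
      proof -
        have "(2 ^ n) ^ k = ((2::real) ^ k) ^ n" by (metis mult.commute power_mult)
        then have "(2 ^ (n + 2)) ^ k = (4 :: real) ^ k * (2 ^ k) ^ n"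
          by (simp add: power_add power_mult_distrib)
        then show ?thesis by (simp add: b_def field_simps)
      qed
      finally show ?thesis .
    qed
    ultimately show ?thesis by blast
  qed
  have summ: "summable (\<lambda>n. c n * (2 ^ (n + 2)) ^ k * nderiv k f (2 ^ (n + 2) * t - 4))" for k t
  proof -
    obtain b where b: "summable b"
      "\<And>n t. \<bar>c n * (2 ^ (n + 2)) ^ k * nderiv k f (2 ^ (n + 2) * t - 4)\<bar> \<le> b n"
      using bound by blast
    show ?thesis
      by (rule summable_comparison_test'[OF b(1)]) (simp only: real_norm_def b(2))
  qed
  have "(D k has_real_derivative D (Suc k) t) (at t)" for k t
  proof -
    obtain b where b: "summable b"
      "\<And>n t. \<bar>c n * (2 ^ (n + 2)) ^ Suc k * nderiv (Suc k) f (2 ^ (n + 2) * t - 4)\<bar> \<le> b n"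
      using bound[of "Suc k"] by blast
    have "((\<lambda>t. \<Sum>n. c n * (2 ^ (n + 2)) ^ k * nderiv k f (2 ^ (n + 2) * t - 4))
      has_real_derivative
        (\<Sum>n. c n * (2 ^ (n + 2)) ^ Suc k * nderiv (Suc k) f (2 ^ (n + 2) * t - 4))) (at t)"
    proof (rule has_field_derivative_series'(2)[of UNIV, where ?x0.0 = 0])
      show "((\<lambda>t. c n * (2 ^ (n + 2)) ^ k * nderiv k f (2 ^ (n + 2) * t - 4)) has_real_derivative
          c n * (2 ^ (n + 2)) ^ Suc k * nderiv (Suc k) f (2 ^ (n + 2) * t - 4)) (at t)" for n t
      proof -
        have "((\<lambda>t. 2 ^ (n + 2) * t - 4) has_real_derivative 2 ^ (n + 2)) (at t)"
          by (auto intro!: derivative_eq_intros)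
        from DERIV_cmult[OF DERIV_chain2[OF nderiv_has_derivative[OF f UNIV_I] this],
            of "c n * (2 ^ (n + 2)) ^ k" k]
        show ?thesis by (simp add: mult_ac)
      qed
      show "uniformly_convergent_on UNIV
          (\<lambda>n x. \<Sum>i<n. c i * (2 ^ (i + 2)) ^ Suc k * nderiv (Suc k) f (2 ^ (i + 2) * x - 4))"
        by (rule Weierstrass_m_test'[OF _ b(1)]) (simp only: real_norm_def b(2))
      show "summable (\<lambda>n. c n * (2 ^ (n + 2)) ^ k * nderiv k f (2 ^ (n + 2) * 0 - 4))"
        by (rule summ)
    qed simp_all
    then show ?thesis unfolding D_def[abs_def] .
  qed
  then have "smooth_on UNIV (D 0)" by (intro smooth_on_derivative_tower) auto
  then show ?thesis by (simp add: D_def[abs_def])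
qed

text \<open>Comparison with \<delta> times the exponential series at 1; the constant 3 is an upper
  bound for e.\<close>

lemma bump_series_bound:
  fixes c :: "nat \<Rightarrow> real" and f :: "real \<Rightarrow> real"
  assumes f: "\<And>z. \<bar>f z\<bar> \<le> 1" and c: "\<And>n. \<bar>c n\<bar> \<le> \<delta> / fact n"
  shows "\<bar>\<Sum>n. c n * f (2 ^ (n + 2) * t - 4)\<bar> \<le> 3 * \<delta>"
proof -
  have delta: "0 \<le> \<delta>" using c[of 0] by simp
  have s: "(\<lambda>n. \<delta> * (1 ^ n /\<^sub>R fact n)) sums (\<delta> * exp (1::real))"
    by (rule sums_mult[OF exp_converges])
  have le: "norm (c n * f (2 ^ (n + 2) * t - 4)) \<le> \<delta> * (1 ^ n /\<^sub>R fact n)" for n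
  proof -
    have "\<bar>c n\<bar> * \<bar>f (2 ^ (n + 2) * t - 4)\<bar> \<le> \<delta> / fact n * 1"
      using delta c f by (intro mult_mono) auto
    then show ?thesis by (simp add: abs_mult field_simps)
  qed
  have "\<bar>\<Sum>n. c n * f (2 ^ (n + 2) * t - 4)\<bar> \<le> (\<Sum>n. \<delta> * (1 ^ n /\<^sub>R fact n))"
    using norm_suminf_le[OF le sums_summable[OF s]] by simp
  also have "\<dots> = \<delta> * exp 1" using sums_unique[OF s] by simp
  also have "\<dots> \<le> \<delta> * 3" by (intro mult_left_mono exp_le delta)
  finally show ?thesis by simp
qed

text \<open>The hypothesis puts s = 2^(n+2) t between 7/2 and 9/2. For m \<noteq> n the number
  2^(m+2) t is then at most 9/4 or at least 7, hence at distance at least 1 from the centre 4, and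
  the m-th term vanishes.\<close>

lemma bump_series_eval:
  fixes c :: "nat \<Rightarrow> real" and f :: "real \<Rightarrow> real"
  assumes supp: "\<And>z. \<bar>z\<bar> \<ge> 1 \<Longrightarrow> f z = 0" and r: "\<bar>2 ^ (n + 2) * t - 4\<bar> \<le> 1 / 2"
  shows "(\<Sum>m. c m * f (2 ^ (m + 2) * t - 4)) = c n * f (2 ^ (n + 2) * t - (4::real))"
proof -
  define s where "s = 2 ^ (n + 2) * t"
  have s: "7 / 2 \<le> s" "s \<le> 9 / 2" using r unfolding s_def abs_le_iff by linarith+
  have "f (2 ^ (m + 2) * t - 4) = 0" if "m \<noteq> n" for m
  proof (rule supp)
    consider "m < n" | "n < m" using \<open>m \<noteq> n\<close> by linarith
    then show "\<bar>2 ^ (m + 2) * t - 4\<bar> \<ge> 1"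
    proof cases
      case 1
      define d where "d = n - m - 1"
      have n: "n = m + 1 + d" using 1 by (simp add: d_def)
      have "2 * (2 ^ (m + 2) * t) * 2 ^ d = s" by (simp add: s_def n power_add)
      moreover have "0 < t"
      proof (rule ccontr)
        assume "\<not> 0 < t"
        then have "s \<le> 0" unfolding s_def by (intro mult_nonneg_nonpos) auto
        with s show False by simp
      qed
      then have "2 * (2 ^ (m + 2) * t) * 1 \<le> 2 * (2 ^ (m + 2) * t) * 2 ^ d"
        by (intro mult_left_mono) auto
      ultimately have "2 * (2 ^ (m + 2) * t) \<le> s" by linarith
      then show ?thesis using s by linarith
    next
      case 2
      define d where "d = m - n - 1"
      have m: "m = n + 1 + d" using 2 by (simp add: d_def)
      have "2 ^ (m + 2) * t = 2 * s * 2 ^ d" by (simp add: s_def m power_add)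
      moreover have "2 * s * 1 \<le> 2 * s * 2 ^ d" using s by (intro mult_left_mono) auto
      ultimately show ?thesis using s by linarith
    qed
  qed
  then have "(\<Sum>m. c m * f (2 ^ (m + 2) * t - 4)) = (\<Sum>m\<in>{n}. c m * f (2 ^ (m + 2) * t - 4))"
    by (intro suminf_finite) auto
  then show ?thesis by simp
qed

text \<open>A special curve as in the proof of Boman's theorem. Around t = 2^-n it runs vertically
  over \<open>x n\<close> and passes \<open>y n\<close> exactly at 2^-n, with speed 2^(n+2) \<delta>
  / n!. The vertical motion comes from a second series with profile z * bump z, which is linear on
  the plateau; the bound 6 \<delta> is the sum of the bounds for the two series. These bounds keep
  the curve in a prescribed square.\<close>

lemma smooth_curve_through_lines:
  fixes x y :: "nat \<Rightarrow> real"
  assumes x: "\<And>n. \<bar>x n\<bar> \<le> \<delta> / fact n" and y: "\<And>n. \<bar>y n\<bar> \<le> \<delta> / fact n"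
  obtains \<sigma> \<tau> where "smooth_on UNIV \<sigma>" "smooth_on UNIV \<tau>"
    "\<And>t. \<bar>\<sigma> t\<bar> \<le> 3 * \<delta>" "\<And>t. \<bar>\<tau> t\<bar> \<le> 6 * \<delta>"
    "\<And>n t. \<bar>2 ^ (n + 2) * t - 4\<bar> \<le> 1 / 2 \<Longrightarrow>
      \<sigma> t = x n \<and> \<tau> t = y n + \<delta> / fact n * (2 ^ (n + 2) * t - 4)"
proof
  let ?S = "\<lambda>c f t. \<Sum>n. c n * f (2 ^ (n + 2) * t - (4::real)) :: real"
  let ?d = "\<lambda>n::nat. \<delta> / fact n"
  define zb where "zb z = z * bump z" for z
  have delta: "0 \<le> \<delta>" using x[of 0] by simp
  have d: "\<bar>?d n\<bar> \<le> \<delta> / fact n" for n using delta by simp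
  have zb: "smooth_on UNIV zb"
    unfolding zb_def[abs_def] by (intro smooth_on_mult smooth_on_ident smooth_bump open_UNIV)
  have zb0: "\<bar>z\<bar> \<ge> 1 \<Longrightarrow> zb z = 0" for z by (simp add: zb_def bump_eq_0)
  have b1: "\<bar>bump z\<bar> \<le> 1" for z using bump_le_1[of z] bump_nonneg[of z] by simp
  have zb1: "\<bar>zb z\<bar> \<le> 1" for z
  proof (cases "\<bar>z\<bar> \<ge> 1")
    case False
    then show ?thesis using b1[of z] mult_mono[of "\<bar>z\<bar>" 1 "\<bar>bump z\<bar>" 1]
      by (simp add: zb_def abs_mult)
  qed (simp add: zb0)
  show "smooth_on UNIV (?S x bump)"
    by (rule smooth_on_bump_series[OF smooth_bump bump_eq_0 x])
  show "smooth_on UNIV (\<lambda>t. ?S y bump t + ?S ?d zb t)"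
    by (rule smooth_on_add[OF open_UNIV smooth_on_bump_series[OF smooth_bump bump_eq_0 y]
          smooth_on_bump_series[OF zb zb0 d]])
  show "\<bar>?S x bump t\<bar> \<le> 3 * \<delta>" for t
    by (rule bump_series_bound[OF b1 x])
  show "\<bar>?S y bump t + ?S ?d zb t\<bar> \<le> 6 * \<delta>" for t
    using bump_series_bound[of bump y \<delta> t, OF b1 y] bump_series_bound[of zb ?d \<delta> t, OF zb1 d]
    by linarith
  show "?S x bump t = x n \<and> ?S y bump t + ?S ?d zb t = y n + ?d n * (2 ^ (n + 2) * t - 4)"
    if t: "\<bar>2 ^ (n + 2) * t - 4\<bar> \<le> 1 / 2" for n t
    using bump_series_eval[of bump n t x, OF bump_eq_0 t] bump_series_eval[of bump n t y, OF bump_eq_0 t]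
      bump_series_eval[of zb n t ?d, OF zb0 t] bump_eq_1[OF t] by (simp add: zb_def)
qed

section \<open>Reparametrisation and mean value estimates on the line\<close>

lemma nderiv_affine:
  assumes f: "smooth_on S f" and "open S" "open N" "t0 \<in> N"
    and G: "\<And>t. t \<in> N \<Longrightarrow> q * t + p \<in> S \<and> G t = f (q * t + p)"
  shows "nderiv k G t0 = q ^ k * nderiv k f (q * t0 + p)"
  using \<open>t0 \<in> N\<close>
proof (induction k arbitrary: t0)
  case 0
  then show ?case using G[OF 0] by simp
next
  case (Suc k)
  have "nderiv (Suc k) G t0 = frechet_derivative (nderiv k G) (at t0) 1"
    using iter_deriv_append[of "replicate k 1" "[1]" G] by (simp add: replicate_append_same)
  also have "\<dots> = frechet_derivative (\<lambda>t. q ^ k * nderiv k f (q * t + p)) (at t0) 1"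
    by (rule fun_cong[OF frechet_derivative_cong_open[OF \<open>open N\<close> Suc.prems Suc.IH]])
  also have "\<dots> = q ^ Suc k * nderiv (Suc k) f (q * t0 + p)"
  proof -
    have "((\<lambda>t. q * t + p) has_real_derivative q) (at t0)"
      by (auto intro!: derivative_eq_intros)
    from DERIV_cmult[OF DERIV_chain2[OF nderiv_has_derivative[OF f] this]] G[OF Suc.prems]
    have "((\<lambda>t. q ^ k * nderiv k f (q * t + p)) has_real_derivative
        q ^ k * (nderiv (Suc k) f (q * t0 + p) * q)) (at t0)" by blast
    from frechet_derivative_real[OF this, of 1] show ?thesis
      by (simp only: power_Suc mult_1_right mult_ac)
  qed
  finally show ?case .
qed

text \<open>After division by |t| the quadratic term tends to 0, so the linear coefficient alone
  bounds the limit of the difference quotients.\<close>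

lemma derivative_bound:
  fixes v :: "real \<Rightarrow> real"
  assumes v: "(v has_real_derivative d) (at 0)" and "\<epsilon> > 0"
    and b: "\<And>t. \<bar>t\<bar> < \<epsilon> \<Longrightarrow> \<bar>v t - v 0\<bar> \<le> C * \<bar>t\<bar> + D * t\<^sup>2"
  shows "\<bar>d\<bar> \<le> C"
proof (rule tendsto_le[OF trivial_limit_at])
  show "((\<lambda>t. \<bar>(v t - v 0) / t\<bar>) \<longlongrightarrow> \<bar>d\<bar>) (at 0)"
    using tendsto_rabs[OF v[unfolded DERIV_def]] by simp
  show "((\<lambda>t. C + D * \<bar>t\<bar>) \<longlongrightarrow> C) (at (0::real))"
    by (rule tendsto_eq_intros refl | simp)+
  show "\<forall>\<^sub>F t in at 0. \<bar>(v t - v 0) / t\<bar> \<le> C + D * \<bar>t\<bar>"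
    unfolding eventually_at
  proof (intro exI[of _ \<epsilon>] conjI ballI impI)
    fix t :: real assume t: "t \<noteq> 0 \<and> dist t 0 < \<epsilon>"
    then have "\<bar>v t - v 0\<bar> \<le> C * \<bar>t\<bar> + D * t\<^sup>2"
      using b[of t] by simp
    also have "\<dots> = (C + D * \<bar>t\<bar>) * \<bar>t\<bar>"
      by (simp add: distrib_right power2_eq_square mult.assoc)
    finally have "\<bar>v t - v 0\<bar> \<le> (C + D * \<bar>t\<bar>) * \<bar>t\<bar>" .
    moreover have "0 < \<bar>t\<bar>" using t by simp
    ultimately show "\<bar>(v t - v 0) / t\<bar> \<le> C + D * \<bar>t\<bar>"
      by (simp only: abs_divide pos_divide_le_eq)
  qed (rule \<open>\<epsilon> > 0\<close>)
qed

lemma real_mvt_bound: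
  fixes f :: "real \<Rightarrow> real"
  assumes f: "\<And>x. \<bar>x\<bar> \<le> \<bar>t\<bar> \<Longrightarrow> (f has_real_derivative f' x) (at x)"
    and B: "\<And>x. \<bar>x\<bar> \<le> \<bar>t\<bar> \<Longrightarrow> \<bar>f' x\<bar> \<le> B"
  shows "\<bar>f t - f 0\<bar> \<le> B * \<bar>t\<bar>"
proof -
  have "norm (f t - f 0) \<le> B * norm (t - 0)"
  proof (rule field_differentiable_bound)
    show "(f has_real_derivative f' x) (at x within {-\<bar>t\<bar>..\<bar>t\<bar>})"
      if "x \<in> {-\<bar>t\<bar>..\<bar>t\<bar>}" for x
      by (rule has_field_derivative_at_within, rule f) (use that in auto)
    show "norm (f' x) \<le> B" if "x \<in> {-\<bar>t\<bar>..\<bar>t\<bar>}" for x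
      unfolding real_norm_def by (rule B) (use that in auto)
  qed (auto simp: abs_if)
  then show ?thesis by simp
qed

section \<open>Regularity of functions that are smooth along all curves in a square\<close>

definition curve_smooth :: "real \<Rightarrow> (real \<Rightarrow> real \<Rightarrow> real) \<Rightarrow> bool" where
  "curve_smooth r g \<longleftrightarrow> (\<forall>(\<sigma> :: real \<Rightarrow> real) \<tau>. smooth_on UNIV \<sigma> \<longrightarrow> smooth_on UNIV \<tau> \<longrightarrow>
     (\<forall>t. \<bar>\<sigma> t\<bar> < r \<and> \<bar>\<tau> t\<bar> < r) \<longrightarrow> smooth_on UNIV (\<lambda>t. g (\<sigma> t) (\<tau> t)))"

lemma curve_smoothD:
  assumes "curve_smooth r g" "smooth_on UNIV \<sigma>" "smooth_on UNIV \<tau>"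
    "\<And>t::real. \<bar>\<sigma> t\<bar> < r" "\<And>t. \<bar>\<tau> t\<bar> < r"
  shows "smooth_on UNIV (\<lambda>t. g (\<sigma> t) (\<tau> t))"
  using assms unfolding curve_smooth_def by simp

text \<open>Admissible curves are defined on the whole line and stay in the square, so a coordinate
  line can be followed at unit speed only near a point. With \<epsilon> = r - |y| the cut-off
  displacement from \<open>y\<close> stays below \<epsilon>.\<close>

lemma smooth_local_line:
  fixes y r :: real
  assumes "\<bar>y\<bar> < r"
  obtains \<epsilon> and \<tau> :: "real \<Rightarrow> real" where "\<epsilon> > 0" "smooth_on UNIV \<tau>" "\<And>t. \<bar>\<tau> t\<bar> < r" "\<And>t. \<bar>t - y\<bar> < \<epsilon> \<Longrightarrow> \<tau> t = t"
proof
  define \<epsilon> where "\<epsilon> = r - \<bar>y\<bar>"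
  define \<tau> where "\<tau> t = y + (t - y) * bump (1 / \<epsilon> * t + - y / \<epsilon>)" for t
  have \<epsilon>: "\<epsilon> > 0" using assms by (simp add: \<epsilon>_def)
  then show "\<epsilon> / 2 > 0" by simp
  show "smooth_on UNIV \<tau>"
    unfolding \<tau>_def[abs_def]
    by (intro smooth_on_add smooth_on_diff smooth_on_mult smooth_on_const smooth_on_ident open_UNIV
        smooth_on_affine_compose smooth_bump)
  have z: "\<tau> t = y + (t - y) * bump ((t - y) / \<epsilon>)" for t
    by (simp add: \<tau>_def diff_divide_distrib)
  show "\<bar>\<tau> t\<bar> < r" for t
  proof -
    have "\<bar>(t - y) * bump ((t - y) / \<epsilon>)\<bar> < \<epsilon>"
    proof (cases "\<bar>(t - y) / \<epsilon>\<bar> \<ge> 1")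
      case False
      then have "\<bar>t - y\<bar> < \<epsilon>" using \<epsilon> by (simp add: divide_less_eq)
      moreover have "\<bar>t - y\<bar> * bump ((t - y) / \<epsilon>) \<le> \<bar>t - y\<bar> * 1"
        by (intro mult_left_mono bump_le_1) auto
      ultimately show ?thesis by (simp add: abs_mult bump_nonneg)
    qed (use \<epsilon> in \<open>simp add: bump_eq_0\<close>)
    then show ?thesis using z[of t] \<epsilon>_def by linarith
  qed
  show "\<tau> t = t" if "\<bar>t - y\<bar> < \<epsilon> / 2" for t
  proof -
    have "\<bar>(t - y) / \<epsilon>\<bar> \<le> 1 / 2" using that \<epsilon> by (simp add: field_simps)
    then show ?thesis unfolding z by (simp add: bump_eq_1)
  qed
qed

lemma curve_smooth_line:
  assumes g: "curve_smooth r g" and x: "\<bar>x\<bar> < r"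
  shows "smooth_on {-r<..<r} (g x)" "smooth_on {-r<..<r} (\<lambda>t. g t x)"
proof -
  have *: "\<exists>T. y \<in> T \<and> smooth_on T (g x) \<and> smooth_on T (\<lambda>t. g t x)" if y: "y \<in> {-r<..<r}" for y
  proof -
    have y': "\<bar>y\<bar> < r" using y by auto
    obtain \<epsilon> \<tau> where \<tau>: "\<epsilon> > 0" "smooth_on UNIV \<tau>" "\<And>t. \<bar>\<tau> t\<bar> < r"
      "\<And>t. \<bar>t - y\<bar> < \<epsilon> \<Longrightarrow> \<tau> t = t" by (rule smooth_local_line[OF y']) (rule that)
    have s: "smooth_on UNIV (\<lambda>t. g x (\<tau> t))" "smooth_on UNIV (\<lambda>t. g (\<tau> t) x)"
      by (rule curve_smoothD[OF g smooth_on_const[OF open_UNIV, of x] \<tau>(2) x \<tau>(3)],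
        rule curve_smoothD[OF g \<tau>(2) smooth_on_const[OF open_UNIV, of x] \<tau>(3) x])
    have "smooth_on (ball y \<epsilon>) (g x)"
      by (rule smooth_on_cong[OF _ _ smooth_on_subset[OF s(1)]])
        (simp_all add: \<tau>(4) dist_real_def abs_minus_commute)
    moreover have "smooth_on (ball y \<epsilon>) (\<lambda>t. g t x)"
      by (rule smooth_on_cong[OF _ _ smooth_on_subset[OF s(2)]])
        (simp_all add: \<tau>(4) dist_real_def abs_minus_commute)
    ultimately show ?thesis using \<tau>(1) by (intro exI[of _ "ball y \<epsilon>"]) auto
  qed
  show "smooth_on {-r<..<r} (g x)" "smooth_on {-r<..<r} (\<lambda>t. g t x)"
    by (rule smooth_on_locally, use * in blast)+
qed

text \<open>If the second derivatives were unbounded near the origin, they would be unbounded along a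
  smooth curve that runs, ever more slowly, through vertical segments where they are large.\<close>

lemma curve_smooth_second_derivative_bounded:
  assumes g: "curve_smooth r g" and r: "r > 0"
  obtains B \<epsilon> where "0 < \<epsilon>" "\<epsilon> < r"
    "\<And>x y. \<bar>x\<bar> \<le> \<epsilon> \<Longrightarrow> \<bar>y\<bar> \<le> \<epsilon> \<Longrightarrow> \<bar>nderiv 2 (g x) y\<bar> \<le> B"
proof -
  \<comment> \<open>The curve built below reaches coordinates up to 6 \<delta>, which must be
    smaller than \<open>r\<close>.\<close>
  define \<delta> where "\<delta> = r / 8"
  have \<delta>: "\<delta> > 0" using r by (simp add: \<delta>_def)
  have le: "\<delta> / fact n \<le> \<delta>" for n
    using \<delta> by (simp add: divide_le_eq mult_le_cancel_left1)
  \<comment> \<open>The factor \<delta> / n! is a lower bound for the vertical speed of the special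
    curve at 2^-n. If every n fails, the counterexamples give a smooth composite with
    \<open>g\<close> whose second derivative at 2^-n exceeds n in absolute value, which is
    impossible on the compact interval [0, 1].\<close>
  have "\<exists>n. \<forall>x y. \<bar>x\<bar> \<le> \<delta> / fact n \<longrightarrow> \<bar>y\<bar> \<le> \<delta> / fact n \<longrightarrow>
      \<bar>nderiv 2 (g x) y\<bar> * (\<delta> / fact n)\<^sup>2 \<le> real n"
  proof (rule ccontr)
    assume "\<not> ?thesis"
    then have "\<forall>n. \<exists>x y. \<bar>x\<bar> \<le> \<delta> / fact n \<and> \<bar>y\<bar> \<le> \<delta> / fact n \<and>
      \<bar>nderiv 2 (g x) y\<bar> * (\<delta> / fact n)\<^sup>2 > real n" by (simp add: not_le)
    then obtain x y where x: "\<And>n. \<bar>x n\<bar> \<le> \<delta> / fact n" and y: "\<And>n. \<bar>y n\<bar> \<le> \<delta> / fact n"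
      and xy: "\<And>n. \<bar>nderiv 2 (g (x n)) (y n)\<bar> * (\<delta> / fact n)\<^sup>2 > real n" by metis
    obtain \<sigma> \<tau> where st: "smooth_on UNIV \<sigma>" "smooth_on UNIV \<tau>"
      "\<And>t. \<bar>\<sigma> t\<bar> \<le> 3 * \<delta>" "\<And>t. \<bar>\<tau> t\<bar> \<le> 6 * \<delta>"
      "\<And>n t. \<bar>2 ^ (n + 2) * t - 4\<bar> \<le> 1 / 2 \<Longrightarrow>
        \<sigma> t = x n \<and> \<tau> t = y n + \<delta> / fact n * (2 ^ (n + 2) * t - 4)"
      by (rule smooth_curve_through_lines[OF x y]) (rule that)
    define G where "G t = g (\<sigma> t) (\<tau> t)" for t
    have lt: "\<bar>\<sigma> t\<bar> < r" "\<bar>\<tau> t\<bar> < r" for t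
      using st(3,4)[of t] r unfolding \<delta>_def by linarith+
    have G: "smooth_on UNIV G"
      unfolding G_def[abs_def] by (rule curve_smoothD[OF g st(1,2) lt])
    have "continuous_on {0..1} (nderiv 2 G)"
      using smooth_on_continuous[OF smooth_on_iter_deriv[OF G]] continuous_on_subset by blast
    then have "bounded (nderiv 2 G ` {0..1})"
      by (intro compact_imp_bounded compact_continuous_image) auto
    then obtain M where M: "\<And>t. t \<in> {0..1} \<Longrightarrow> \<bar>nderiv 2 G t\<bar> \<le> M"
      unfolding bounded_iff by (metis imageI real_norm_def)
    have "real n < M" for n
    proof -
      define q where "q = \<delta> / fact n * 2 ^ (n + 2)"
      define p where "p = y n - \<delta> / fact n * 4"
      define N where "N = {t::real. \<bar>2 ^ (n + 2) * t - 4\<bar> < 1 / 2}"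
      define t0 :: real where "t0 = 1 / 2 ^ n"
      have t0: "2 ^ (n + 2) * t0 = 4" by (simp add: t0_def power_add)
      have xn: "\<bar>x n\<bar> < r" using x[of n] le[of n] r unfolding \<delta>_def by linarith
      have "nderiv 2 G t0 = q ^ 2 * nderiv 2 (g (x n)) (q * t0 + p)"
      proof (rule nderiv_affine[OF curve_smooth_line(1)[OF g xn]])
        show "open N" unfolding N_def by (intro open_Collect_less continuous_intros)
        show "t0 \<in> N" unfolding N_def using t0 by simp
        show "q * t + p \<in> {-r<..<r} \<and> G t = g (x n) (q * t + p)" if "t \<in> N" for t
        proof -
          have *: "\<sigma> t = x n" "\<tau> t = q * t + p"
            using st(5)[of n t] that by (auto simp: N_def q_def p_def algebra_simps)
          then show ?thesis using lt(2)[of t] by (auto simp: G_def abs_less_iff)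
        qed
      qed simp
      also have "q * t0 + p = y n"
        using t0 by (simp add: q_def p_def mult.assoc)
      finally have "\<bar>nderiv 2 G t0\<bar> = q\<^sup>2 * \<bar>nderiv 2 (g (x n)) (y n)\<bar>" by (simp add: abs_mult)
      moreover have "(\<delta> / fact n)\<^sup>2 \<le> q\<^sup>2"
      proof (rule power_mono)
        have "(1::real) \<le> 2 ^ (n + 2)" by (rule one_le_power) simp
        from mult_left_mono[OF this, of "\<delta> / fact n"] have "\<delta> / fact n * 1 \<le> q"
          unfolding q_def using \<delta> by simp
        then show "\<delta> / fact n \<le> q" by simp
      qed (use \<delta> in simp)
      ultimately have "\<bar>nderiv 2 (g (x n)) (y n)\<bar> * (\<delta> / fact n)\<^sup>2 \<le> \<bar>nderiv 2 G t0\<bar>"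
        by (metis abs_ge_zero mult.commute mult_right_mono)
      moreover have "t0 \<in> {0..1}" by (simp add: t0_def divide_le_eq)
      ultimately show ?thesis using xy[of n] M[of t0] by linarith
    qed
    then show False by (meson less_asym reals_Archimedean2)
  qed
  then obtain n where n: "\<And>x y. \<bar>x\<bar> \<le> \<delta> / fact n \<Longrightarrow> \<bar>y\<bar> \<le> \<delta> / fact n \<Longrightarrow>
      \<bar>nderiv 2 (g x) y\<bar> * (\<delta> / fact n)\<^sup>2 \<le> real n" by blast
  show thesis
  proof (rule that[of "\<delta> / fact n" "real n / (\<delta> / fact n)\<^sup>2"])
    show "0 < \<delta> / fact n" using \<delta> by simp
    show "\<delta> / fact n < r" using le[of n] r unfolding \<delta>_def by linarith
    show "\<bar>nderiv 2 (g x) y\<bar> \<le> real n / (\<delta> / fact n)\<^sup>2"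
      if "\<bar>x\<bar> \<le> \<delta> / fact n" "\<bar>y\<bar> \<le> \<delta> / fact n" for x y
      using n[OF that] \<delta> by (subst le_divide_eq) simp
  qed
qed

text \<open>Schwarz's theorem without joint continuity. Bounding the second derivative of
  \<open>g1\<close> in its second variable gives a first-order expansion of \<open>g1\<close> in t
  that is uniform in the first variable. It makes the mixed derivative continuous along the first
  axis at the origin, so that u(s,t) - u(s,0) - u(0,t) + u(0,0) can be compared with s t a by the
  mean value theorem in s. Dividing by t and afterwards by s leads from this to b = a.\<close>

lemma mixed_derivatives_eq:
  fixes u g1 g2 :: "real \<Rightarrow> real \<Rightarrow> real"
  assumes r: "r > 0" and g1: "curve_smooth r g1"
    and u1: "\<And>x y. \<bar>x\<bar> < r \<Longrightarrow> \<bar>y\<bar> < r \<Longrightarrow> ((\<lambda>s. u s y) has_real_derivative g1 x y) (at x)"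
    and u2: "\<And>x. \<bar>x\<bar> < r \<Longrightarrow> (u x has_real_derivative g2 x 0) (at 0)"
    and A: "(g1 0 has_real_derivative a) (at 0)"
    and B: "((\<lambda>s. g2 s 0) has_real_derivative b) (at 0)"
  shows "a = b"
proof -
  obtain K \<epsilon> where \<epsilon>: "0 < \<epsilon>" "\<epsilon> < r"
    and K: "\<And>x y. \<bar>x\<bar> \<le> \<epsilon> \<Longrightarrow> \<bar>y\<bar> \<le> \<epsilon> \<Longrightarrow> \<bar>nderiv 2 (g1 x) y\<bar> \<le> K"
    by (rule curve_smooth_second_derivative_bounded[OF g1 r]) (rule that)
  have K0: "0 \<le> K" using K[of 0 0] \<epsilon> by linarith
  define h where "h x = nderiv 1 (g1 x)" for x
  have d1: "(g1 x has_real_derivative h x y) (at y)" if "\<bar>x\<bar> < r" "\<bar>y\<bar> < r" for x y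
    using nderiv_has_derivative[OF curve_smooth_line(1)[OF g1 that(1)], of y 0] that(2)
    by (simp add: h_def abs_less_iff)
  have d2: "(h x has_real_derivative nderiv 2 (g1 x) y) (at y)" if "\<bar>x\<bar> < r" "\<bar>y\<bar> < r" for x y
    using nderiv_has_derivative[OF curve_smooth_line(1)[OF g1 that(1)], of y 1] that(2)
    unfolding h_def by (simp add: numeral_2_eq_2 abs_less_iff)
  have h00: "h 0 0 = a"
    using DERIV_unique[OF A d1[of 0 0]] r by simp
  \<comment> \<open>The mean value theorem is applied twice: \<open>K\<close> controls the increment
    of \<open>h\<close>, and this increment controls the remainder.\<close>
  have taylor: "\<bar>g1 x t - g1 x 0 - t * h x 0\<bar> \<le> K * t\<^sup>2" if x: "\<bar>x\<bar> \<le> \<epsilon>" and t: "\<bar>t\<bar> \<le> \<epsilon>" for x t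
  proof -
    have "\<bar>h x y - h x 0\<bar> \<le> K * \<bar>y\<bar>" if "\<bar>y\<bar> \<le> \<epsilon>" for y
      by (rule real_mvt_bound[of _ _ "nderiv 2 (g1 x)"]) (use K d2 x that \<epsilon> in auto)
    then have h: "\<bar>h x y - h x 0\<bar> \<le> K * \<bar>t\<bar>" if "\<bar>y\<bar> \<le> \<bar>t\<bar>" for y
      using that t K0 by (meson dual_order.trans mult_left_mono)
    have "\<bar>(g1 x t - t * h x 0) - (g1 x 0 - 0 * h x 0)\<bar> \<le> (K * \<bar>t\<bar>) * \<bar>t\<bar>"
    proof (rule real_mvt_bound[of _ "\<lambda>t. g1 x t - t * h x 0" "\<lambda>y. h x y - h x 0"])
      show "((\<lambda>t. g1 x t - t * h x 0) has_real_derivative h x y - h x 0) (at y)" if "\<bar>y\<bar> \<le> \<bar>t\<bar>" for y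
        by (rule derivative_eq_intros d1 refl | use that x t \<epsilon> in simp)+
    qed (rule h)
    then show ?thesis by (simp add: power2_eq_square algebra_simps)
  qed
  have "\<bar>b - a\<bar> \<le> e" if e: "e > 0" for e
  proof -
    \<comment> \<open>For a fixed small t the difference quotient \<open>F\<close> is continuous in
      x and lies within e/4 of h(x, 0), uniformly in x. The deviation of h(x, 0) from its value a at
      0 consists of three errors of size e/4.\<close>
    obtain \<epsilon>' where \<epsilon>': "0 < \<epsilon>'" "\<epsilon>' \<le> \<epsilon>" and hc: "\<And>x. \<bar>x\<bar> < \<epsilon>' \<Longrightarrow> \<bar>h x 0 - a\<bar> \<le> e"
    proof -
      \<comment> \<open>The denominator K + 1 excludes division by 0 and still yields K t \<le>
        e/4.\<close>
      define t where "t = min \<epsilon> (e / (4 * (K + 1)))"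
      have t: "0 < t" "t \<le> \<epsilon>" using e K0 \<epsilon> by (auto simp: t_def)
      have "t \<le> e / (4 * (K + 1))" by (simp add: t_def)
      then have "K * t + t \<le> e / 4" using K0 by (simp add: field_simps)
      then have Kt: "K * t \<le> e / 4" using t by linarith
      define F where "F x = (g1 x t - g1 x 0) / t" for x
      have "continuous_on {-r<..<r} F"
        unfolding F_def
        by (intro continuous_on_divide continuous_on_diff continuous_on_const
            smooth_on_continuous[OF curve_smooth_line(2)[OF g1]]) (use t \<epsilon> in auto)
      then have "isCont F 0" using r by (simp add: continuous_on_eq_continuous_at)
      then have "\<forall>\<epsilon>>0. \<exists>d>0. \<forall>x. \<bar>x\<bar> < d \<longrightarrow> \<bar>F x - F 0\<bar> < \<epsilon>"
        by (simp add: continuous_at_eps_delta dist_real_def)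
      moreover have "e / 4 > 0" using e by simp
      ultimately obtain d where d: "d > 0" "\<And>x. \<bar>x\<bar> < d \<Longrightarrow> \<bar>F x - F 0\<bar> < e / 4"
        by blast
      have app: "\<bar>F x - h x 0\<bar> \<le> e / 4" if "\<bar>x\<bar> \<le> \<epsilon>" for x
      proof -
        have "F x - h x 0 = (g1 x t - g1 x 0 - t * h x 0) / t"
          using t by (simp add: F_def field_simps)
        then have "\<bar>F x - h x 0\<bar> \<le> K * t\<^sup>2 / t"
          using taylor[OF that, of t] t by (simp add: divide_right_mono)
        also have "\<dots> = K * t" using t by (simp add: power2_eq_square)
        finally show ?thesis using Kt by linarith
      qed
      show thesis
      proof (rule that[of "min d \<epsilon>"])
        show "\<bar>h x 0 - a\<bar> \<le> e" if x: "\<bar>x\<bar> < min d \<epsilon>" for x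
        proof -
          have "\<bar>x\<bar> < d" "\<bar>x\<bar> \<le> \<epsilon>" "\<bar>0::real\<bar> \<le> \<epsilon>" using x \<epsilon> by auto
          from app[OF this(2)] app[OF this(3)] d(2)[OF this(1)] show ?thesis
            using h00 e by linarith
        qed
      qed (use d \<epsilon> in auto)
    qed
    \<comment> \<open>The second difference of u is bounded by |s| (e |t| + K t^2), using the mean
      value theorem in s. Differentiating in t at 0 removes the quadratic term.\<close>
    have main: "\<bar>g2 s 0 - g2 0 0 - s * a\<bar> \<le> \<bar>s\<bar> * e" if s: "\<bar>s\<bar> < \<epsilon>'" for s
    proof (rule derivative_bound[of "\<lambda>t. u s t - u 0 t - s * (t * a)" _ \<epsilon> _ "\<bar>s\<bar> * K"])
      have sr: "\<bar>s\<bar> < r" using s \<epsilon>' \<epsilon> by linarith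
      show "((\<lambda>t. u s t - u 0 t - s * (t * a)) has_real_derivative g2 s 0 - g2 0 0 - s * a) (at 0)"
        by (rule derivative_eq_intros u2 sr refl | use r in simp)+
      show "\<bar>(u s t - u 0 t - s * (t * a)) - (u s 0 - u 0 0 - s * (0 * a))\<bar>
          \<le> \<bar>s\<bar> * e * \<bar>t\<bar> + \<bar>s\<bar> * K * t\<^sup>2" if t: "\<bar>t\<bar> < \<epsilon>" for t
      proof -
        have "\<bar>(u s t - u s 0 - s * (t * a)) - (u 0 t - u 0 0 - 0 * (t * a))\<bar>
            \<le> (e * \<bar>t\<bar> + K * t\<^sup>2) * \<bar>s\<bar>"
        proof (rule real_mvt_bound[of s "\<lambda>s. u s t - u s 0 - s * (t * a)" "\<lambda>x. g1 x t - g1 x 0 - t * a"])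
          fix x :: real assume x: "\<bar>x\<bar> \<le> \<bar>s\<bar>"
          then have xr: "\<bar>x\<bar> < r" "\<bar>x\<bar> < \<epsilon>'" "\<bar>x\<bar> \<le> \<epsilon>" using sr s \<epsilon>' by linarith+
          have tr: "\<bar>t\<bar> < r" using t \<epsilon> by linarith
          show "((\<lambda>s. u s t - u s 0 - s * (t * a)) has_real_derivative g1 x t - g1 x 0 - t * a) (at x)"
            by (rule derivative_eq_intros u1 xr tr refl | use r in simp)+
          have "\<bar>t * (h x 0 - a)\<bar> \<le> \<bar>t\<bar> * e"
            unfolding abs_mult by (intro mult_left_mono hc xr) auto
          then show "\<bar>g1 x t - g1 x 0 - t * a\<bar> \<le> e * \<bar>t\<bar> + K * t\<^sup>2"
            using taylor[OF xr(3) less_imp_le[OF t]]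
            unfolding right_diff_distrib mult.commute[of e] by linarith
        qed
        then show ?thesis by (simp add: algebra_simps)
      qed
    qed (use \<epsilon> in simp)
    show ?thesis
    proof (rule derivative_bound[of "\<lambda>s. g2 s 0 - s * a" _ \<epsilon>' _ 0])
      show "((\<lambda>s. g2 s 0 - s * a) has_real_derivative b - a) (at 0)"
        by (rule derivative_eq_intros B refl | simp)+
      show "\<bar>(g2 s 0 - s * a) - (g2 0 0 - 0 * a)\<bar> \<le> e * \<bar>s\<bar> + 0 * s\<^sup>2" if "\<bar>s\<bar> < \<epsilon>'" for s
        using main[OF that] by (simp add: algebra_simps)
    qed (rule \<epsilon>')
  qed
  then show ?thesis
    by (metis abs_le_zero_iff dense_ge eq_iff_diff_eq_0)
qed

lemma smooth_on_Un: "smooth_on S f \<Longrightarrow> smooth_on T f \<Longrightarrow> smooth_on (S \<union> T) f"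
  unfolding smooth_on_def by blast

section \<open>Poisson brackets on closed manifolds\<close>

lemma skew_bivector_fieldD:
  assumes "skew_bivector_field X p" "x \<in> points X" "\<alpha> \<in> cotangent_space X x"
  shows "\<beta> \<in> cotangent_space X x \<Longrightarrow> p x \<alpha> \<beta> = - p x \<beta> \<alpha>"
    and "linear_form X x (p x \<alpha>)" and "tangent_form X x (p x \<alpha>)"
  using assms unfolding skew_bivector_field_def by blast+

lemma bracket_in_funs:
  "skew_bivector_field X p \<Longrightarrow> f \<in> funs X \<Longrightarrow> g \<in> funs X \<Longrightarrow> bracket X p f g \<in> funs X"
  unfolding skew_bivector_field_def by blast

lemma manifold_space_simps [simp]:
  "points (manifold_space A) = UNIV" "c \<in> curves (manifold_space A) \<longleftrightarrow> smooth_curve A c"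
  "f \<in> funs (manifold_space A) \<longleftrightarrow> smooth_fun A f"
  by (simp_all add: manifold_space_def)

locale closed_manifold =
  fixes A :: "('a::t2_space, 'e::euclidean_space) chart set"
  assumes closed_connected: "closed_connected_manifold A"
begin

lemma atlas: "smooth_atlas A"
  using closed_connected by (simp add: closed_connected_manifold_def)

lemma compact_space: "compact (UNIV :: 'a set)"
  using closed_connected by (simp add: closed_connected_manifold_def)

lemma chart:
  assumes "(U, \<phi>) \<in> A"
  shows "open U" "open (\<phi> ` U)" "homeomorphism U (\<phi> ` U) \<phi> (inv_into U \<phi>)"
  using atlas assms unfolding smooth_atlas_def is_chart_def by auto

lemma chart_inv:
  assumes "(U, \<phi>) \<in> A" "x \<in> U"
  shows "inv_into U \<phi> (\<phi> x) = x"
  using homeomorphism_apply1[OF chart(3)[OF assms(1)] assms(2)] .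

lemma transition:
  assumes "(U, \<phi>) \<in> A" "(V, \<psi>) \<in> A"
  shows "smooth_on (\<phi> ` (U \<inter> V)) (\<psi> \<circ> inv_into U \<phi>)"
  using atlas assms unfolding smooth_atlas_def by auto

lemma open_chart_image:
  assumes "(U, \<phi>) \<in> A" "open W"
  shows "open (\<phi> ` (U \<inter> W))"
proof -
  have "openin (top_of_set U) (U \<inter> W)" using assms(2) by blast
  from homeomorphism_imp_open_map[OF chart(3)[OF assms(1)] this]
  show ?thesis using chart(2)[OF assms(1)] openin_open_trans by blast
qed

text \<open>The one-point manifold has the empty atlas, so local arguments split into a case with
  coordinates and a trivial case.\<close>

lemma chart_cases:
  obtains (in_chart) U \<phi> where "(U, \<phi>) \<in> A" "x \<in> U" | (point) "A = {}" "UNIV = {x}"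
proof -
  have "(\<Union>(U, \<phi>)\<in>A. U) = UNIV \<or> A = {} \<and> (\<exists>x. (UNIV :: 'a set) = {x})"
    using atlas unfolding smooth_atlas_def by simp
  then show thesis
  proof
    assume "(\<Union>(U, \<phi>)\<in>A. U) = UNIV"
    then have "x \<in> (\<Union>(U, \<phi>)\<in>A. U)" by simp
    then show thesis using that(1) by auto
  next
    assume "A = {} \<and> (\<exists>x. (UNIV :: 'a set) = {x})"
    then show thesis using that(2) by (metis UNIV_I singletonD)
  qed
qed

section \<open>Smooth functions on the manifold, cut-offs and extended coordinates\<close>

lemma smooth_fun_chart:
  "smooth_fun A f \<Longrightarrow> (U, \<phi>) \<in> A \<Longrightarrow> smooth_on (\<phi> ` U) (f \<circ> inv_into U \<phi>)"
  unfolding smooth_fun_def by auto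

lemma smooth_funI:
  "(\<And>U \<phi>. (U, \<phi>) \<in> A \<Longrightarrow> smooth_on (\<phi> ` U) (f \<circ> inv_into U \<phi>)) \<Longrightarrow> smooth_fun A f"
  unfolding smooth_fun_def by auto

lemma smooth_fun_const: "smooth_fun A (\<lambda>x. c)"
  by (rule smooth_funI) (simp add: comp_def smooth_on_const chart)

lemma smooth_fun_add: "smooth_fun A f \<Longrightarrow> smooth_fun A g \<Longrightarrow> smooth_fun A (\<lambda>x. f x + g x)"
  using smooth_on_add[OF chart(2)] smooth_fun_chart
  by (intro smooth_funI) (fastforce simp: comp_def)

lemma smooth_fun_mult: "smooth_fun A f \<Longrightarrow> smooth_fun A g \<Longrightarrow> smooth_fun A (\<lambda>x. f x * g x)"
  using smooth_on_mult[OF chart(2)] smooth_fun_chart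
  by (intro smooth_funI) (fastforce simp: comp_def)

lemma smooth_fun_lincomb:
  assumes "smooth_fun A f" "smooth_fun A g"
  shows "smooth_fun A (\<lambda>x. a * f x + b * g x)"
  by (intro smooth_fun_add smooth_fun_mult smooth_fun_const assms)

lemma smooth_fun_inverse:
  assumes f: "smooth_fun A f" and "\<And>x. f x \<noteq> 0"
  shows "smooth_fun A (\<lambda>x. inverse (f x))"
proof (rule smooth_funI)
  fix U \<phi> assume U: "(U, \<phi>) \<in> A"
  show "smooth_on (\<phi> ` U) ((\<lambda>x. inverse (f x)) \<circ> inv_into U \<phi>)"
    using smooth_on_inverse[OF chart(2)[OF U] smooth_fun_chart[OF f U]] assms(2)
    by (simp add: comp_def)
qed

lemma smooth_fun_continuous:
  assumes f: "smooth_fun A f"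
  shows "continuous_on UNIV f"
proof (rule continuous_at_imp_continuous_on, rule ballI)
  fix x
  show "isCont f x"
  proof (cases x rule: chart_cases)
    case (in_chart U \<phi>)
    have "continuous_on U \<phi>" using chart(3)[OF in_chart(1)]
      by (simp add: homeomorphism_def)
    moreover have "continuous_on (\<phi> ` U) (f \<circ> inv_into U \<phi>)"
      using smooth_on_continuous[OF smooth_fun_chart[OF f in_chart(1)]] .
    ultimately have "continuous_on U ((f \<circ> inv_into U \<phi>) \<circ> \<phi>)"
      by (rule continuous_on_compose)
    then have "continuous_on U f"
      by (rule continuous_on_eq) (simp add: chart_inv[OF in_chart(1)])
    then show ?thesis
      using in_chart(2) chart(1)[OF in_chart(1)]
      by (simp add: continuous_on_eq_continuous_at)
  next
    case point
    then have "f = (\<lambda>y. f x)" by (metis UNIV_I singletonD)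
    then show ?thesis by (metis continuous_const)
  qed
qed

lemma smooth_fun_bounded: "smooth_fun A f \<Longrightarrow> bounded (range f)"
  by (rule compact_imp_bounded[OF compact_continuous_image[OF smooth_fun_continuous compact_space]])

lemma smooth_fun_measurable: "smooth_fun A f \<Longrightarrow> f \<in> borel_measurable borel"
  by (rule borel_measurable_continuous_onI[OF smooth_fun_continuous])

text \<open>The preimage K' of \<open>K\<close> in the chart domain is compact, hence closed as the
  manifold is Hausdorff. The extension is therefore smooth on two open sets covering the manifold:
  on \<open>U\<close> it is w \<circ> \<phi>, and off K' it is 0.\<close>

lemma smooth_fun_extend:
  assumes U: "(U, \<phi>) \<in> A" and w: "smooth_on UNIV w" and K: "compact K" "K \<subseteq> \<phi> ` U"
    and supp: "\<And>y. y \<notin> K \<Longrightarrow> w y = (0::real)"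
  shows "smooth_fun A (\<lambda>x. if x \<in> U then w (\<phi> x) else 0)" (is "smooth_fun A ?f")
proof (rule smooth_funI)
  fix V \<psi> assume V: "(V, \<psi>) \<in> A"
  define K' where "K' = inv_into U \<phi> ` K"
  have "compact K'"
    unfolding K'_def
    by (rule compact_continuous_image[OF continuous_on_subset[OF _ K(2)] K(1)])
      (use chart(3)[OF U] in \<open>simp add: homeomorphism_def\<close>)
  then have "closed K'" by (rule compact_imp_closed)
  have out: "?f x = 0" if "x \<notin> K'" for x
  proof (cases "x \<in> U")
    case True
    then have "\<phi> x \<notin> K" using that chart_inv[OF U True] unfolding K'_def by force
    then show ?thesis using supp by simp
  qed simp
  have 1: "smooth_on (\<psi> ` (V \<inter> U)) (?f \<circ> inv_into V \<psi>)"
  proof (rule smooth_on_cong[OF open_chart_image[OF V chart(1)[OF U]]])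
    show "smooth_on (\<psi> ` (V \<inter> U)) (\<lambda>y. w ((\<phi> \<circ> inv_into V \<psi>) y))"
      by (rule smooth_on_compose[OF open_chart_image[OF V chart(1)[OF U]] transition[OF V U] w]) simp
    show "w ((\<phi> \<circ> inv_into V \<psi>) y) = (?f \<circ> inv_into V \<psi>) y" if "y \<in> \<psi> ` (V \<inter> U)" for y
      using that chart_inv[OF V] by auto
  qed
  have 2: "smooth_on (\<psi> ` (V \<inter> - K')) (?f \<circ> inv_into V \<psi>)"
  proof (rule smooth_on_cong[OF open_chart_image[OF V]])
    show "open (- K')" using \<open>closed K'\<close> by auto
    then show "smooth_on (\<psi> ` (V \<inter> - K')) (\<lambda>y. 0::real)"
      by (intro smooth_on_const open_chart_image[OF V])
    show "0 = (?f \<circ> inv_into V \<psi>) y" if "y \<in> \<psi> ` (V \<inter> - K')" for y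
    proof -
      from that obtain x where "x \<in> V" "x \<notin> K'" "y = \<psi> x" by auto
      then show ?thesis using chart_inv[OF V, of x] out[of x] by (simp split: if_splits)
    qed
  qed
  have "K' \<subseteq> U"
  proof
    fix x assume "x \<in> K'"
    then obtain y where "y \<in> K" "x = inv_into U \<phi> y" by (auto simp: K'_def)
    then show "x \<in> U" using K(2) inv_into_into[of y \<phi> U] by auto
  qed
  then have "\<psi> ` V = \<psi> ` (V \<inter> U) \<union> \<psi> ` (V \<inter> - K')"
    unfolding image_Un[symmetric] by (intro arg_cong[of _ _ "image \<psi>"]) auto
  with smooth_on_Un[OF 1 2] show "smooth_on (\<psi> ` V) (?f \<circ> inv_into V \<psi>)" by (simp only:)
qed

text \<open>Differentials are taken of functions on the whole manifold, so the coordinates are cut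
  off and extended by 0. The compact set \<open>K\<close> is recorded because smooth convergence is
  uniform on compact subsets of chart images, and \<open>K\<close> passes this on to
  \<open>W\<close>.\<close>

lemma local_coordinates:
  assumes U: "(U, \<phi>) \<in> A" and x: "x \<in> U"
  obtains \<eta> W K where "\<And>i. smooth_fun A (\<eta> i)" "open W" "x \<in> W" "W \<subseteq> U"
    "compact K" "K \<subseteq> \<phi> ` U" "\<phi> ` W \<subseteq> K" "\<And>i y. y \<in> W \<Longrightarrow> \<eta> i y = \<phi> y \<bullet> i"
proof -
  obtain \<epsilon> where \<epsilon>: "\<epsilon> > 0" "cball (\<phi> x) \<epsilon> \<subseteq> \<phi> ` U"
    using chart(2)[OF U] x open_contains_cball by blast
  \<comment> \<open>The squared distance to \<phi> x, written as a polynomial in the coordinates to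
    make its smoothness immediate.\<close>
  define q where "q y = (\<Sum>i\<in>Basis. (y \<bullet> i - \<phi> x \<bullet> i) * (y \<bullet> i - \<phi> x \<bullet> i))" for y
  have q: "q y = (dist y (\<phi> x))\<^sup>2" for y
    unfolding dist_norm power2_norm_eq_inner q_def
    by (subst euclidean_inner) (simp add: inner_diff_left)
  have smooth_q: "smooth_on UNIV q"
    unfolding q_def
    by (intro smooth_on_sum smooth_on_mult smooth_on_diff smooth_on_id smooth_on_const open_UNIV)
  define w where "w i y = bump (1 / \<epsilon>\<^sup>2 * q y) * (y \<bullet> i)" for i y
  have "smooth_on UNIV (\<lambda>y. bump (1 / \<epsilon>\<^sup>2 * q y))"
    by (rule smooth_on_compose[OF open_UNIV _ smooth_bump])
      (intro smooth_on_mult smooth_on_const smooth_q open_UNIV, simp)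
  then have w: "smooth_on UNIV (w i)" for i
    unfolding w_def[abs_def] by (intro smooth_on_mult smooth_on_id open_UNIV)
  have w0: "w i y = 0" if "y \<notin> cball (\<phi> x) \<epsilon>" for i y
  proof -
    have "\<epsilon>\<^sup>2 \<le> q y" unfolding q
      by (rule power_mono) (use that \<epsilon>(1) in \<open>auto simp: dist_commute\<close>)
    then have "1 \<le> 1 / \<epsilon>\<^sup>2 * q y" using \<epsilon>(1) by simp
    then have "1 \<le> \<bar>1 / \<epsilon>\<^sup>2 * q y\<bar>" by linarith
    then show ?thesis unfolding w_def by (simp only: bump_eq_0 mult_zero_left)
  qed
  define W where "W = U \<inter> \<phi> -` ball (\<phi> x) (\<epsilon> / 2)"
  show thesis
  proof (rule that[of "\<lambda>i x. if x \<in> U then w i (\<phi> x) else 0" W "cball (\<phi> x) \<epsilon>"])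
    show "smooth_fun A (\<lambda>x. if x \<in> U then w i (\<phi> x) else 0)" for i
      by (rule smooth_fun_extend[OF U w compact_cball \<epsilon>(2) w0])
    show "open W"
      unfolding W_def
      by (rule continuous_open_preimage) (use chart[OF U] in \<open>auto simp: homeomorphism_def\<close>)
    show "x \<in> W" "W \<subseteq> U" "\<phi> ` W \<subseteq> cball (\<phi> x) \<epsilon>"
      using x \<epsilon>(1) by (auto simp: W_def)
    show "(if y \<in> U then w i (\<phi> y) else 0) = \<phi> y \<bullet> i" if "y \<in> W" for i y
    proof -
      have "q (\<phi> y) \<le> (\<epsilon> / 2)\<^sup>2"
        unfolding q by (rule power_mono) (use that in \<open>auto simp: W_def dist_commute\<close>)
      moreover have nonneg: "0 \<le> q (\<phi> y)" unfolding q by simp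
      ultimately have "q (\<phi> y) * 2 \<le> \<epsilon>\<^sup>2"
        by (simp add: power_divide)
      then have "1 / \<epsilon>\<^sup>2 * q (\<phi> y) \<le> 1 / 2"
        using \<epsilon>(1) by (simp add: field_simps)
      moreover have "0 \<le> 1 / \<epsilon>\<^sup>2 * q (\<phi> y)" using nonneg by simp
      ultimately have "bump (1 / \<epsilon>\<^sup>2 * q (\<phi> y)) = 1" by (intro bump_eq_1) simp
      then show ?thesis using that by (simp add: w_def W_def)
    qed
  qed (use \<epsilon> in auto)
qed

lemma smooth_fun_curve_derivative:
  assumes U: "(U, \<phi>) \<in> A" and c: "smooth_curve A c" "c 0 \<in> U" and f: "smooth_fun A f"
  shows "((f \<circ> c) has_real_derivative
    (\<Sum>i\<in>Basis. (frechet_derivative (\<phi> \<circ> c) (at 0) 1 \<bullet> i) *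
       frechet_derivative (f \<circ> inv_into U \<phi>) (at (\<phi> (c 0))) i)) (at 0)"
proof -
  have open_c: "open (c -` U)"
    using c(1) chart(1)[OF U] unfolding smooth_curve_def by (simp add: continuous_on_open_vimage)
  have "smooth_on (c -` U) (\<phi> \<circ> c)"
    using c(1) U unfolding smooth_curve_def by auto
  then have "(\<phi> \<circ> c) differentiable (at 0)" using smooth_on_differentiable c(2) by blast
  moreover have "(f \<circ> inv_into U \<phi>) differentiable (at ((\<phi> \<circ> c) 0))"
    using smooth_on_differentiable[OF smooth_fun_chart[OF f U]] c(2) by simp
  ultimately have "((\<lambda>t. (f \<circ> inv_into U \<phi>) ((\<phi> \<circ> c) t)) has_derivative
    (\<lambda>v. \<Sum>i\<in>Basis. (frechet_derivative (\<phi> \<circ> c) (at 0) v \<bullet> i) *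
       frechet_derivative (f \<circ> inv_into U \<phi>) (at ((\<phi> \<circ> c) 0)) i)) (at 0)"
    by (intro has_derivative_compose_frechet)
  then have D: "((f \<circ> c) has_derivative
    (\<lambda>v. \<Sum>i\<in>Basis. (frechet_derivative (\<phi> \<circ> c) (at 0) v \<bullet> i) *
       frechet_derivative (f \<circ> inv_into U \<phi>) (at ((\<phi> \<circ> c) 0)) i)) (at 0)"
    by (rule has_derivative_transform_within_open[OF _ open_c])
      (use c(2) chart_inv[OF U] in auto)
  then have "(f \<circ> c) differentiable (at 0)" by (auto simp: differentiable_def)
  then obtain d where d: "((f \<circ> c) has_real_derivative d) (at 0)"
    using real_differentiable_def by blast
  from frechet_derivative_real[OF d, of 1] frechet_derivative_eq[OF D]
  have "d = (\<Sum>i\<in>Basis. (frechet_derivative (\<phi> \<circ> c) (at 0) 1 \<bullet> i) *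
       frechet_derivative (f \<circ> inv_into U \<phi>) (at (\<phi> (c 0))) i)" by simp
  then show ?thesis using d by simp
qed

lemma smooth_fun_curve_differentiable:
  assumes c: "smooth_curve A c" and f: "smooth_fun A f"
  shows "((f \<circ> c) has_real_derivative deriv (f \<circ> c) 0) (at 0)"
proof (cases "c 0" rule: chart_cases)
  case (in_chart U \<phi>)
  show ?thesis
    using smooth_fun_curve_derivative[OF in_chart(1) c in_chart(2) f] DERIV_imp_deriv by fastforce
next
  case point
  have "f \<circ> c = (\<lambda>t. f (c 0))"
  proof
    fix t
    have "c t \<in> {c 0}" unfolding point(2)[symmetric] by simp
    then show "(f \<circ> c) t = f (c 0)" by simp
  qed
  then show ?thesis by simp
qed

section \<open>Differentials on the manifold and their expression in coordinates\<close>

abbreviation "dM \<equiv> differential (manifold_space A)"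

lemma dM_lincomb:
  assumes f: "smooth_fun A f" and g: "smooth_fun A g"
  shows "dM (\<lambda>x. a * f x + b * g x) x = (\<lambda>c. a * dM f x c + b * dM g x c)"
proof
  fix c
  have "deriv ((\<lambda>x. a * f x + b * g x) \<circ> c) 0 = a * deriv (f \<circ> c) 0 + b * deriv (g \<circ> c) 0"
    if c: "smooth_curve A c"
  proof (rule DERIV_imp_deriv)
    show "(((\<lambda>x. a * f x + b * g x) \<circ> c) has_real_derivative
        a * deriv (f \<circ> c) 0 + b * deriv (g \<circ> c) 0) (at 0)"
      using DERIV_add[OF DERIV_cmult[OF smooth_fun_curve_differentiable[OF c f], of a]
          DERIV_cmult[OF smooth_fun_curve_differentiable[OF c g], of b]]
      by (simp add: comp_def)
  qed
  then show "dM (\<lambda>x. a * f x + b * g x) x c = a * dM f x c + b * dM g x c"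
    by (simp add: differential_def manifold_space_def)
qed

lemma cotangentI: "smooth_fun A f \<Longrightarrow> dM f x \<in> cotangent_space (manifold_space A) x"
  by (auto simp: cotangent_space_def manifold_space_def)

text \<open>The identity df = \<Sum> (\<partial>_i f) d\<eta>_i on \<open>W\<close>. On a smooth
  curve through \<open>x\<close> it is the chain rule; on all other functions both sides are 0 by
  convention.\<close>

lemma dM_chart:
  assumes U: "(U, \<phi>) \<in> A" and f: "smooth_fun A f" and \<eta>: "\<And>i. smooth_fun A (\<eta> i)"
    and W: "open W" "W \<subseteq> U" "\<And>i y. y \<in> W \<Longrightarrow> \<eta> i y = \<phi> y \<bullet> i" and x: "x \<in> W"
  shows "dM f x = (\<lambda>c. \<Sum>i\<in>Basis.
    iter_deriv [i] (f \<circ> inv_into U \<phi>) (\<phi> x) * dM (\<eta> i) x c)"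
proof
  fix c
  show "dM f x c = (\<Sum>i\<in>Basis. iter_deriv [i] (f \<circ> inv_into U \<phi>) (\<phi> x) * dM (\<eta> i) x c)"
  proof (cases "smooth_curve A c \<and> c 0 = x")
    case True
    then have c: "smooth_curve A c" "c 0 = x" "c 0 \<in> U" using x W(2) by auto
    have "smooth_on (c -` U) (\<phi> \<circ> c)"
      using c(1) U unfolding smooth_curve_def by auto
    then have d: "(\<phi> \<circ> c) differentiable (at 0)" using smooth_on_differentiable c(3) by blast
    have "deriv (\<eta> i \<circ> c) 0 = frechet_derivative (\<phi> \<circ> c) (at 0) 1 \<bullet> i" for i
    proof -
      have open_c: "open (c -` W)"
        using c(1) W(1) unfolding smooth_curve_def by (simp add: continuous_on_open_vimage)
      have "((\<lambda>t. (\<phi> \<circ> c) t \<bullet> i) has_derivative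
          (\<lambda>v. frechet_derivative (\<phi> \<circ> c) (at 0) v \<bullet> i)) (at 0)"
        by (rule has_derivative_inner_left[OF has_derivative_frechet[OF d]])
      then have "((\<eta> i \<circ> c) has_derivative (\<lambda>v. frechet_derivative (\<phi> \<circ> c) (at 0) v \<bullet> i)) (at 0)"
        by (rule has_derivative_transform_within_open[OF _ open_c]) (use c(2) x W(3) in auto)
      from frechet_derivative_eq[OF this]
        frechet_derivative_real[OF smooth_fun_curve_differentiable[OF c(1) \<eta>], of i 1]
      show ?thesis by simp
    qed
    then show ?thesis
      using DERIV_imp_deriv[OF smooth_fun_curve_derivative[OF U c(1,3) f]] c
      by (simp add: differential_def manifold_space_def mult.commute)
  qed (auto simp: differential_def manifold_space_def)
qed

text \<open>Every curve in a one-point space is constant.\<close>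

lemma dM_point:
  assumes "A = {}"
  shows "dM f x = (\<lambda>c. 0)"
proof
  fix c :: "real \<Rightarrow> 'a"
  have "f \<circ> c = (\<lambda>t. f x)"
  proof (cases x rule: chart_cases)
    case point
    have "c t \<in> {x}" for t unfolding point(2)[symmetric] by simp
    then show ?thesis by (simp add: fun_eq_iff)
  qed (use assms in simp)
  then show "dM f x c = 0" by (simp add: differential_def)
qed

end

lemma uniform_limit_sum:
  fixes f :: "'i \<Rightarrow> 's \<Rightarrow> 'b \<Rightarrow> real"
  assumes "finite I" "\<And>i. i \<in> I \<Longrightarrow> uniform_limit S (f i) (l i) F"
  shows "uniform_limit S (\<lambda>s x. \<Sum>i\<in>I. f i s x) (\<lambda>x. \<Sum>i\<in>I. l i x) F"
  using assms by (induction I rule: finite_induct) (auto intro!: uniform_limit_intros)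

lemma bounded_mult_image:
  fixes f g :: "'b \<Rightarrow> real"
  assumes "bounded (f ` S)" "bounded (g ` S)"
  shows "bounded ((\<lambda>x. f x * g x) ` S)"
proof -
  obtain B C where "\<And>x. x \<in> S \<Longrightarrow> \<bar>f x\<bar> \<le> B" "\<And>x. x \<in> S \<Longrightarrow> \<bar>g x\<bar> \<le> C"
    using assms unfolding bounded_iff by (metis imageI real_norm_def)
  then have "\<bar>f x * g x\<bar> \<le> B * C" if "x \<in> S" for x
    unfolding abs_mult using that by (intro mult_mono') auto
  then show ?thesis unfolding bounded_iff by auto
qed

section \<open>Bilinearity, local formula and continuity of the Poisson bracket\<close>

locale poisson_manifold = closed_manifold A
  for A :: "('a::t2_space, 'e::euclidean_space) chart set" +
  fixes p :: "'a bivector_field"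
  assumes poisson: "poisson_structure (manifold_space A) p"
begin

abbreviation "bracketM \<equiv> bracket (manifold_space A) p"

lemma skew_p: "skew_bivector_field (manifold_space A) p"
  using poisson by (simp add: poisson_structure_def)

lemma bracketM_smooth: "smooth_fun A f \<Longrightarrow> smooth_fun A g \<Longrightarrow> smooth_fun A (bracketM f g)"
  using bracket_in_funs[OF skew_p] by simp

lemma bracketM_skew: "smooth_fun A f \<Longrightarrow> smooth_fun A g \<Longrightarrow> bracketM f g x = - bracketM g f x"
  unfolding bracket_def by (rule skew_bivector_fieldD(1)[OF skew_p _ cotangentI cotangentI]) simp_all

lemma bracketM_jacobi:
  assumes "smooth_fun A f" "smooth_fun A g" "smooth_fun A h"
  shows "bracketM (bracketM f g) h x + bracketM (bracketM g h) f x + bracketM (bracketM h f) g x = 0"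
proof -
  have "is_boundary (manifold_space A) p (\<lambda>x \<alpha> \<beta> \<gamma>. 0)"
    using poisson by (simp add: poisson_structure_def)
  then have "\<forall>f\<in>funs (manifold_space A). \<forall>g\<in>funs (manifold_space A). \<forall>h\<in>funs (manifold_space A).
      \<forall>x\<in>points (manifold_space A). 0 = bracketM (bracketM f g) h x + bracketM (bracketM g h) f x
        + bracketM (bracketM h f) g x"
    unfolding is_boundary_def by blast
  with assms show ?thesis by simp
qed

lemma linear_p:
  assumes "\<alpha> \<in> cotangent_space (manifold_space A) x"
  shows "linear_form (manifold_space A) x (p x \<alpha>)"
  by (rule skew_bivector_fieldD(2)[OF skew_p _ assms]) simp

lemma bracketM_lincomb_right:
  assumes "smooth_fun A f" "smooth_fun A g" "smooth_fun A h"
  shows "bracketM f (\<lambda>x. a * g x + b * h x) x = a * bracketM f g x + b * bracketM f h x"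
  using linear_p[OF cotangentI[OF assms(1)], of x] cotangentI[OF assms(2)] cotangentI[OF assms(3)]
  by (simp add: bracket_def dM_lincomb[OF assms(2,3)] linear_form_def)

lemma bracketM_lincomb_left:
  assumes "smooth_fun A f" "smooth_fun A g" "smooth_fun A h"
  shows "bracketM (\<lambda>x. a * g x + b * h x) f x = a * bracketM g f x + b * bracketM h f x"
  using bracketM_lincomb_right[OF assms, of a b x]
    bracketM_skew[OF smooth_fun_lincomb[OF assms(2,3)] assms(1)]
    bracketM_skew[OF assms(1,2)] bracketM_skew[OF assms(1,3)] by simp

text \<open>Linearity is given for pairs of elements of the cotangent space, so an induction over a
  sum needs each partial sum to be the differential of one smooth function.\<close>

lemma cotangent_sum:
  assumes "finite I" "\<And>i. smooth_fun A (\<eta> i)"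
  shows "\<exists>f. smooth_fun A f \<and> (\<lambda>c. \<Sum>i\<in>I. a i * dM (\<eta> i) x c) = dM f x"
  using assms(1)
proof induction
  case empty
  have "dM (\<lambda>x. 0) x = (\<lambda>c. 0)"
    by (rule ext) (auto simp: differential_def comp_def split: if_splits)
  then show ?case using smooth_fun_const[of 0] by (intro exI[of _ "\<lambda>x. 0"]) simp
next
  case (insert j I)
  then obtain f where "smooth_fun A f" "(\<lambda>c. \<Sum>i\<in>I. a i * dM (\<eta> i) x c) = dM f x" by blast
  then show ?case
    using insert(1,2) dM_lincomb[OF assms(2)[of j], of f "a j" 1 x]
      smooth_fun_lincomb[OF assms(2)[of j], of f "a j" 1]
    by (intro exI[of _ "\<lambda>x. a j * \<eta> j x + 1 * f x"]) (simp add: fun_eq_iff)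
qed

lemma p_sum_right:
  assumes "\<alpha> \<in> cotangent_space (manifold_space A) x" "finite I" "\<And>i. smooth_fun A (\<eta> i)"
  shows "p x \<alpha> (\<lambda>c. \<Sum>i\<in>I. a i * dM (\<eta> i) x c) = (\<Sum>i\<in>I. a i * p x \<alpha> (dM (\<eta> i) x))"
  using assms(2)
proof induction
  case empty
  \<comment> \<open>Linearity with both coefficients 0 gives the value at the zero covector, the
    empty sum.\<close>
  have "(\<lambda>c. 0 * \<alpha> c + 0 * \<alpha> c) = (\<lambda>c. 0)" by simp
  moreover have "p x \<alpha> (\<lambda>c. 0 * \<alpha> c + 0 * \<alpha> c) = 0 * p x \<alpha> \<alpha> + 0 * p x \<alpha> \<alpha>"
    using linear_p[OF assms(1)] assms(1) unfolding linear_form_def by blast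
  ultimately show ?case by simp
next
  case (insert j I)
  obtain f where f: "smooth_fun A f" "(\<lambda>c. \<Sum>i\<in>I. a i * dM (\<eta> i) x c) = dM f x"
    using cotangent_sum[where I = I and \<eta> = \<eta> and a = a and x = x, OF insert(1) assms(3)] by blast
  have "p x \<alpha> (\<lambda>c. a j * dM (\<eta> j) x c + 1 * dM f x c) =
      a j * p x \<alpha> (dM (\<eta> j) x) + 1 * p x \<alpha> (dM f x)"
    using linear_p[OF assms(1)] cotangentI[OF assms(3)] cotangentI[OF f(1)]
    unfolding linear_form_def by blast
  then show ?case using insert f(2)[symmetric] by (simp add: fun_eq_iff)
qed

text \<open>Both differentials are expanded by \<open>dM_chart\<close>; the brackets of the extended
  coordinates are the components of the bivector field.\<close>

lemma bracketM_chart: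
  assumes U: "(U, \<phi>) \<in> A" and f: "smooth_fun A f" and g: "smooth_fun A g"
    and \<eta>: "\<And>i. smooth_fun A (\<eta> i)"
    and W: "open W" "W \<subseteq> U" "\<And>i y. y \<in> W \<Longrightarrow> \<eta> i y = \<phi> y \<bullet> i" and x: "x \<in> W"
  shows "bracketM f g x = (\<Sum>i\<in>Basis. \<Sum>j\<in>Basis.
    iter_deriv [i] (f \<circ> inv_into U \<phi>) (\<phi> x) * iter_deriv [j] (g \<circ> inv_into U \<phi>) (\<phi> x) *
    bracketM (\<eta> i) (\<eta> j) x)"
proof -
  have df: "dM f x = (\<lambda>c. \<Sum>i\<in>Basis. iter_deriv [i] (f \<circ> inv_into U \<phi>) (\<phi> x) * dM (\<eta> i) x c)"
    by (rule dM_chart[OF U f \<eta> W(1,2) _ x]) (rule W(3))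
  have dg: "dM g x = (\<lambda>c. \<Sum>i\<in>Basis. iter_deriv [i] (g \<circ> inv_into U \<phi>) (\<phi> x) * dM (\<eta> i) x c)"
    by (rule dM_chart[OF U g \<eta> W(1,2) _ x]) (rule W(3))
  let ?f = "\<lambda>i. iter_deriv [i] (f \<circ> inv_into U \<phi>) (\<phi> x)"
  let ?g = "\<lambda>i. iter_deriv [i] (g \<circ> inv_into U \<phi>) (\<phi> x)"
  have 1: "bracketM h g x = (\<Sum>j\<in>Basis. ?g j * bracketM h (\<eta> j) x)" if "smooth_fun A h" for h
    unfolding bracket_def dg by (rule p_sum_right[OF cotangentI[OF that] finite_Basis \<eta>])
  have 2: "bracketM f h x = (\<Sum>i\<in>Basis. ?f i * bracketM (\<eta> i) h x)" if h: "smooth_fun A h" for h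
  proof -
    have "bracketM h f x = (\<Sum>j\<in>Basis. ?f j * bracketM h (\<eta> j) x)"
      unfolding bracket_def df by (rule p_sum_right[OF cotangentI[OF h] finite_Basis \<eta>])
    then show ?thesis
      unfolding bracketM_skew[OF f h] bracketM_skew[OF \<eta> h] by (simp add: sum_negf)
  qed
  show ?thesis
    unfolding 2[OF g] 1[OF \<eta>] by (simp add: sum_distrib_left mult.assoc)
qed

text \<open>In coordinates the bracket involves only first derivatives and bounded coefficients, so
  it converges uniformly near each point, and finitely many such neighbourhoods cover the compact
  manifold. Uniform convergence is what the later limits under the integral require.\<close>

lemma bracketM_uniform_limit:
  assumes f: "smooth_tendsto A f f0 F" "smooth_fun A f0" "\<And>s. smooth_fun A (f s)"
    and g: "smooth_tendsto A g g0 F" "smooth_fun A g0" "\<And>s. smooth_fun A (g s)"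
  shows "uniform_limit UNIV (\<lambda>s. bracketM (f s) (g s)) (bracketM f0 g0) F"
proof -
  have "\<exists>W. open W \<and> x \<in> W \<and> uniform_limit W (\<lambda>s. bracketM (f s) (g s)) (bracketM f0 g0) F" for x
  proof (cases x rule: chart_cases)
    case (in_chart U \<phi>)
    obtain \<eta> W K where \<eta>: "\<And>i. smooth_fun A (\<eta> i)" and W: "open W" "x \<in> W" "W \<subseteq> U"
      "compact K" "K \<subseteq> \<phi> ` U" "\<phi> ` W \<subseteq> K" "\<And>i y. y \<in> W \<Longrightarrow> \<eta> i y = \<phi> y \<bullet> i"
      by (rule local_coordinates[OF in_chart]) (rule that)
    note formula = bracketM_chart[OF in_chart(1) _ _ \<eta> W(1,3,7)]
    have lim: "uniform_limit W (\<lambda>s y. iter_deriv vs (h s \<circ> inv_into U \<phi>) (\<phi> y))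
        (\<lambda>y. iter_deriv vs (h0 \<circ> inv_into U \<phi>) (\<phi> y)) F"
      if "smooth_tendsto A h h0 F" for h h0 vs
    proof -
      have "uniform_limit K (\<lambda>s. iter_deriv vs (h s \<circ> inv_into U \<phi>))
          (iter_deriv vs (h0 \<circ> inv_into U \<phi>)) F"
        using that in_chart(1) W(4,5) unfolding smooth_tendsto_def by blast
      then show ?thesis
        unfolding uniform_limit_iff using W(6) by (fast elim: eventually_mono)
    qed
    have bdd: "bounded ((\<lambda>y. iter_deriv vs (h0 \<circ> inv_into U \<phi>) (\<phi> y)) ` W)"
      if "smooth_fun A h0" for h0 vs
    proof -
      have "continuous_on K (iter_deriv vs (h0 \<circ> inv_into U \<phi>))"
        by (rule continuous_on_subset[OF smooth_on_continuous[OF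
              smooth_on_iter_deriv[OF smooth_fun_chart[OF that in_chart(1)]]] W(5)])
      then have "bounded (iter_deriv vs (h0 \<circ> inv_into U \<phi>) ` K)"
        by (intro compact_imp_bounded compact_continuous_image W(4))
      then show ?thesis by (rule bounded_subset) (use W(6) in auto)
    qed
    have bdd2: "bounded (bracketM (\<eta> i) (\<eta> j) ` W)" for i j
      by (rule bounded_subset[OF smooth_fun_bounded[OF bracketM_smooth[OF \<eta> \<eta>]]]) auto
    have bdd3: "bounded ((\<lambda>y. iter_deriv [i] (f0 \<circ> inv_into U \<phi>) (\<phi> y) *
        iter_deriv [j] (g0 \<circ> inv_into U \<phi>) (\<phi> y)) ` W)" for i j
      by (rule bounded_mult_image) (rule bdd f g)+
    have "uniform_limit W (\<lambda>s y. \<Sum>i\<in>Basis. \<Sum>j\<in>Basis.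
        iter_deriv [i] (f s \<circ> inv_into U \<phi>) (\<phi> y) * iter_deriv [j] (g s \<circ> inv_into U \<phi>) (\<phi> y) *
        bracketM (\<eta> i) (\<eta> j) y)
      (\<lambda>y. \<Sum>i\<in>Basis. \<Sum>j\<in>Basis.
        iter_deriv [i] (f0 \<circ> inv_into U \<phi>) (\<phi> y) * iter_deriv [j] (g0 \<circ> inv_into U \<phi>) (\<phi> y) *
        bracketM (\<eta> i) (\<eta> j) y) F"
      by (intro uniform_limit_sum finite_Basis uniform_lim_mult[OF uniform_lim_mult]
          uniform_limit_const lim f(1) g(1) bdd f(2) g(2) bdd2 bdd3)
    then have "uniform_limit W (\<lambda>s. bracketM (f s) (g s)) (bracketM f0 g0) F"
      by (subst uniform_limit_cong') (use formula[OF f(3) g(3)] formula[OF f(2) g(2)] in auto)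
    then show ?thesis using W(1,2) by blast
  next
    case point
    have "bracketM h k = (\<lambda>x. p x (\<lambda>c. 0) (\<lambda>c. 0))" for h k
      by (simp add: bracket_def dM_point[OF point(1)])
    then have "uniform_limit UNIV (\<lambda>s. bracketM (f s) (g s)) (bracketM f0 g0) F"
      by (simp only: uniform_limit_const)
    then show ?thesis by blast
  qed
  then obtain W where W: "\<And>x. open (W x)" "\<And>x. x \<in> W x"
    "\<And>x. uniform_limit (W x) (\<lambda>s. bracketM (f s) (g s)) (bracketM f0 g0) F" by metis
  obtain C where "C \<subseteq> UNIV" "finite C" "UNIV \<subseteq> (\<Union>x\<in>C. W x)"
    by (rule compactE_image[OF compact_space, of UNIV W]) (use W(1,2) in auto)
  then have C: "(\<Union>x\<in>C. W x) = UNIV" "finite C" by auto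
  show ?thesis
    unfolding C(1)[symmetric] by (rule uniform_limit_on_UNION[OF C(2) W(3)])
qed

end

section \<open>Smooth measures and their curves\<close>

context closed_manifold
begin

lemma PinfD:
  assumes "\<mu> \<in> Pinf A"
  shows "prob_space \<mu>" "sets \<mu> = sets borel" "space \<mu> = UNIV"
proof -
  show "prob_space \<mu>" and s: "sets \<mu> = sets borel" using assms by (auto simp: Pinf_def)
  show "space \<mu> = UNIV" using sets_eq_imp_space_eq[OF s] by simp
qed

lemma Pinf_measurable: "\<mu> \<in> Pinf A \<Longrightarrow> smooth_fun A f \<Longrightarrow> f \<in> borel_measurable \<mu>"
  using smooth_fun_measurable measurable_cong_sets[OF PinfD(2) refl] by blast

lemma smooth_fun_abs_bound:
  assumes "smooth_fun A f"
  obtains B where "B > 0" "\<And>x. \<bar>f x\<bar> \<le> B"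
proof -
  obtain B where "B > 0" "\<forall>x\<in>range f. norm x \<le> B"
    using smooth_fun_bounded[OF assms] bounded_pos by blast
  then show thesis using that by auto
qed

lemma Pinf_integrable:
  assumes "\<mu> \<in> Pinf A" "smooth_fun A f"
  shows "integrable \<mu> f"
proof -
  interpret prob_space \<mu> by (rule PinfD[OF assms(1)])
  obtain B where "\<And>x. \<bar>f x\<bar> \<le> B" using smooth_fun_abs_bound[OF assms(2)] by blast
  then show ?thesis
    using Pinf_measurable[OF assms] by (intro integrable_const_bound[of _ B]) auto
qed

text \<open>The total mass is 1, so the integrals differ by no more than a uniform bound on the
  difference of the integrands.\<close>

lemma integral_uniform_limit:
  fixes g :: "'s \<Rightarrow> 'a \<Rightarrow> real"
  assumes \<mu>: "\<mu> \<in> Pinf A" and lim: "uniform_limit UNIV g l F"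
    and g: "\<And>s. integrable \<mu> (g s)" and l: "integrable \<mu> l"
  shows "((\<lambda>s. \<integral>x. g s x \<partial>\<mu>) \<longlongrightarrow> (\<integral>x. l x \<partial>\<mu>)) F"
proof (rule tendstoI)
  interpret prob_space \<mu> by (rule PinfD[OF \<mu>])
  fix e :: real assume e: "e > 0"
  have "\<forall>\<^sub>F s in F. \<forall>x\<in>UNIV. dist (g s x) (l x) < e / 2"
    by (rule uniform_limitD[OF lim]) (use e in simp)
  then show "\<forall>\<^sub>F s in F. dist (\<integral>x. g s x \<partial>\<mu>) (\<integral>x. l x \<partial>\<mu>) < e"
  proof eventually_elim
    case (elim s)
    have "\<bar>(\<integral>x. g s x \<partial>\<mu>) - (\<integral>x. l x \<partial>\<mu>)\<bar> = \<bar>\<integral>x. g s x - l x \<partial>\<mu>\<bar>"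
      by (simp add: Bochner_Integration.integral_diff[OF g l])
    also have "\<dots> \<le> (\<integral>x. \<bar>g s x - l x\<bar> \<partial>\<mu>)" by (rule integral_abs_bound)
    also have "\<dots> \<le> (\<integral>x. e / 2 \<partial>\<mu>)"
      by (rule integral_mono) (use g l elim in \<open>auto simp: dist_real_def less_imp_le\<close>)
    also have "\<dots> = e / 2" by (simp add: prob_space)
    finally show ?case using e by (simp add: dist_real_def)
  qed
qed

lemma chart_preimage_borel:
  assumes U: "(U, \<phi>) \<in> A" and B: "B \<in> sets borel"
  shows "U \<inter> \<phi> -` B \<in> sets borel"
proof -
  have "\<phi> \<in> borel_measurable (restrict_space borel U)"
    by (rule borel_measurable_continuous_on_restrict)
      (use chart(3)[OF U] in \<open>simp add: homeomorphism_def\<close>)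
  from measurable_sets[OF this B] have "\<phi> -` B \<inter> U \<in> sets (restrict_space borel U)"
    by (simp add: space_restrict_space)
  then have "\<phi> -` B \<inter> U \<in> sets borel"
    using chart(1)[OF U] by (subst (asm) sets_restrict_space_iff) auto
  then show ?thesis by (simp add: Int_commute)
qed

text \<open>The definition of \<open>Pinf\<close> describes \<mu> in a chart on Borel sets only.
  Identifying the image of the restricted measure with a density of Lebesgue measure extends the
  description to integrals.\<close>

lemma Pinf_chart_integral:
  assumes \<mu>: "\<mu> \<in> Pinf A" and U: "(U, \<phi>) \<in> A"
    and \<rho>: "smooth_on (\<phi> ` U) \<rho>"
      "\<And>B. B \<in> sets lborel \<Longrightarrow> B \<subseteq> \<phi> ` U \<Longrightarrow>
         emeasure \<mu> (U \<inter> \<phi> -` B) = (\<integral>\<^sup>+x\<in>B. ennreal (\<rho> x) \<partial>lborel)"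
    and h: "h \<in> borel_measurable borel"
  shows "(\<integral>\<^sup>+x. h (\<phi> x) * indicator U x \<partial>\<mu>) =
    (\<integral>\<^sup>+y. ennreal (\<rho> y) * indicator (\<phi> ` U) y * h y \<partial>lborel)"
proof -
  let ?R = "restrict_space \<mu> U"
  have s: "sets \<mu> = sets borel" by (rule PinfD[OF \<mu>])
  have U_sets: "U \<inter> space \<mu> \<in> sets \<mu>" using chart(1)[OF U] s by (simp add: PinfD[OF \<mu>])
  have V_sets: "\<phi> ` U \<in> sets borel" using chart(2)[OF U] by simp
  have sR: "sets ?R = sets (restrict_space borel U)"
    by (rule sets_restrict_space_cong[OF s])
  have spR: "space ?R = U" by (simp add: space_restrict_space PinfD[OF \<mu>])
  have "\<phi> \<in> borel_measurable (restrict_space borel U)"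
    by (rule borel_measurable_continuous_on_restrict)
      (use chart(3)[OF U] in \<open>simp add: homeomorphism_def\<close>)
  then have \<phi>: "\<phi> \<in> ?R \<rightarrow>\<^sub>M borel"
    using measurable_cong_sets[OF sR refl] by blast
  define k where "k y = ennreal (\<rho> y) * indicator (\<phi> ` U) y" for y
  have "(\<lambda>y. indicator (\<phi> ` U) y *\<^sub>R \<rho> y) \<in> borel_measurable borel"
    by (rule borel_measurable_continuous_on_indicator[OF V_sets smooth_on_continuous[OF \<rho>(1)]])
  then have "(\<lambda>y. ennreal (indicator (\<phi> ` U) y *\<^sub>R \<rho> y)) \<in> borel_measurable borel" by simp
  moreover have "(\<lambda>y. ennreal (indicator (\<phi> ` U) y *\<^sub>R \<rho> y)) = k"
    by (auto simp: k_def fun_eq_iff split: split_indicator)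
  ultimately have k: "k \<in> borel_measurable borel" by simp
  have N: "distr ?R borel \<phi> = density lborel k"
  proof (rule measure_eqI)
    show "sets (distr ?R borel \<phi>) = sets (density lborel k)" by simp
    fix B assume "B \<in> sets (distr ?R borel \<phi>)"
    then have B: "B \<in> sets borel" by simp
    have "emeasure (distr ?R borel \<phi>) B = emeasure ?R (\<phi> -` B \<inter> U)"
      using emeasure_distr[OF \<phi> B] by (simp add: spR)
    also have "\<dots> = emeasure \<mu> (U \<inter> \<phi> -` (B \<inter> \<phi> ` U))"
      by (subst emeasure_restrict_space[OF U_sets]) (auto intro!: arg_cong[of _ _ "emeasure \<mu>"])
    also have "\<dots> = (\<integral>\<^sup>+x\<in>B \<inter> \<phi> ` U. ennreal (\<rho> x) \<partial>lborel)"
      using B V_sets by (intro \<rho>(2)) auto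
    also have "\<dots> = (\<integral>\<^sup>+x\<in>B. k x \<partial>lborel)"
      by (intro nn_integral_cong) (auto simp: k_def split: split_indicator)
    also have "\<dots> = emeasure (density lborel k) B"
      using emeasure_density[of k lborel B] k B by simp
    finally show "emeasure (distr ?R borel \<phi>) B = emeasure (density lborel k) B" .
  qed
  have "(\<integral>\<^sup>+x. h (\<phi> x) * indicator U x \<partial>\<mu>) = (\<integral>\<^sup>+x. h (\<phi> x) \<partial>?R)"
    using nn_integral_restrict_space[OF U_sets, of "\<lambda>x. h (\<phi> x)"] by simp
  also have "\<dots> = (\<integral>\<^sup>+y. h y \<partial>distr ?R borel \<phi>)"
    using nn_integral_distr[OF \<phi>, of h] h by simp
  also have "\<dots> = (\<integral>\<^sup>+y. k y * h y \<partial>lborel)"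
    unfolding N using k h by (intro nn_integral_density) auto
  finally show ?thesis by (simp add: k_def)
qed

text \<open>In a chart the density of r \<mu> is the density of \<mu> times r in coordinates, which
  is again smooth and positive.\<close>

lemma Pinf_density:
  assumes \<mu>: "\<mu> \<in> Pinf A" and r: "smooth_fun A r" "\<And>x. r x > 0" and total: "(\<integral>x. r x \<partial>\<mu>) = 1"
  shows "density \<mu> (\<lambda>x. ennreal (r x)) \<in> Pinf A"
proof -
  let ?d = "density \<mu> (\<lambda>x. ennreal (r x))"
  have meas: "(\<lambda>x. ennreal (r x)) \<in> borel_measurable \<mu>"
    using Pinf_measurable[OF \<mu> r(1)] by simp
  have "emeasure ?d (space ?d) = (\<integral>\<^sup>+x. ennreal (r x) \<partial>\<mu>)"
    by (subst emeasure_density[OF meas]) (auto simp: PinfD[OF \<mu>])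
  also have "\<dots> = ennreal (\<integral>x. r x \<partial>\<mu>)"
    by (rule nn_integral_eq_integral[OF Pinf_integrable[OF \<mu> r(1)]]) (simp add: less_imp_le r(2))
  finally have "prob_space ?d" using total by (intro prob_spaceI) simp
  moreover have "\<exists>\<rho>. smooth_on (\<phi> ` U) \<rho> \<and> (\<forall>x\<in>\<phi> ` U. \<rho> x > 0) \<and>
      (\<forall>B\<in>sets lborel. B \<subseteq> \<phi> ` U \<longrightarrow>
         emeasure ?d (U \<inter> \<phi> -` B) = (\<integral>\<^sup>+x\<in>B. ennreal (\<rho> x) \<partial>lborel))"
    if U: "(U, \<phi>) \<in> A" for U \<phi>
  proof -
    obtain \<rho> where \<rho>: "smooth_on (\<phi> ` U) \<rho>" "\<And>x. x \<in> \<phi> ` U \<Longrightarrow> \<rho> x > 0"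
      "\<And>B. B \<in> sets lborel \<Longrightarrow> B \<subseteq> \<phi> ` U \<Longrightarrow>
         emeasure \<mu> (U \<inter> \<phi> -` B) = (\<integral>\<^sup>+x\<in>B. ennreal (\<rho> x) \<partial>lborel)"
      using \<mu> U unfolding Pinf_def by fastforce
    let ?r = "r \<circ> inv_into U \<phi>"
    have sr: "smooth_on (\<phi> ` U) ?r" by (rule smooth_fun_chart[OF r(1) U])
    show ?thesis
    proof (intro exI[of _ "\<lambda>y. \<rho> y * ?r y"] conjI ballI impI)
      show "smooth_on (\<phi> ` U) (\<lambda>y. \<rho> y * ?r y)"
        by (rule smooth_on_mult[OF chart(2)[OF U] \<rho>(1) sr])
      show "\<rho> y * ?r y > 0" if "y \<in> \<phi> ` U" for y
        using \<rho>(2)[OF that] r(2) by simp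
      fix B assume B: "B \<in> sets lborel" "B \<subseteq> \<phi> ` U"
      define h where "h y = ennreal (indicator B y *\<^sub>R ?r y)" for y
      have "continuous_on B ?r"
        by (rule continuous_on_subset[OF smooth_on_continuous[OF sr] B(2)])
      then have "(\<lambda>y. indicator B y *\<^sub>R ?r y) \<in> borel_measurable borel"
        using B(1) by (intro borel_measurable_continuous_on_indicator) auto
      then have h: "h \<in> borel_measurable borel" unfolding h_def[abs_def] by simp
      have E: "U \<inter> \<phi> -` B \<in> sets \<mu>"
        using chart_preimage_borel[OF U] B(1) by (simp add: PinfD[OF \<mu>])
      have "emeasure ?d (U \<inter> \<phi> -` B) = (\<integral>\<^sup>+x. h (\<phi> x) * indicator U x \<partial>\<mu>)"
        unfolding emeasure_density[OF meas E]
        by (intro nn_integral_cong) (auto simp: h_def chart_inv[OF U] split: split_indicator)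
      also have "\<dots> = (\<integral>\<^sup>+y. ennreal (\<rho> y) * indicator (\<phi> ` U) y * h y \<partial>lborel)"
        by (rule Pinf_chart_integral[OF \<mu> U \<rho>(1,3) h])
      also have "\<dots> = (\<integral>\<^sup>+y\<in>B. ennreal (\<rho> y * ?r y) \<partial>lborel)"
      proof (intro nn_integral_cong)
        fix y
        show "ennreal (\<rho> y) * indicator (\<phi> ` U) y * h y = ennreal (\<rho> y * ?r y) * indicator B y"
        proof (cases "y \<in> B")
          case True
          then have y: "y \<in> \<phi> ` U" using B(2) by blast
          then show ?thesis
            using True \<rho>(2)[OF y] by (simp add: h_def ennreal_mult' less_imp_le)
        qed (simp add: h_def)
      qed
      finally show "emeasure ?d (U \<inter> \<phi> -` B) = (\<integral>\<^sup>+y\<in>B. ennreal (\<rho> y * ?r y) \<partial>lborel)" .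
    qed
  qed
  ultimately show ?thesis using PinfD(2)[OF \<mu>] by (auto simp: Pinf_def)
qed

text \<open>A nonempty open set in a chart is not Lebesgue negligible, and the density is positive
  on it. Through this a vanishing integral of a square forces a smooth function to be 0.\<close>

lemma Pinf_open_positive:
  assumes \<mu>: "\<mu> \<in> Pinf A" and W: "open W" "x \<in> W"
  shows "emeasure \<mu> W \<noteq> 0"
proof (cases x rule: chart_cases)
  case (in_chart U \<phi>)
  obtain \<rho> where \<rho>: "smooth_on (\<phi> ` U) \<rho>" "\<And>x. x \<in> \<phi> ` U \<Longrightarrow> \<rho> x > 0"
    "\<And>B. B \<in> sets lborel \<Longrightarrow> B \<subseteq> \<phi> ` U \<Longrightarrow>
       emeasure \<mu> (U \<inter> \<phi> -` B) = (\<integral>\<^sup>+x\<in>B. ennreal (\<rho> x) \<partial>lborel)"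
    using \<mu> in_chart(1) unfolding Pinf_def by fastforce
  define B where "B = \<phi> ` (U \<inter> W)"
  have B: "open B" "\<phi> x \<in> B" "B \<subseteq> \<phi> ` U"
    using open_chart_image[OF in_chart(1) W(1)] in_chart(2) W(2) by (auto simp: B_def)
  have "(\<integral>\<^sup>+x\<in>B. ennreal (\<rho> x) \<partial>lborel) \<noteq> 0"
  proof
    assume 0: "(\<integral>\<^sup>+x\<in>B. ennreal (\<rho> x) \<partial>lborel) = 0"
    have "(\<lambda>y. indicator B y *\<^sub>R \<rho> y) \<in> borel_measurable borel"
      using B smooth_on_continuous[OF smooth_on_subset[OF \<rho>(1) B(3)]]
      by (intro borel_measurable_continuous_on_indicator) auto
    then have "(\<lambda>y. ennreal (indicator B y *\<^sub>R \<rho> y)) \<in> borel_measurable lborel" by simp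
    moreover have "(\<lambda>y. ennreal (indicator B y *\<^sub>R \<rho> y)) = (\<lambda>y. ennreal (\<rho> y) * indicator B y)"
      by (auto simp: fun_eq_iff split: split_indicator)
    ultimately have "AE y in lborel. ennreal (\<rho> y) * indicator B y = 0"
      using 0 by (simp add: nn_integral_0_iff_AE)
    moreover have "\<not> \<rho> y \<le> 0" if "y \<in> B" for y
      using \<rho>(2)[of y] B(3) that by auto
    ultimately have "AE y in lborel. y \<notin> B"
      by (elim AE_mp, intro AE_I2) (auto simp: ennreal_eq_0_iff)
    then have "B \<in> null_sets lborel"
      using B(1) by (subst (asm) AE_iff_null_sets[symmetric]) auto
    then have "negligible B"
      using negligible_iff_null_sets null_sets_completionI by blast
    then show False using open_not_negligible[OF B(1)] B(2) by blast
  qed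
  then have "emeasure \<mu> (U \<inter> \<phi> -` B) \<noteq> 0" using \<rho>(3)[of B] B by auto
  moreover have "U \<inter> \<phi> -` B \<subseteq> W"
  proof
    fix y assume "y \<in> U \<inter> \<phi> -` B"
    then obtain z where "y \<in> U" "z \<in> U" "z \<in> W" "\<phi> y = \<phi> z" by (auto simp: B_def)
    then show "y \<in> W" using chart_inv[OF in_chart(1)] by metis
  qed
  moreover have "W \<in> sets \<mu>" using W(1) PinfD(2)[OF \<mu>] by simp
  ultimately show ?thesis using emeasure_mono[of "U \<inter> \<phi> -` B" W \<mu>] by auto
next
  case point
  have "y \<in> W" for y
  proof -
    have "y \<in> {x}" unfolding point(2)[symmetric] by simp
    then show ?thesis using W(2) by simp
  qed
  then have "W = space \<mu>" using PinfD(3)[OF \<mu>] by auto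
  then show ?thesis using prob_space.emeasure_space_1[OF PinfD(1)[OF \<mu>]] by simp
qed

lemma Pinf_integral_square_zero:
  assumes \<mu>: "\<mu> \<in> Pinf A" and f: "smooth_fun A f" and 0: "(\<integral>x. f x * f x \<partial>\<mu>) = 0"
  shows "f x = 0"
proof (rule ccontr)
  assume "f x \<noteq> 0"
  have "AE x in \<mu>. f x * f x = 0"
    using integral_nonneg_eq_0_iff_AE[OF Pinf_integrable[OF \<mu> smooth_fun_mult[OF f f]]] 0 by simp
  then have "AE x in \<mu>. x \<notin> {x. f x \<noteq> 0}" by (rule AE_mp) simp
  moreover have o: "open {x. f x \<noteq> 0}"
    using smooth_fun_continuous[OF f] by (intro open_Collect_neq) auto
  moreover have "{x. f x \<noteq> 0} \<in> sets \<mu>" using o PinfD(2)[OF \<mu>] by simp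
  ultimately have "emeasure \<mu> {x. f x \<noteq> 0} = 0"
    by (subst (asm) AE_iff_null_sets[symmetric]) auto
  then show False using Pinf_open_positive[OF \<mu> o, of x] \<open>f x \<noteq> 0\<close> by simp
qed

lemma integral_density_Pinf:
  assumes \<mu>: "\<mu> \<in> Pinf A" and r: "smooth_fun A r" "\<And>x. r x > 0" and f: "smooth_fun A f"
  shows "(\<integral>x. f x \<partial>density \<mu> (\<lambda>x. ennreal (r x))) = (\<integral>x. f x * r x \<partial>\<mu>)"
  using integral_density[OF Pinf_measurable[OF \<mu> f] Pinf_measurable[OF \<mu> r(1)]] r(2)
  by (simp add: less_imp_le mult.commute)

end

section \<open>Smooth curves of functions and of measures\<close>

lemma uniform_limit_scale:
  fixes a :: "'x \<Rightarrow> real"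
  assumes q: "(q \<longlongrightarrow> l) F" and a: "bounded (a ` K)"
  shows "uniform_limit K (\<lambda>s x. q s * a x) (\<lambda>x. l * a x) F"
proof (rule uniform_lim_mult[OF _ uniform_limit_const _ a])
  show "uniform_limit K (\<lambda>s x. q s) (\<lambda>x. l) F"
    using q by (auto intro!: uniform_limitI dest: tendstoD elim: eventually_mono)
  show "bounded ((\<lambda>x. l) ` K)"
    by (rule bounded_subset[of "{l}"]) auto
qed

context closed_manifold
begin

lemma smooth_tendsto_const: "smooth_tendsto A (\<lambda>s. f) f F"
  by (auto simp: smooth_tendsto_def intro: uniform_limit_const)

text \<open>Only the real coefficients vary, so it suffices that iterated derivatives are linear and
  that those of \<open>a\<close> and \<open>b\<close> are bounded on compact sets.\<close>

lemma smooth_tendsto_lincomb: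
  assumes q: "(q1 \<longlongrightarrow> l1) F" "(q2 \<longlongrightarrow> l2) F" and a: "smooth_fun A a" and b: "smooth_fun A b"
  shows "smooth_tendsto A (\<lambda>s x. q1 s * a x + q2 s * b x) (\<lambda>x. l1 * a x + l2 * b x) F"
proof -
  have "uniform_limit K (\<lambda>s. iter_deriv vs ((\<lambda>x. q1 s * a x + q2 s * b x) \<circ> inv_into U \<phi>))
      (iter_deriv vs ((\<lambda>x. l1 * a x + l2 * b x) \<circ> inv_into U \<phi>)) F"
    if U: "(U, \<phi>) \<in> A" and K: "compact K" "K \<subseteq> \<phi> ` U" for U \<phi> K vs
  proof -
    have lin: "iter_deriv vs ((\<lambda>x. c * a x + d * b x) \<circ> inv_into U \<phi>) y =
        c * iter_deriv vs (a \<circ> inv_into U \<phi>) y + d * iter_deriv vs (b \<circ> inv_into U \<phi>) y"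
      if "y \<in> K" for c d y
      using iter_deriv_linear[OF chart(2)[OF U] smooth_fun_chart[OF a U] smooth_fun_chart[OF b U],
          of y vs c d] that K(2) by (auto simp: comp_def)
    have bdd: "bounded (iter_deriv vs (h \<circ> inv_into U \<phi>) ` K)" if "smooth_fun A h" for h
      by (intro compact_imp_bounded compact_continuous_image K(1) continuous_on_subset[OF _ K(2)]
          smooth_on_continuous smooth_on_iter_deriv smooth_fun_chart[OF that U])
    have "uniform_limit K
        (\<lambda>s y. q1 s * iter_deriv vs (a \<circ> inv_into U \<phi>) y + q2 s * iter_deriv vs (b \<circ> inv_into U \<phi>) y)
        (\<lambda>y. l1 * iter_deriv vs (a \<circ> inv_into U \<phi>) y + l2 * iter_deriv vs (b \<circ> inv_into U \<phi>) y) F"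
      by (intro uniform_limit_add uniform_limit_scale q bdd a b)
    then show ?thesis
      by (subst uniform_limit_cong') (rule lin, assumption)+
  qed
  moreover have "uniform_limit UNIV (\<lambda>s x. q1 s * a x + q2 s * b x) (\<lambda>x. l1 * a x + l2 * b x) F"
    by (intro uniform_limit_add uniform_limit_scale q smooth_fun_bounded a b)
  ultimately show ?thesis unfolding smooth_tendsto_def by blast
qed

text \<open>The existential witness of \<open>smooth_fun_curve\<close>. It is kept as an object
  because the velocity \<open>D 1 0\<close> appears in the formulas for double brackets.\<close>

definition derivative_tower :: "(nat \<Rightarrow> real \<Rightarrow> 'a \<Rightarrow> real) \<Rightarrow> bool" where
  "derivative_tower D \<longleftrightarrow> (\<forall>k t. smooth_fun A (D k t) \<and>
     smooth_tendsto A (\<lambda>s x. (D k (t + s) x - D k t x) / s) (D (Suc k) t) (at 0))"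

lemma smooth_fun_curve_tower: "smooth_fun_curve A r \<longleftrightarrow> (\<exists>D. D 0 = r \<and> derivative_tower D)"
  unfolding smooth_fun_curve_def derivative_tower_def by blast

lemma tower_smooth: "derivative_tower D \<Longrightarrow> smooth_fun A (D k t)"
  unfolding derivative_tower_def by blast

lemma tower_tendsto:
  "derivative_tower D \<Longrightarrow> smooth_tendsto A (\<lambda>s x. (D k (t + s) x - D k t x) / s) (D (Suc k) t) (at 0)"
  unfolding derivative_tower_def by blast

text \<open>The fixed summand \<open>a0\<close> survives only in order 0, whence the case
  distinction. Two moving directions suffice for curves in a plane spanned by two tangent
  vectors.\<close>

lemma tower_affine:
  assumes a0: "smooth_fun A a0" and a: "smooth_fun A a" and b: "smooth_fun A b"
    and \<sigma>: "smooth_on UNIV \<sigma>" and \<tau>: "smooth_on UNIV \<tau>"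
  shows "derivative_tower (\<lambda>k t x. (if k = 0 then a0 x else 0) + nderiv k \<sigma> t * a x + nderiv k \<tau> t * b x)"
    (is "derivative_tower ?D")
  unfolding derivative_tower_def
proof (intro allI conjI)
  fix k :: nat and t :: real
  have "smooth_fun A (\<lambda>x. if k = 0 then a0 x else 0)"
    using a0 smooth_fun_const[of 0] by (cases "k = 0") auto
  then show "smooth_fun A (?D k t)"
    by (intro smooth_fun_add smooth_fun_mult smooth_fun_const a b)
  have q: "((\<lambda>s. (nderiv k f (t + s) - nderiv k f t) / s) \<longlongrightarrow> nderiv (Suc k) f t) (at 0)"
    if "smooth_on UNIV f" for f
    using nderiv_has_derivative[OF that UNIV_I, of k t] unfolding DERIV_def .
  have "(\<lambda>s x. (?D k (t + s) x - ?D k t x) / s) = (\<lambda>s x.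
      ((nderiv k \<sigma> (t + s) - nderiv k \<sigma> t) / s) * a x + ((nderiv k \<tau> (t + s) - nderiv k \<tau> t) / s) * b x)"
    by (simp add: fun_eq_iff diff_divide_distrib add_divide_distrib algebra_simps del: iter_deriv.simps replicate.simps)
  moreover have "?D (Suc k) t = (\<lambda>x. nderiv (Suc k) \<sigma> t * a x + nderiv (Suc k) \<tau> t * b x)"
    by simp
  ultimately show "smooth_tendsto A (\<lambda>s x. (?D k (t + s) x - ?D k t x) / s) (?D (Suc k) t) (at 0)"
    using smooth_tendsto_lincomb[OF q[OF \<sigma>] q[OF \<tau>] a b] by (simp only:)
qed

lemma tower_const:
  assumes "smooth_fun A f"
  shows "derivative_tower (\<lambda>k t. if k = 0 then f else (\<lambda>x. 0))"
proof -
  have "(\<lambda>k t x. (if k = 0 then f x else 0) + nderiv k (\<lambda>t. 0) t * 0 + nderiv k (\<lambda>t. 0) t * 0) =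
      (\<lambda>k (t::real). if k = (0::nat) then f else (\<lambda>x. 0))"
    by (simp add: fun_eq_iff del: iter_deriv.simps replicate.simps)
  with tower_affine[OF assms smooth_fun_const[of 0] smooth_fun_const[of 0]
      smooth_on_const[OF open_UNIV, of 0] smooth_on_const[OF open_UNIV, of 0]]
  show ?thesis by (simp only:)
qed

lemma smooth_fun_curve_const: "smooth_fun A f \<Longrightarrow> smooth_fun_curve A (\<lambda>t. f)"
  unfolding smooth_fun_curve_tower using tower_const[of f] by (intro exI conjI) auto

text \<open>The difference quotients converge uniformly and the weight \<open>w\<close> is bounded,
  so the limit passes under the integral.\<close>

lemma tower_integral_derivative:
  assumes D: "derivative_tower D" and \<mu>: "\<mu> \<in> Pinf A" and w: "smooth_fun A w"
  shows "((\<lambda>t. \<integral>x. D k t x * w x \<partial>\<mu>) has_real_derivative (\<integral>x. D (Suc k) t x * w x \<partial>\<mu>)) (at t)"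
proof -
  let ?q = "\<lambda>s x. (D k (t + s) x - D k t x) / s"
  note s = tower_smooth[OF D]
  have q: "smooth_fun A (?q s)" for s
    using smooth_fun_lincomb[OF s s, of "1 / s" k "t + s" "- 1 / s" k t]
    by (simp add: diff_divide_distrib)
  have int: "integrable \<mu> (\<lambda>x. f x * w x)" if "smooth_fun A f" for f
    by (rule Pinf_integrable[OF \<mu> smooth_fun_mult[OF that w]])
  have "uniform_limit UNIV ?q (D (Suc k) t) (at 0)"
    using tower_tendsto[OF D] unfolding smooth_tendsto_def by blast
  then have "uniform_limit UNIV (\<lambda>s x. ?q s x * w x) (\<lambda>x. D (Suc k) t x * w x) (at 0)"
    by (intro uniform_lim_mult uniform_limit_const smooth_fun_bounded s w)
  from integral_uniform_limit[OF \<mu> this int[OF q] int[OF s]]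
  have "((\<lambda>s. \<integral>x. ?q s x * w x \<partial>\<mu>) \<longlongrightarrow> (\<integral>x. D (Suc k) t x * w x \<partial>\<mu>)) (at 0)" .
  moreover have "(\<integral>x. ?q s x * w x \<partial>\<mu>) = ((\<integral>x. D k (t + s) x * w x \<partial>\<mu>) - (\<integral>x. D k t x * w x \<partial>\<mu>)) / s" for s
  proof -
    have "(\<integral>x. ?q s x * w x \<partial>\<mu>) = (\<integral>x. (D k (t + s) x * w x - D k t x * w x) / s \<partial>\<mu>)"
      by (simp add: left_diff_distrib)
    then show ?thesis
      by (simp add: Bochner_Integration.integral_diff[OF int[OF s] int[OF s]])
  qed
  ultimately show ?thesis unfolding DERIV_def by (simp only:)
qed

lemma tower_integral_smooth:
  assumes "derivative_tower D" "\<mu> \<in> Pinf A" "smooth_fun A w"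
  shows "smooth_on UNIV (\<lambda>t. \<integral>x. D k t x * w x \<partial>\<mu>)"
  by (rule smooth_on_derivative_tower[where D = "\<lambda>k t. \<integral>x. D k t x * w x \<partial>\<mu>",
        OF open_UNIV tower_integral_derivative[OF assms]])

lemma Pinf_curve_tower:
  assumes "Pinf_curve A c"
  obtains \<nu> D where "\<nu> \<in> Pinf A" "derivative_tower D" "\<And>t x. D 0 t x > 0" "\<And>t. c t \<in> Pinf A"
    "\<And>t. c t = density \<nu> (\<lambda>x. ennreal (D 0 t x))"
proof -
  obtain \<nu> r where *: "\<nu> \<in> Pinf A" "smooth_fun_curve A r"
    "\<forall>t. (\<forall>x. r t x > 0) \<and> c t \<in> Pinf A \<and> c t = density \<nu> (\<lambda>x. ennreal (r t x))"
    using assms unfolding Pinf_curve_def by blast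
  obtain D where D: "D 0 = r" "derivative_tower D"
    using *(2) unfolding smooth_fun_curve_tower by blast
  show thesis
  proof (rule that[OF *(1) D(2)])
    show "D 0 t x > 0" "c t = density \<nu> (\<lambda>x. ennreal (D 0 t x))" "c t \<in> Pinf A" for t x
      unfolding D(1) using *(3) by blast+
  qed
qed

lemma F_fun_curve_derivative:
  assumes \<nu>: "\<nu> \<in> Pinf A" and D: "derivative_tower D" "\<And>t x. D 0 t x > 0"
    and c: "\<And>t. c t = density \<nu> (\<lambda>x. ennreal (D 0 t x))" and \<phi>: "smooth_fun A \<phi>"
  shows "smooth_on UNIV (F_fun \<phi> \<circ> c)"
    "((F_fun \<phi> \<circ> c) has_real_derivative (\<integral>x. D 1 t x * \<phi> x \<partial>\<nu>)) (at t)"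
proof -
  have F: "F_fun \<phi> \<circ> c = (\<lambda>t. \<integral>x. D 0 t x * \<phi> x \<partial>\<nu>)"
    using integral_density_Pinf[OF \<nu> tower_smooth[OF D(1)] D(2) \<phi>]
    by (simp add: fun_eq_iff F_fun_def c mult.commute)
  show "smooth_on UNIV (F_fun \<phi> \<circ> c)"
    unfolding F by (rule tower_integral_smooth[OF D(1) \<nu> \<phi>])
  show "((F_fun \<phi> \<circ> c) has_real_derivative (\<integral>x. D 1 t x * \<phi> x \<partial>\<nu>)) (at t)"
    unfolding F using tower_integral_derivative[OF D(1) \<nu> \<phi>, of 0 t] by simp
qed

text \<open>The same \<phi> represents the differential of F_\<phi> at every measure, so a constant
  curve of functions serves.\<close>

lemma F_fun_Pinf_fun:
  assumes \<phi>: "smooth_fun A \<phi>"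
  shows "Pinf_fun A (F_fun \<phi>)"
  unfolding Pinf_fun_def
proof (intro conjI allI impI)
  fix c assume c: "Pinf_curve A c"
  show "smooth_on UNIV (F_fun \<phi> \<circ> c)"
    by (rule Pinf_curve_tower[OF c]) (rule F_fun_curve_derivative(1)[OF _ _ _ _ \<phi>])
  show "\<exists>\<psi>. smooth_fun_curve A \<psi> \<and> (\<forall>t \<gamma>. Pinf_curve A \<gamma> \<and> \<gamma> 0 = c t \<longrightarrow>
      deriv (F_fun \<phi> \<circ> \<gamma>) 0 = deriv (F_fun (\<psi> t) \<circ> \<gamma>) 0)"
    by (rule exI[of _ "\<lambda>t. \<phi>"]) (simp add: smooth_fun_curve_const[OF \<phi>])
qed

text \<open>The velocity of r(t) \<nu> at 0 is r'(0) \<nu>, whose density with respect to \<mu> =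
  r(0) \<nu> is a = r'(0) / r(0). Its total mass is 0 because every measure on the curve has mass
  1.\<close>

lemma Pinf_curve_velocity:
  assumes c: "Pinf_curve A c" "c 0 = \<mu>"
  obtains a where "smooth_fun A a" "(\<integral>x. a x \<partial>\<mu>) = 0"
    "\<And>\<phi>. smooth_fun A \<phi> \<Longrightarrow> deriv (F_fun \<phi> \<circ> c) 0 = (\<integral>x. \<phi> x * a x \<partial>\<mu>)"
proof -
  obtain \<nu> D where \<nu>: "\<nu> \<in> Pinf A" and D: "derivative_tower D" "\<And>t x. D 0 t x > 0"
    and ct: "\<And>t. c t \<in> Pinf A" "\<And>t. c t = density \<nu> (\<lambda>x. ennreal (D 0 t x))"
    by (rule Pinf_curve_tower[OF c(1)]) (rule that)
  define a where "a x = D 1 0 x * inverse (D 0 0 x)" for x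
  have pos: "D 0 0 x \<noteq> 0" for x using D(2)[of 0 x] by simp
  have a: "smooth_fun A a"
    unfolding a_def[abs_def]
    by (intro smooth_fun_mult smooth_fun_inverse tower_smooth D pos)
  have main: "deriv (F_fun \<phi> \<circ> c) 0 = (\<integral>x. \<phi> x * a x \<partial>\<mu>)" if \<phi>: "smooth_fun A \<phi>" for \<phi>
  proof -
    have "deriv (F_fun \<phi> \<circ> c) 0 = (\<integral>x. D 1 0 x * \<phi> x \<partial>\<nu>)"
      by (rule DERIV_imp_deriv[OF F_fun_curve_derivative(2)[OF \<nu> D ct(2) \<phi>]])
    also have "\<dots> = (\<integral>x. \<phi> x * a x * D 0 0 x \<partial>\<nu>)"
      by (rule Bochner_Integration.integral_cong) (simp_all add: a_def pos)
    also have "\<dots> = (\<integral>x. \<phi> x * a x \<partial>\<mu>)"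
      unfolding c(2)[symmetric] ct(2)
      by (rule integral_density_Pinf[OF \<nu> tower_smooth[OF D(1)] D(2) smooth_fun_mult[OF \<phi> a], symmetric])
    finally show ?thesis .
  qed
  have "F_fun (\<lambda>x. 1) \<circ> c = (\<lambda>t. 1)"
    using prob_space.prob_space[OF PinfD(1)[OF ct(1)]] by (simp add: F_fun_def fun_eq_iff)
  then have "(\<integral>x. a x \<partial>\<mu>) = 0" using main[OF smooth_fun_const[of 1]] by simp
  then show thesis using that a main by blast
qed

lemma Pinf_curve_const:
  assumes \<mu>: "\<mu> \<in> Pinf A"
  shows "Pinf_curve A (\<lambda>t. \<mu>)"
  unfolding Pinf_curve_def
proof (intro bexI[OF _ \<mu>] exI[of _ "\<lambda>t x. 1"] conjI allI)
  show "smooth_fun_curve A (\<lambda>t x. 1)" by (rule smooth_fun_curve_const[OF smooth_fun_const])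
  show "\<mu> = density \<mu> (\<lambda>x. ennreal 1)" by (simp add: density_1)
qed (use \<mu> in auto)

text \<open>The relation df = dF_\<phi> at \<open>m\<close>, tested on velocities of curves. It is
  the second clause of \<open>Pinf_fun\<close> at a single point, and it turns first derivatives of
  \<open>f\<close> into integrals.\<close>

definition represents :: "('a measure \<Rightarrow> real) \<Rightarrow> 'a measure \<Rightarrow> ('a \<Rightarrow> real) \<Rightarrow> bool" where
  "represents f m \<phi> \<longleftrightarrow> smooth_fun A \<phi> \<and>
     (\<forall>\<gamma>. Pinf_curve A \<gamma> \<longrightarrow> \<gamma> 0 = m \<longrightarrow> deriv (f \<circ> \<gamma>) 0 = deriv (F_fun \<phi> \<circ> \<gamma>) 0)"

lemma represents_smooth: "represents f m \<phi> \<Longrightarrow> smooth_fun A \<phi>"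
  by (simp add: represents_def)

lemma represents_deriv:
  "represents f m \<phi> \<Longrightarrow> Pinf_curve A \<gamma> \<Longrightarrow> \<gamma> 0 = m \<Longrightarrow> deriv (f \<circ> \<gamma>) 0 = deriv (F_fun \<phi> \<circ> \<gamma>) 0"
  unfolding represents_def by blast

lemma Pinf_fun_represents_curve:
  assumes "Pinf_fun A f" "Pinf_curve A c"
  obtains D where "derivative_tower D" "\<And>t. represents f (c t) (D 0 t)"
proof -
  obtain \<psi> where \<psi>: "smooth_fun_curve A \<psi>"
    "\<forall>t \<gamma>. Pinf_curve A \<gamma> \<and> \<gamma> 0 = c t \<longrightarrow> deriv (f \<circ> \<gamma>) 0 = deriv (F_fun (\<psi> t) \<circ> \<gamma>) 0"
    using assms unfolding Pinf_fun_def by blast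
  obtain D where D: "D 0 = \<psi>" "derivative_tower D"
    using \<psi>(1) unfolding smooth_fun_curve_tower by blast
  have "represents f (c t) (D 0 t)" for t
    unfolding represents_def using \<psi>(2) tower_smooth[OF D(2)] D(1) by blast
  with D(2) show thesis by (rule that)
qed

lemma Pinf_fun_represents:
  assumes "Pinf_fun A f" "\<mu> \<in> Pinf A"
  obtains \<phi> where "represents f \<mu> \<phi>"
  by (rule Pinf_fun_represents_curve[OF assms(1) Pinf_curve_const[OF assms(2)]]) (rule that)

lemma Pinf_fun_curve_derivative:
  assumes "Pinf_fun A f" "Pinf_curve A c"
  shows "((f \<circ> c) has_real_derivative deriv (f \<circ> c) 0) (at 0)"
proof -
  have "smooth_on UNIV (f \<circ> c)" using assms unfolding Pinf_fun_def by blast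
  from smooth_on_has_real_derivative[OF this, of 0] DERIV_imp_deriv show ?thesis by fastforce
qed

end

section \<open>Affine two-parameter families of measures and symmetry of the Hessian\<close>

locale perturbation = closed_manifold A
  for A :: "('a::t2_space, 'e::euclidean_space) chart set" +
  fixes \<mu> :: "'a measure" and a b :: "'a \<Rightarrow> real" and r :: real
  assumes \<mu>: "\<mu> \<in> Pinf A" and a: "smooth_fun A a" "(\<integral>x. a x \<partial>\<mu>) = 0"
    and b: "smooth_fun A b" "(\<integral>x. b x \<partial>\<mu>) = 0"
    and r: "r > 0" "\<And>x. r * (\<bar>a x\<bar> + \<bar>b x\<bar>) < 1"
begin

text \<open>The bound on \<open>r\<close> makes this density positive for |s|, |t| < r, and the
  vanishing integrals of \<open>a\<close> and \<open>b\<close> keep the total mass equal to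
  1.\<close>

definition perturb :: "real \<Rightarrow> real \<Rightarrow> 'a measure" where
  "perturb s t = density \<mu> (\<lambda>x. ennreal (1 + s * a x + t * b x))"

lemma perturb_pos:
  assumes "\<bar>s\<bar> < r" "\<bar>t\<bar> < r"
  shows "1 + s * a x + t * b x > 0"
proof -
  have "\<bar>s * a x\<bar> \<le> r * \<bar>a x\<bar>" "\<bar>t * b x\<bar> \<le> r * \<bar>b x\<bar>"
    unfolding abs_mult using assms by (auto intro!: mult_right_mono)
  then show ?thesis using r(2)[of x] unfolding distrib_left by linarith
qed

lemma smooth_perturb: "smooth_fun A (\<lambda>x. 1 + s * a x + t * b x)"
  by (intro smooth_fun_add smooth_fun_mult smooth_fun_const a b)

lemma integral_perturb:
  assumes \<phi>: "smooth_fun A \<phi>"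
  shows "(\<integral>x. \<phi> x * (1 + s * a x + t * b x) \<partial>\<mu>) =
    (\<integral>x. \<phi> x \<partial>\<mu>) + s * (\<integral>x. \<phi> x * a x \<partial>\<mu>) + t * (\<integral>x. \<phi> x * b x \<partial>\<mu>)"
proof -
  note i = Pinf_integrable[OF \<mu>]
  have "(\<integral>x. \<phi> x * (1 + s * a x + t * b x) \<partial>\<mu>) =
      (\<integral>x. \<phi> x + s * (\<phi> x * a x) + t * (\<phi> x * b x) \<partial>\<mu>)"
    by (rule Bochner_Integration.integral_cong) (simp_all add: algebra_simps)
  then show ?thesis
    using i[OF \<phi>] i[OF smooth_fun_mult[OF \<phi> a(1)]] i[OF smooth_fun_mult[OF \<phi> b(1)]] by simp
qed

lemma perturb_Pinf:
  assumes "\<bar>s\<bar> < r" "\<bar>t\<bar> < r"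
  shows "perturb s t \<in> Pinf A"
  unfolding perturb_def
proof (rule Pinf_density[OF \<mu> smooth_perturb perturb_pos[OF assms]])
  show "(\<integral>x. 1 + s * a x + t * b x \<partial>\<mu>) = 1"
    using integral_perturb[OF smooth_fun_const[of 1], of s t] a(2) b(2)
      prob_space.prob_space[OF PinfD(1)[OF \<mu>]] by simp
qed

lemma F_fun_perturb:
  assumes "\<bar>s\<bar> < r" "\<bar>t\<bar> < r" "smooth_fun A \<phi>"
  shows "F_fun \<phi> (perturb s t) = (\<integral>x. \<phi> x \<partial>\<mu>) + s * (\<integral>x. \<phi> x * a x \<partial>\<mu>) + t * (\<integral>x. \<phi> x * b x \<partial>\<mu>)"
  unfolding F_fun_def perturb_def
    integral_density_Pinf[OF \<mu> smooth_perturb perturb_pos[OF assms(1,2)] assms(3)]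
  by (rule integral_perturb[OF assms(3)])

lemma perturb_curve:
  assumes \<sigma>: "smooth_on UNIV \<sigma>" "\<And>t. \<bar>\<sigma> t\<bar> < r" and \<tau>: "smooth_on UNIV \<tau>" "\<And>t. \<bar>\<tau> t\<bar> < r"
  shows "Pinf_curve A (\<lambda>t. perturb (\<sigma> t) (\<tau> t))"
  unfolding Pinf_curve_def
proof (intro bexI[OF _ \<mu>] exI[of _ "\<lambda>t x. 1 + \<sigma> t * a x + \<tau> t * b x"] conjI allI)
  show "smooth_fun_curve A (\<lambda>t x. 1 + \<sigma> t * a x + \<tau> t * b x)"
    unfolding smooth_fun_curve_tower
  proof (intro exI conjI)
    show "derivative_tower (\<lambda>k t x. (if k = 0 then 1 else 0) + nderiv k \<sigma> t * a x + nderiv k \<tau> t * b x)"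
      by (rule tower_affine[OF smooth_fun_const a(1) b(1) \<sigma>(1) \<tau>(1)])
  qed simp
qed (use perturb_pos[OF \<sigma>(2) \<tau>(2)] perturb_Pinf[OF \<sigma>(2) \<tau>(2)] in \<open>auto simp: perturb_def\<close>)

text \<open>Representing functions describe derivatives at time 0, so the curve is shifted by
  \<open>t0\<close>. On the square of parameters F_\<phi> is affine, which gives its derivative
  along the curve, and \<open>f\<close> has the same one.\<close>

lemma perturb_derivative:
  assumes f: "Pinf_fun A f" and \<sigma>: "smooth_on UNIV \<sigma>" "\<And>t. \<bar>\<sigma> t\<bar> < r" "(\<sigma> has_real_derivative \<sigma>') (at t0)"
    and \<tau>: "smooth_on UNIV \<tau>" "\<And>t. \<bar>\<tau> t\<bar> < r" "(\<tau> has_real_derivative \<tau>') (at t0)"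
    and \<phi>: "represents f (perturb (\<sigma> t0) (\<tau> t0)) \<phi>"
  shows "((\<lambda>t. f (perturb (\<sigma> t) (\<tau> t))) has_real_derivative
    \<sigma>' * (\<integral>x. \<phi> x * a x \<partial>\<mu>) + \<tau>' * (\<integral>x. \<phi> x * b x \<partial>\<mu>)) (at t0)"
proof -
  define \<gamma> where "\<gamma> t = perturb (\<sigma> (1 * t + t0)) (\<tau> (1 * t + t0))" for t
  have \<gamma>: "Pinf_curve A \<gamma>"
    unfolding \<gamma>_def[abs_def]
    by (rule perturb_curve[OF smooth_on_affine_compose[OF \<sigma>(1)] \<sigma>(2)
          smooth_on_affine_compose[OF \<tau>(1)] \<tau>(2)])
  have "((\<lambda>t. (\<integral>x. \<phi> x \<partial>\<mu>) + \<sigma> t * (\<integral>x. \<phi> x * a x \<partial>\<mu>) + \<tau> t * (\<integral>x. \<phi> x * b x \<partial>\<mu>))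
      has_real_derivative \<sigma>' * (\<integral>x. \<phi> x * a x \<partial>\<mu>) + \<tau>' * (\<integral>x. \<phi> x * b x \<partial>\<mu>)) (at (0 + t0))"
    by (rule derivative_eq_intros refl | use \<sigma>(3) \<tau>(3) in simp)+
  then have "((F_fun \<phi> \<circ> \<gamma>) has_real_derivative
      \<sigma>' * (\<integral>x. \<phi> x * a x \<partial>\<mu>) + \<tau>' * (\<integral>x. \<phi> x * b x \<partial>\<mu>)) (at 0)"
    unfolding DERIV_shift
    using F_fun_perturb[OF \<sigma>(2) \<tau>(2) represents_smooth[OF \<phi>]] by (simp add: \<gamma>_def comp_def)
  then have "deriv (f \<circ> \<gamma>) 0 = \<sigma>' * (\<integral>x. \<phi> x * a x \<partial>\<mu>) + \<tau>' * (\<integral>x. \<phi> x * b x \<partial>\<mu>)"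
    using represents_deriv[OF \<phi> \<gamma>] DERIV_imp_deriv by (simp add: \<gamma>_def)
  with Pinf_fun_curve_derivative[OF f \<gamma>]
  have "((\<lambda>t. f (perturb (\<sigma> (t + t0)) (\<tau> (t + t0)))) has_real_derivative
    \<sigma>' * (\<integral>x. \<phi> x * a x \<partial>\<mu>) + \<tau>' * (\<integral>x. \<phi> x * b x \<partial>\<mu>)) (at 0)"
    by (simp add: \<gamma>_def comp_def)
  then show ?thesis
    using DERIV_shift[of "\<lambda>t. f (perturb (\<sigma> t) (\<tau> t))" _ 0 t0] by simp
qed

text \<open>A full coordinate line leaves the square of admissible parameters; it is replaced by a
  curve from \<open>smooth_local_line\<close> that agrees with it near the point.\<close>

lemma perturb_partial_derivatives:
  assumes f: "Pinf_fun A f" and st: "\<bar>s\<bar> < r" "\<bar>t\<bar> < r" and \<phi>: "represents f (perturb s t) \<phi>"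
  shows "((\<lambda>s. f (perturb s t)) has_real_derivative (\<integral>x. \<phi> x * a x \<partial>\<mu>)) (at s)"
    "(f \<circ> perturb s has_real_derivative (\<integral>x. \<phi> x * b x \<partial>\<mu>)) (at t)"
proof -
  have const: "smooth_on UNIV (\<lambda>t. c)" for c :: real by (rule smooth_on_const[OF open_UNIV])
  have near: "open (ball y \<epsilon>)" "y \<in> ball y \<epsilon>" if "\<epsilon> > 0" for y \<epsilon> :: real using that by auto
  obtain \<epsilon> \<sigma> where \<sigma>: "\<epsilon> > 0" "smooth_on UNIV \<sigma>" "\<And>t. \<bar>\<sigma> t\<bar> < r" "\<And>t. \<bar>t - s\<bar> < \<epsilon> \<Longrightarrow> \<sigma> t = t"
    by (rule smooth_local_line[OF st(1)]) (rule that)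
  have eq: "\<sigma> s = s" using \<sigma>(1,4) by simp
  have d: "(\<sigma> has_real_derivative 1) (at s)"
    by (rule has_field_derivative_transform_within_open[OF DERIV_ident near[OF \<sigma>(1)]])
      (simp add: \<sigma>(4) dist_real_def abs_minus_commute)
  have "((\<lambda>x. f (perturb (\<sigma> x) t)) has_real_derivative
      1 * (\<integral>x. \<phi> x * a x \<partial>\<mu>) + 0 * (\<integral>x. \<phi> x * b x \<partial>\<mu>)) (at s)"
    by (rule perturb_derivative[OF f \<sigma>(2,3) d const st(2) DERIV_const]) (simp add: eq \<phi>)
  then have "((\<lambda>x. f (perturb x t)) has_real_derivative
      1 * (\<integral>x. \<phi> x * a x \<partial>\<mu>) + 0 * (\<integral>x. \<phi> x * b x \<partial>\<mu>)) (at s)"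
    by (rule has_field_derivative_transform_within_open[OF _ near[OF \<sigma>(1)]])
      (simp add: \<sigma>(4) dist_real_def abs_minus_commute)
  then show "((\<lambda>s. f (perturb s t)) has_real_derivative (\<integral>x. \<phi> x * a x \<partial>\<mu>)) (at s)" by simp
  obtain \<delta> \<tau> where \<tau>: "\<delta> > 0" "smooth_on UNIV \<tau>" "\<And>t. \<bar>\<tau> t\<bar> < r" "\<And>y. \<bar>y - t\<bar> < \<delta> \<Longrightarrow> \<tau> y = y"
    by (rule smooth_local_line[OF st(2)]) (rule that)
  have eq': "\<tau> t = t" using \<tau>(1,4) by simp
  have d': "(\<tau> has_real_derivative 1) (at t)"
    by (rule has_field_derivative_transform_within_open[OF DERIV_ident near[OF \<tau>(1)]])
      (simp add: \<tau>(4) dist_real_def abs_minus_commute)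
  have "((\<lambda>x. f (perturb s (\<tau> x))) has_real_derivative
      0 * (\<integral>x. \<phi> x * a x \<partial>\<mu>) + 1 * (\<integral>x. \<phi> x * b x \<partial>\<mu>)) (at t)"
    by (rule perturb_derivative[OF f const st(1) DERIV_const \<tau>(2,3) d']) (simp add: eq' \<phi>)
  then have "(f \<circ> perturb s has_real_derivative
      0 * (\<integral>x. \<phi> x * a x \<partial>\<mu>) + 1 * (\<integral>x. \<phi> x * b x \<partial>\<mu>)) (at t)"
    by (rule has_field_derivative_transform_within_open[OF _ near[OF \<tau>(1)]])
      (simp add: \<tau>(4) dist_real_def abs_minus_commute)
  then show "(f \<circ> perturb s has_real_derivative (\<integral>x. \<phi> x * b x \<partial>\<mu>)) (at t)" by simp
qed

text \<open>Both sides are mixed second derivatives at the origin of u(s,t) = f(perturb s t). The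
  partial derivatives \<open>g1\<close> and \<open>g2\<close> of u are integrals of a representing
  function against \<open>a\<close> and \<open>b\<close>. Near 0, \<open>D\<close> represents df
  along the s-axis and \<open>E\<close> along the t-axis, so the two integrals are \<partial>_t g1
  and \<partial>_s g2.\<close>

lemma hessian_symmetric:
  assumes f: "Pinf_fun A f"
    and \<sigma>: "smooth_on UNIV \<sigma>" "\<And>t. \<bar>\<sigma> t\<bar> < r" "\<epsilon> > 0" "\<And>t. \<bar>t\<bar> < \<epsilon> \<Longrightarrow> \<sigma> t = t"
    and D: "derivative_tower D" "\<And>t. represents f (perturb (\<sigma> t) 0) (D 0 t)"
    and E: "derivative_tower E" "\<And>t. represents f (perturb 0 (\<sigma> t)) (E 0 t)"
  shows "(\<integral>x. E 1 0 x * a x \<partial>\<mu>) = (\<integral>x. D 1 0 x * b x \<partial>\<mu>)"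
proof -
  have "0 < r" by (rule r)
  then have r0: "\<bar>0::real\<bar> < r" by simp
  define u where "u s t = f (perturb s t)" for s t
  define g1 where "g1 s t = deriv (\<lambda>s. u s t) s" for s t
  define g2 where "g2 s t = deriv (u s) t" for s t
  have g1: "g1 s t = (\<integral>x. \<phi> x * a x \<partial>\<mu>)" "((\<lambda>s. u s t) has_real_derivative g1 s t) (at s)"
    and g2: "g2 s t = (\<integral>x. \<phi> x * b x \<partial>\<mu>)" "(u s has_real_derivative g2 s t) (at t)"
    if "\<bar>s\<bar> < r" "\<bar>t\<bar> < r" "represents f (perturb s t) \<phi>" for s t \<phi>
  proof -
    have 1: "((\<lambda>s. u s t) has_real_derivative (\<integral>x. \<phi> x * a x \<partial>\<mu>)) (at s)"
      and 2: "(u s has_real_derivative (\<integral>x. \<phi> x * b x \<partial>\<mu>)) (at t)"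
      using perturb_partial_derivatives[OF f that] by (simp_all add: u_def[abs_def] comp_def)
    show "g1 s t = (\<integral>x. \<phi> x * a x \<partial>\<mu>)" "g2 s t = (\<integral>x. \<phi> x * b x \<partial>\<mu>)"
      unfolding g1_def g2_def by (rule DERIV_imp_deriv[OF 1], rule DERIV_imp_deriv[OF 2])
    then show "((\<lambda>s. u s t) has_real_derivative g1 s t) (at s)" "(u s has_real_derivative g2 s t) (at t)"
      using 1 2 by simp_all
  qed
  have g1': "((\<lambda>s. u s t) has_real_derivative g1 s t) (at s)"
    and g2': "(u s has_real_derivative g2 s t) (at t)" if st: "\<bar>s\<bar> < r" "\<bar>t\<bar> < r" for s t
  proof -
    obtain \<phi> where "represents f (perturb s t) \<phi>"
      by (rule Pinf_fun_represents[OF f perturb_Pinf[OF st]]) (rule that)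
    then show "((\<lambda>s. u s t) has_real_derivative g1 s t) (at s)" "(u s has_real_derivative g2 s t) (at t)"
      using g1(2)[OF st] g2(2)[OF st] by blast+
  qed
  have near: "open (ball 0 \<epsilon>)" "0 \<in> ball 0 \<epsilon>" using \<sigma>(3) by auto
  have in_ball: "\<sigma> t = t" if "t \<in> ball 0 \<epsilon>" for t using \<sigma>(4) that by (simp add: dist_real_def)
  show ?thesis
  proof (rule mixed_derivatives_eq[of r g1 u g2])
    \<comment> \<open>This is where smooth dependence of the differential is used: along a smooth
      curve of parameters the representing functions form a smooth curve, so their integrals against
      \<open>a\<close> are smooth in t.\<close>
    show "curve_smooth r g1"
      unfolding curve_smooth_def
    proof (intro allI impI)
      fix \<sigma> \<tau> :: "real \<Rightarrow> real"
      assume st: "smooth_on UNIV \<sigma>" "smooth_on UNIV \<tau>" "\<forall>t. \<bar>\<sigma> t\<bar> < r \<and> \<bar>\<tau> t\<bar> < r"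
      then have lt: "\<bar>\<sigma> t\<bar> < r" "\<bar>\<tau> t\<bar> < r" for t by auto
      obtain G where G: "derivative_tower G" "\<And>t. represents f (perturb (\<sigma> t) (\<tau> t)) (G 0 t)"
        by (rule Pinf_fun_represents_curve[OF f perturb_curve[OF st(1) lt(1) st(2) lt(2)]]) (rule that)
      have "(\<lambda>t. g1 (\<sigma> t) (\<tau> t)) = (\<lambda>t. \<integral>x. G 0 t x * a x \<partial>\<mu>)"
        by (rule ext, rule g1(1)[OF lt G(2)])
      then show "smooth_on UNIV (\<lambda>t. g1 (\<sigma> t) (\<tau> t))"
        using tower_integral_smooth[OF G(1) \<mu> a(1)] by simp
    qed
    show "(g1 0 has_real_derivative (\<integral>x. E 1 0 x * a x \<partial>\<mu>)) (at 0)"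
    proof (rule has_field_derivative_transform_within_open[OF _ near])
      show "((\<lambda>t. \<integral>x. E 0 t x * a x \<partial>\<mu>) has_real_derivative (\<integral>x. E 1 0 x * a x \<partial>\<mu>)) (at 0)"
        using tower_integral_derivative[OF E(1) \<mu> a(1), of 0 0] by simp
      show "(\<integral>x. E 0 t x * a x \<partial>\<mu>) = g1 0 t" if "t \<in> ball 0 \<epsilon>" for t
        using g1(1)[OF r0 \<sigma>(2) E(2), of t] in_ball[OF that] by simp
    qed
    show "((\<lambda>s. g2 s 0) has_real_derivative (\<integral>x. D 1 0 x * b x \<partial>\<mu>)) (at 0)"
    proof (rule has_field_derivative_transform_within_open[OF _ near])
      show "((\<lambda>t. \<integral>x. D 0 t x * b x \<partial>\<mu>) has_real_derivative (\<integral>x. D 1 0 x * b x \<partial>\<mu>)) (at 0)"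
        using tower_integral_derivative[OF D(1) \<mu> b(1), of 0 0] by simp
      show "(\<integral>x. D 0 t x * b x \<partial>\<mu>) = g2 t 0" if "t \<in> ball 0 \<epsilon>" for t
        using g2(1)[OF \<sigma>(2) r0 D(2), of t] in_ball[OF that] by simp
    qed
  qed (use r g1' g2' r0 in auto)
qed

end

section \<open>The Jacobi identity\<close>

lemma Pinf_space_simps [simp]:
  "points (Pinf_space A) = Pinf A" "c \<in> curves (Pinf_space A) \<longleftrightarrow> Pinf_curve A c"
  "f \<in> funs (Pinf_space A) \<longleftrightarrow> Pinf_fun A f"
  by (simp_all add: Pinf_space_def)

context closed_manifold
begin

lemma represents_differential:
  "represents f m \<phi> \<Longrightarrow> differential (Pinf_space A) f m = differential (Pinf_space A) (F_fun \<phi>) m"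
  by (auto simp: differential_def fun_eq_iff represents_deriv)

lemma represents_F_fun: "smooth_fun A \<phi> \<Longrightarrow> represents (F_fun \<phi>) m \<phi>"
  by (simp add: represents_def)

text \<open>Let \<delta> be the difference of the two functions and a = \<delta> - m with m its
  mean. Differentiating f along (1 + s a) \<mu> in both descriptions shows that the integral of
  \<delta> a is 0. As a has mean 0, its square also has integral 0, and positivity of \<mu> on
  nonempty open sets gives a = 0.\<close>

lemma represents_unique:
  assumes \<mu>: "\<mu> \<in> Pinf A" and f: "Pinf_fun A f"
    and \<phi>: "represents f \<mu> \<phi>" and \<psi>: "represents f \<mu> \<psi>"
  obtains m where "\<phi> = (\<lambda>x. 1 * \<psi> x + m * 1)"
proof -
  note s = represents_smooth[OF \<phi>] represents_smooth[OF \<psi>]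
  note int = Pinf_integrable[OF \<mu>]
  define \<delta> where "\<delta> x = 1 * \<phi> x + (- 1) * \<psi> x" for x
  have \<delta>: "smooth_fun A \<delta>" unfolding \<delta>_def[abs_def] by (rule smooth_fun_lincomb[OF s])
  define m where "m = (\<integral>x. \<delta> x \<partial>\<mu>)"
  define a where "a x = 1 * \<delta> x + (- m) * 1" for x
  have sa: "smooth_fun A a"
    unfolding a_def[abs_def] by (rule smooth_fun_lincomb[OF \<delta> smooth_fun_const])
  have a0: "(\<integral>x. a x \<partial>\<mu>) = 0"
    unfolding a_def using int[OF \<delta>] int[OF smooth_fun_const] prob_space.prob_space[OF PinfD(1)[OF \<mu>]]
    by (simp add: m_def)
  obtain B where B: "B > 0" "\<And>x. \<bar>a x\<bar> \<le> B" by (rule smooth_fun_abs_bound[OF sa]) (rule that)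
  \<comment> \<open>One direction is enough, so the other is 0. The radius 1 / (2 B) makes r |a| at
    most 1/2.\<close>
  interpret perturbation A \<mu> a "\<lambda>x. 0" "1 / (2 * B)"
  proof
    show "1 / (2 * B) * (\<bar>a x\<bar> + \<bar>0\<bar>) < 1" for x
      using B(1) B(2)[of x] by (simp add: field_simps)
  qed (use \<mu> sa a0 B smooth_fun_const[of 0] in auto)
  have p0: "perturb 0 0 = \<mu>" by (simp add: perturb_def density_1)
  have lt: "\<bar>0::real\<bar> < 1 / (2 * B)" using B by simp
  have "(\<integral>x. \<phi> x * a x \<partial>\<mu>) = (\<integral>x. \<psi> x * a x \<partial>\<mu>)"
    by (rule DERIV_unique[OF perturb_partial_derivatives(1)[OF f lt lt] perturb_partial_derivatives(1)[OF f lt lt]])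
      (simp_all add: p0 \<phi> \<psi>)
  then have "(\<integral>x. \<delta> x * a x \<partial>\<mu>) = 0"
    using int[OF smooth_fun_mult[OF s(1) sa]] int[OF smooth_fun_mult[OF s(2) sa]]
    by (simp add: \<delta>_def left_diff_distrib)
  moreover have "(\<integral>x. a x * a x \<partial>\<mu>) = (\<integral>x. \<delta> x * a x - m * a x \<partial>\<mu>)"
    by (rule Bochner_Integration.integral_cong) (simp_all add: a_def algebra_simps)
  ultimately have "(\<integral>x. a x * a x \<partial>\<mu>) = 0"
    using int[OF smooth_fun_mult[OF \<delta> sa]] int[OF sa] a0 by simp
  then have zero: "a x = 0" for x by (rule Pinf_integral_square_zero[OF \<mu> sa])
  have "\<phi> x = 1 * \<psi> x + m * 1" for x
    using zero[of x] by (simp add: a_def \<delta>_def algebra_simps)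
  then show thesis using that by blast
qed

text \<open>Valid also for s = 0, where the second summand vanishes. The factor 1 and the argument
  \<open>0 + s\<close> match the bilinearity lemmas and the difference quotients of a tower at time
  0.\<close>

lemma tower_increment:
  fixes D :: "nat \<Rightarrow> real \<Rightarrow> 'a \<Rightarrow> real"
  shows "D 0 s = (\<lambda>x. 1 * D 0 0 x + s * ((D 0 (0 + s) x - D 0 0 x) / s))"
  by (cases "s = 0") auto

lemma tower_quotient_smooth:
  assumes "derivative_tower D"
  shows "smooth_fun A (\<lambda>x. (D k (t + s) x - D k t x) / s)"
  using smooth_fun_lincomb[OF tower_smooth[OF assms] tower_smooth[OF assms], of "1 / s" k "t + s" "- 1 / s" k t]
  by (simp add: diff_divide_distrib)

end

section \<open>Differentiating the integral of a bracket\<close>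

context poisson_manifold
begin

lemma bracketM_const_right: "smooth_fun A f \<Longrightarrow> bracketM f (\<lambda>x. c) x = 0"
proof -
  assume f: "smooth_fun A f"
  have "dM (\<lambda>x. c) x = (\<lambda>c. 0)"
    by (rule ext) (auto simp: differential_def comp_def split: if_splits)
  then show ?thesis
    using p_sum_right[OF cotangentI[OF f], of "{}" "\<lambda>i x. 0" x] smooth_fun_const[of 0]
    by (simp add: bracket_def)
qed

text \<open>Two representing functions differ by a constant, and brackets with constants
  vanish.\<close>

lemma bracketM_represents_cong:
  assumes \<mu>: "\<mu> \<in> Pinf A" and f: "Pinf_fun A f"
    and \<phi>: "represents f \<mu> \<phi>" and \<psi>: "represents f \<mu> \<psi>" and k: "smooth_fun A k"
  shows "bracketM \<phi> k = bracketM \<psi> k" "bracketM k \<phi> = bracketM k \<psi>"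
proof -
  obtain m where m: "\<phi> = (\<lambda>x. 1 * \<psi> x + m * 1)"
    by (rule represents_unique[OF \<mu> f \<phi> \<psi>]) (rule that)
  note s = represents_smooth[OF \<phi>] represents_smooth[OF \<psi>]
  show right: "bracketM k \<phi> = bracketM k \<psi>"
    unfolding m
    by (rule ext) (simp add: bracketM_const_right[OF k]
        bracketM_lincomb_right[OF k s(2) smooth_fun_const[of 1], of 1 m, simplified])
  show "bracketM \<phi> k = bracketM \<psi> k"
    by (rule ext) (simp add: bracketM_skew[OF s(1) k] bracketM_skew[OF s(2) k] right)
qed

text \<open>A product rule with three varying factors: the two arguments of the bracket and the
  density. Each increment is exactly s times a difference quotient, so bilinearity splits off the
  factor s, and the remainder converges uniformly by continuity of the bracket.\<close>

lemma bracket_integral_derivative: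
  assumes \<mu>: "\<mu> \<in> Pinf A" and D: "derivative_tower D" and E: "derivative_tower E"
    and R: "derivative_tower R" "\<And>t x. R 0 t x > 0" "R 0 0 = (\<lambda>x. 1)"
  shows "((\<lambda>t. \<integral>x. bracketM (D 0 t) (E 0 t) x \<partial>density \<mu> (\<lambda>x. ennreal (R 0 t x)))
    has_real_derivative
      (\<integral>x. bracketM (D 1 0) (E 0 0) x \<partial>\<mu>) + (\<integral>x. bracketM (D 0 0) (E 1 0) x \<partial>\<mu>) +
      (\<integral>x. bracketM (D 0 0) (E 0 0) x * R 1 0 x \<partial>\<mu>)) (at 0)"
proof -
  define q where "q G s x = (G 0 (0 + s) x - G 0 0 x) / s" for G :: "nat \<Rightarrow> real \<Rightarrow> 'a \<Rightarrow> real" and s x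
  have q: "smooth_fun A (q G s)" if "derivative_tower G" for G s
    unfolding q_def[abs_def] by (rule tower_quotient_smooth[OF that])
  have inc: "G 0 s = (\<lambda>x. 1 * G 0 0 x + s * q G s x)" for G s
    unfolding q_def by (rule tower_increment)
  have ql: "smooth_tendsto A (q G) (G 1 0) (at 0)" if "derivative_tower G" for G
    using tower_tendsto[OF that, of 0 0] by (simp add: q_def[abs_def])
  note sm = tower_smooth[OF D] tower_smooth[OF E] tower_smooth[OF R(1)] q[OF D] q[OF E] q[OF R(1)]
  note br = bracketM_smooth
  note int = Pinf_integrable[OF \<mu>]
  \<comment> \<open>For s \<noteq> 0 this is the difference quotient of the integrand
    \<open>h\<close> below, arranged as the quotient of the bracket times the new density plus the
    old bracket times the quotient of the density.\<close>
  define T where "T s x = (bracketM (D 0 0) (q E s) x + bracketM (q D s) (E 0 0) x +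
      s * bracketM (q D s) (q E s) x) * R 0 s x + bracketM (D 0 0) (E 0 0) x * q R s x" for s x
  \<comment> \<open>The terms with factor 0 are kept so that \<open>L\<close> is the limit of
    \<open>T\<close> summand by summand.\<close>
  define L where "L x = (bracketM (D 0 0) (E 1 0) x + bracketM (D 1 0) (E 0 0) x +
      0 * bracketM (D 1 0) (E 1 0) x) * (1 + 0 * R 1 0 x) + bracketM (D 0 0) (E 0 0) x * R 1 0 x" for x
  have lb: "uniform_limit UNIV (\<lambda>s. bracketM (q D s) (q E s)) (bracketM (D 1 0) (E 1 0)) (at 0)"
    and lb1: "uniform_limit UNIV (\<lambda>s. bracketM (D 0 0) (q E s)) (bracketM (D 0 0) (E 1 0)) (at 0)"
    and lb2: "uniform_limit UNIV (\<lambda>s. bracketM (q D s) (E 0 0)) (bracketM (D 1 0) (E 0 0)) (at 0)"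
    by (intro bracketM_uniform_limit ql smooth_tendsto_const D E sm)+
  have lq: "uniform_limit UNIV (q R) (R 1 0) (at 0)"
    using ql[OF R(1)] unfolding smooth_tendsto_def by blast
  have ls: "uniform_limit UNIV (\<lambda>s x. s) (\<lambda>x. 0) (at (0::real))"
    by (rule uniform_limitI) (auto simp: eventually_at intro!: exI)
  have bd: "bounded (range f)" if "smooth_fun A f" for f by (rule smooth_fun_bounded[OF that])
  have bd0: "bounded (range (\<lambda>x::'a. 0::real))"
    by (rule bounded_subset[of "{0}"]) auto
  have lR: "uniform_limit UNIV (R 0) (\<lambda>x. 1 + 0 * R 1 0 x) (at 0)"
  proof -
    have "uniform_limit UNIV (\<lambda>s x. 1 + s * q R s x) (\<lambda>x. 1 + 0 * R 1 0 x) (at 0)"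
      by (intro uniform_limit_add uniform_limit_const uniform_lim_mult ls lq bd0 bd sm)
    moreover have "(\<lambda>s x. 1 + s * q R s x) = R 0"
      by (intro ext) (subst inc[of R], simp add: R(3))
    ultimately show ?thesis by simp
  qed
  have T: "smooth_fun A (T s)" for s
    unfolding T_def[abs_def] by (intro smooth_fun_add smooth_fun_mult br smooth_fun_const sm)
  have L: "smooth_fun A L"
    unfolding L_def[abs_def] by (intro smooth_fun_add smooth_fun_mult br smooth_fun_const sm)
  have "uniform_limit UNIV T L (at 0)"
    unfolding T_def[abs_def] L_def[abs_def]
    by (intro uniform_limit_add uniform_lim_mult lb lb1 lb2 lq ls lR uniform_limit_const bd bd0
        smooth_fun_add smooth_fun_mult br smooth_fun_const sm)
  from integral_uniform_limit[OF \<mu> this int[OF T] int[OF L]]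
  have lim: "((\<lambda>s. \<integral>x. T s x \<partial>\<mu>) \<longlongrightarrow> (\<integral>x. L x \<partial>\<mu>)) (at 0)" .
  define h where "h t x = bracketM (D 0 t) (E 0 t) x * R 0 t x" for t x
  have h: "smooth_fun A (h t)" for t
    unfolding h_def[abs_def] by (intro smooth_fun_mult br sm)
  have inth: "(\<integral>x. bracketM (D 0 t) (E 0 t) x \<partial>density \<mu> (\<lambda>x. ennreal (R 0 t x))) = (\<integral>x. h t x \<partial>\<mu>)" for t
    unfolding h_def by (rule integral_density_Pinf[OF \<mu> sm(3) R(2) br[OF sm(1,2)]])
  have expand: "h s x - h 0 x = s * T s x" for s x
  proof -
    have "bracketM (D 0 s) (E 0 s) x =
        bracketM (D 0 0) (E 0 0) x + s * bracketM (D 0 0) (q E s) x +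
        s * (bracketM (q D s) (E 0 0) x + s * bracketM (q D s) (q E s) x)"
    proof -
      have E': "bracketM k (E 0 s) x = 1 * bracketM k (E 0 0) x + s * bracketM k (q E s) x"
        if "smooth_fun A k" for k
        by (subst inc[of E]) (rule bracketM_lincomb_right[OF that sm(2,5)])
      have "bracketM (D 0 s) (E 0 s) x = 1 * bracketM (D 0 0) (E 0 s) x + s * bracketM (q D s) (E 0 s) x"
        by (subst inc[of D]) (rule bracketM_lincomb_left[OF sm(2,1,4)])
      then show ?thesis using E'[OF sm(1)] E'[OF sm(4)] by simp
    qed
    moreover have "R 0 s x = 1 + s * q R s x" by (subst inc) (simp add: R(3))
    ultimately show ?thesis by (simp add: h_def T_def R(3) algebra_simps)
  qed
  have "(\<lambda>s. ((\<integral>x. h (0 + s) x \<partial>\<mu>) - (\<integral>x. h 0 x \<partial>\<mu>)) / s) \<midarrow>0\<rightarrow> (\<integral>x. L x \<partial>\<mu>)"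
  proof (rule LIM_equal[THEN iffD2, OF _ lim], intro allI impI)
    fix s :: real assume s: "s \<noteq> 0"
    have "(\<integral>x. h s x \<partial>\<mu>) - (\<integral>x. h 0 x \<partial>\<mu>) = (\<integral>x. h s x - h 0 x \<partial>\<mu>)"
      by (rule Bochner_Integration.integral_diff[OF int[OF h] int[OF h], symmetric])
    also have "\<dots> = s * (\<integral>x. T s x \<partial>\<mu>)" unfolding expand by simp
    finally show "((\<integral>x. h (0 + s) x \<partial>\<mu>) - (\<integral>x. h 0 x \<partial>\<mu>)) / s = (\<integral>x. T s x \<partial>\<mu>)"
      using s by simp
  qed
  then have "((\<lambda>t. \<integral>x. h t x \<partial>\<mu>) has_real_derivative (\<integral>x. L x \<partial>\<mu>)) (at 0)"
    unfolding DERIV_def by simp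
  moreover have "(\<integral>x. L x \<partial>\<mu>) = (\<integral>x. bracketM (D 1 0) (E 0 0) x \<partial>\<mu>) + (\<integral>x. bracketM (D 0 0) (E 1 0) x \<partial>\<mu>) +
      (\<integral>x. bracketM (D 0 0) (E 0 0) x * R 1 0 x \<partial>\<mu>)"
    using int[OF br[OF sm(1) sm(2)]] int[OF smooth_fun_mult[OF br[OF sm(1) sm(2)] sm(3)]]
    by (simp add: L_def)
  ultimately show ?thesis unfolding inth by simp
qed

end

section \<open>Hamiltonian vectors and double brackets on the space of measures\<close>

locale poisson_measures = poisson_manifold A p
  for A :: "('a::t2_space, 'e::euclidean_space) chart set" and p :: "'a bivector_field" +
  fixes P :: "'a measure bivector_field"
  assumes skew_P: "skew_bivector_field (Pinf_space A) P"
    and bracketP_F_fun: "\<And>\<phi> \<psi> \<mu>. smooth_fun A \<phi> \<Longrightarrow> smooth_fun A \<psi> \<Longrightarrow> \<mu> \<in> Pinf A \<Longrightarrow>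
      bracket (Pinf_space A) P (F_fun \<phi>) (F_fun \<psi>) \<mu> = (\<integral>x. bracketM \<phi> \<psi> x \<partial>\<mu>)"
begin

abbreviation "bracketP \<equiv> bracket (Pinf_space A) P"

text \<open>A bivector field at \<mu> sees only the differentials at \<mu>, and these agree with
  those of F_\<phi> and F_\<psi>.\<close>

lemma bracketP_represents:
  assumes "\<mu> \<in> Pinf A" "represents f \<mu> \<phi>" "represents g \<mu> \<psi>"
  shows "bracketP f g \<mu> = (\<integral>x. bracketM \<phi> \<psi> x \<partial>\<mu>)"
  using bracketP_F_fun[OF represents_smooth[OF assms(2)] represents_smooth[OF assms(3)] assms(1)]
  by (simp add: bracket_def represents_differential[OF assms(2)] represents_differential[OF assms(3)])

lemma cotangentP: "Pinf_fun A f \<Longrightarrow> differential (Pinf_space A) f \<mu> \<in> cotangent_space (Pinf_space A) \<mu>"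
  by (auto simp: cotangent_space_def)

lemma bracketP_skew:
  assumes "Pinf_fun A f" "Pinf_fun A g" "\<mu> \<in> Pinf A"
  shows "bracketP f g \<mu> = - bracketP g f \<mu>"
  unfolding bracket_def
  by (rule skew_bivector_fieldD(1)[OF skew_P _ cotangentP[OF assms(1)] cotangentP[OF assms(2)]])
    (simp add: assms)

text \<open>The value at \<open>\<mu>\<close> of the Hamiltonian vector field of \<open>f\<close>, which is a tangent vector by the
  definition of a bivector field, is the measure \<open>a \<mu>\<close>.\<close>

definition hamiltonian :: "'a measure \<Rightarrow> ('a measure \<Rightarrow> real) \<Rightarrow> ('a \<Rightarrow> real) \<Rightarrow> ('a \<Rightarrow> real) \<Rightarrow> bool" where
  "hamiltonian \<mu> f \<phi> a \<longleftrightarrow> Pinf_fun A f \<and> represents f \<mu> \<phi> \<and> smooth_fun A a \<and> (\<integral>x. a x \<partial>\<mu>) = 0 \<and>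
     (\<forall>g \<psi>. Pinf_fun A g \<longrightarrow> represents g \<mu> \<psi> \<longrightarrow> bracketP f g \<mu> = (\<integral>x. \<psi> x * a x \<partial>\<mu>))"

lemma hamiltonian_exists:
  assumes \<mu>: "\<mu> \<in> Pinf A" and f: "Pinf_fun A f"
  obtains \<phi> a where "hamiltonian \<mu> f \<phi> a"
proof -
  obtain \<phi> where \<phi>: "represents f \<mu> \<phi>" by (rule Pinf_fun_represents[OF f \<mu>]) (rule that)
  have "tangent_form (Pinf_space A) \<mu> (P \<mu> (differential (Pinf_space A) f \<mu>))"
    by (rule skew_bivector_fieldD(3)[OF skew_P _ cotangentP[OF f]]) (simp add: \<mu>)
  then obtain c where c: "Pinf_curve A c" "c 0 = \<mu>"
    and Pc: "\<And>\<beta>. \<beta> \<in> cotangent_space (Pinf_space A) \<mu> \<Longrightarrow> P \<mu> (differential (Pinf_space A) f \<mu>) \<beta> = \<beta> c"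
    unfolding tangent_form_def by auto
  obtain a where a: "smooth_fun A a" "(\<integral>x. a x \<partial>\<mu>) = 0"
    "\<And>\<phi>. smooth_fun A \<phi> \<Longrightarrow> deriv (F_fun \<phi> \<circ> c) 0 = (\<integral>x. \<phi> x * a x \<partial>\<mu>)"
    by (rule Pinf_curve_velocity[OF c]) (rule that)
  have "bracketP f g \<mu> = (\<integral>x. \<psi> x * a x \<partial>\<mu>)" if g: "Pinf_fun A g" "represents g \<mu> \<psi>" for g \<psi>
  proof -
    have "bracketP f g \<mu> = deriv (g \<circ> c) 0"
      using Pc[OF cotangentP[OF g(1)]] c by (simp add: bracket_def differential_def)
    then show ?thesis
      using represents_deriv[OF g(2) c] a(3)[OF represents_smooth[OF g(2)]] by simp
  qed
  then show thesis
    using that[of \<phi> a] f \<phi> a(1,2) unfolding hamiltonian_def by blast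
qed

lemma hamiltonianD:
  assumes "hamiltonian \<mu> f \<phi> a"
  shows "Pinf_fun A f" "represents f \<mu> \<phi>" "smooth_fun A a" "(\<integral>x. a x \<partial>\<mu>) = 0"
    "\<And>g \<psi>. Pinf_fun A g \<Longrightarrow> represents g \<mu> \<psi> \<Longrightarrow> bracketP f g \<mu> = (\<integral>x. \<psi> x * a x \<partial>\<mu>)"
  using assms unfolding hamiltonian_def by blast+

text \<open>By skewness {{f, g}, h} is minus the derivative of {f, g} in the direction X_h. The
  curve \<open>c\<close> has this velocity at 0 and the explicit form needed to compare Hessians.
  The first two integrals are the second derivatives of f in X_h, X_g and of g in X_h, X_f; the
  third comes from the variation of the measure.\<close>

lemma bracketP_bracketP:
  assumes \<mu>: "\<mu> \<in> Pinf A"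
    and f: "hamiltonian \<mu> f \<phi>f af" and g: "hamiltonian \<mu> g \<phi>g ag" and h: "hamiltonian \<mu> h \<phi>h ah"
    and \<sigma>: "smooth_on UNIV \<sigma>" "(\<sigma> has_real_derivative 1) (at 0)" "\<sigma> 0 = 0"
    and pos: "\<And>t x. 1 + \<sigma> t * ah x > 0"
    and c: "Pinf_curve A c" "\<And>t. c t \<in> Pinf A" "\<And>t. c t = density \<mu> (\<lambda>x. ennreal (1 + \<sigma> t * ah x))"
    and D: "derivative_tower D" "\<And>t. represents f (c t) (D 0 t)"
    and E: "derivative_tower E" "\<And>t. represents g (c t) (E 0 t)"
  shows "bracketP (bracketP f g) h \<mu> =
    (\<integral>x. D 1 0 x * ag x \<partial>\<mu>) - (\<integral>x. E 1 0 x * af x \<partial>\<mu>) - (\<integral>x. bracketM \<phi>h (bracketM \<phi>f \<phi>g) x \<partial>\<mu>)"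
proof -
  \<comment> \<open>The tower of the density 1 + \<sigma> ah. The last summand only fills the second
    direction required by \<open>tower_affine\<close>; since \<sigma> has derivative 1 at 0, the
    velocity is \<open>ah\<close>.\<close>
  define R where "R k t x = (if k = 0 then 1 else 0) + nderiv k \<sigma> t * ah x + nderiv k \<sigma> t * 0"
    for k :: nat and t x
  have R: "derivative_tower R"
    unfolding R_def[abs_def]
    by (rule tower_affine[OF smooth_fun_const hamiltonianD(3)[OF h] smooth_fun_const \<sigma>(1) \<sigma>(1)])
  have R0: "R 0 t x = 1 + \<sigma> t * ah x" for t x by (simp add: R_def)
  have R1: "R 1 0 x = ah x" for x
    using frechet_derivative_real[OF \<sigma>(2), of 1] by (simp add: R_def)
  have Rpos: "R 0 t x > 0" for t x using pos by (simp add: R0)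
  have R00: "R 0 0 = (\<lambda>x. 1)" by (simp add: fun_eq_iff R0 \<sigma>(3))
  have ct: "c t = density \<mu> (\<lambda>x. ennreal (R 0 t x))" for t by (simp add: c(3) R0)
  have c0: "c 0 = \<mu>" by (simp add: c(3) \<sigma>(3) density_1)
  have G: "Pinf_fun A (bracketP f g)"
    using bracket_in_funs[OF skew_P] hamiltonianD(1)[OF f] hamiltonianD(1)[OF g] by simp
  obtain \<psi> where \<psi>: "represents (bracketP f g) \<mu> \<psi>" by (rule Pinf_fun_represents[OF G \<mu>]) (rule that)
  \<comment> \<open>Any representing \<psi> of {f, g} converts the pairing with X_h into the
    derivative of {f, g} along \<open>c\<close>; \<psi> itself need not be computed.\<close>
  have "bracketP (bracketP f g) h \<mu> = - (\<integral>x. \<psi> x * ah x \<partial>\<mu>)"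
    using bracketP_skew[OF G hamiltonianD(1)[OF h] \<mu>] hamiltonianD(5)[OF h G \<psi>] by simp
  also have "(\<integral>x. \<psi> x * ah x \<partial>\<mu>) = (\<integral>x. R 1 0 x * \<psi> x \<partial>\<mu>)"
    unfolding R1 by (simp add: mult.commute)
  also have "\<dots> = deriv (F_fun \<psi> \<circ> c) 0"
    using DERIV_imp_deriv[OF F_fun_curve_derivative(2)[OF \<mu> R Rpos ct represents_smooth[OF \<psi>]]] by simp
  also have "\<dots> = deriv (bracketP f g \<circ> c) 0"
    using represents_deriv[OF \<psi> c(1) c0] by simp
  also have "bracketP f g \<circ> c = (\<lambda>t. \<integral>x. bracketM (D 0 t) (E 0 t) x \<partial>density \<mu> (\<lambda>x. ennreal (R 0 t x)))"
    using bracketP_represents[OF c(2) D(2) E(2)] by (simp add: fun_eq_iff ct)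
  also have "deriv \<dots> 0 = (\<integral>x. bracketM (D 1 0) (E 0 0) x \<partial>\<mu>) + (\<integral>x. bracketM (D 0 0) (E 1 0) x \<partial>\<mu>) +
      (\<integral>x. bracketM (D 0 0) (E 0 0) x * R 1 0 x \<partial>\<mu>)"
    by (rule DERIV_imp_deriv[OF bracket_integral_derivative[OF \<mu> D(1) E(1) R Rpos R00]])
  \<comment> \<open>The velocity of \<open>D\<close> is itself a smooth function, so the integral is
    the bracket of its linear functional with g at \<mu>. The Hamiltonian vector of g turns this
    into a pairing with \<open>ag\<close>.\<close>
  also have "(\<integral>x. bracketM (D 1 0) (E 0 0) x \<partial>\<mu>) = - (\<integral>x. D 1 0 x * ag x \<partial>\<mu>)"
  proof -
    note D1 = tower_smooth[OF D(1), of 1 0]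
    have "(\<integral>x. bracketM (D 1 0) (E 0 0) x \<partial>\<mu>) = bracketP (F_fun (D 1 0)) g \<mu>"
      using bracketP_represents[OF \<mu> represents_F_fun[OF D1]] E(2)[of 0] by (simp add: c0)
    also have "\<dots> = - bracketP g (F_fun (D 1 0)) \<mu>"
      by (rule bracketP_skew[OF F_fun_Pinf_fun[OF D1] hamiltonianD(1)[OF g] \<mu>])
    also have "\<dots> = - (\<integral>x. D 1 0 x * ag x \<partial>\<mu>)"
      by (subst hamiltonianD(5)[OF g F_fun_Pinf_fun[OF D1] represents_F_fun[OF D1]]) simp
    finally show ?thesis .
  qed
  also have "(\<integral>x. bracketM (D 0 0) (E 1 0) x \<partial>\<mu>) = (\<integral>x. E 1 0 x * af x \<partial>\<mu>)"
  proof -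
    note E1 = tower_smooth[OF E(1), of 1 0]
    have "(\<integral>x. bracketM (D 0 0) (E 1 0) x \<partial>\<mu>) = bracketP f (F_fun (E 1 0)) \<mu>"
      using bracketP_represents[OF \<mu> _ represents_F_fun[OF E1]] D(2)[of 0] by (simp add: c0)
    also have "\<dots> = (\<integral>x. E 1 0 x * af x \<partial>\<mu>)"
      by (rule hamiltonianD(5)[OF f F_fun_Pinf_fun[OF E1] represents_F_fun[OF E1]])
    finally show ?thesis .
  qed
  \<comment> \<open>\<open>D 0 0\<close> and \<open>\<phi>f\<close> represent the same differential
    but may differ by a constant, and likewise \<open>E 0 0\<close> and \<open>\<phi>g\<close>; the
    bracket ignores this.\<close>
  also have "(\<integral>x. bracketM (D 0 0) (E 0 0) x * R 1 0 x \<partial>\<mu>) = (\<integral>x. bracketM \<phi>h (bracketM \<phi>f \<phi>g) x \<partial>\<mu>)"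
  proof -
    have rep: "represents f \<mu> (D 0 0)" "represents g \<mu> (E 0 0)"
      using D(2)[of 0] E(2)[of 0] by (simp_all add: c0)
    note sm = represents_smooth[OF hamiltonianD(2)[OF f]] represents_smooth[OF hamiltonianD(2)[OF g]]
    have "bracketM (D 0 0) (E 0 0) = bracketM \<phi>f (E 0 0)"
      by (rule bracketM_represents_cong(1)[OF \<mu> hamiltonianD(1)[OF f] rep(1) hamiltonianD(2)[OF f]
            represents_smooth[OF rep(2)]])
    also have "\<dots> = bracketM \<phi>f \<phi>g"
      by (rule bracketM_represents_cong(2)[OF \<mu> hamiltonianD(1)[OF g] rep(2) hamiltonianD(2)[OF g] sm(1)])
    finally have eq: "bracketM (D 0 0) (E 0 0) = bracketM \<phi>f \<phi>g" .
    note B = bracketM_smooth[OF sm]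
    have "(\<integral>x. bracketM \<phi>f \<phi>g x * ah x \<partial>\<mu>) = bracketP h (F_fun (bracketM \<phi>f \<phi>g)) \<mu>"
      by (rule hamiltonianD(5)[OF h F_fun_Pinf_fun[OF B] represents_F_fun[OF B], symmetric])
    also have "\<dots> = (\<integral>x. bracketM \<phi>h (bracketM \<phi>f \<phi>g) x \<partial>\<mu>)"
      by (rule bracketP_represents[OF \<mu> hamiltonianD(2)[OF h] represents_F_fun[OF B]])
    finally show ?thesis unfolding eq R1 .
  qed
  finally show ?thesis by simp
qed

lemma bracketP_jacobi:
  assumes \<mu>: "\<mu> \<in> Pinf A" and f: "Pinf_fun A f" and g: "Pinf_fun A g" and h: "Pinf_fun A h"
  shows "bracketP (bracketP f g) h \<mu> + bracketP (bracketP g h) f \<mu> + bracketP (bracketP h f) g \<mu> = 0"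
proof -
  obtain \<phi>f af where hf: "hamiltonian \<mu> f \<phi>f af" by (rule hamiltonian_exists[OF \<mu> f]) (rule that)
  obtain \<phi>g ag where hg: "hamiltonian \<mu> g \<phi>g ag" by (rule hamiltonian_exists[OF \<mu> g]) (rule that)
  obtain \<phi>h ah where hh: "hamiltonian \<mu> h \<phi>h ah" by (rule hamiltonian_exists[OF \<mu> h]) (rule that)
  obtain Bf where Bf: "Bf > 0" "\<And>x. \<bar>af x\<bar> \<le> Bf"
    by (rule smooth_fun_abs_bound[OF hamiltonianD(3)[OF hf]]) (rule that)
  obtain Bg where Bg: "Bg > 0" "\<And>x. \<bar>ag x\<bar> \<le> Bg"
    by (rule smooth_fun_abs_bound[OF hamiltonianD(3)[OF hg]]) (rule that)
  obtain Bh where Bh: "Bh > 0" "\<And>x. \<bar>ah x\<bar> \<le> Bh"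
    by (rule smooth_fun_abs_bound[OF hamiltonianD(3)[OF hh]]) (rule that)
  \<comment> \<open>One radius for all three families allows one cut-off \<sigma>, and so one curve
    in each Hamiltonian direction that can be used in two families.\<close>
  define r where "r = 1 / (2 * (Bf + Bg + Bh))"
  have r: "r > 0" using Bf Bg Bh by (simp add: r_def)
  have r_less: "r * y < 1" if "y \<le> Bf + Bg + Bh" for y
    using that Bf(1) Bg(1) Bh(1) by (simp add: r_def divide_less_eq)
  have pert: "perturbation A \<mu> a b r"
    if "hamiltonian \<mu> k \<phi> a" "hamiltonian \<mu> l \<psi> b" "\<And>x. \<bar>a x\<bar> + \<bar>b x\<bar> \<le> Bf + Bg + Bh" for k l \<phi> \<psi> a b
    by unfold_locales (use \<mu> r r_less that hamiltonianD(3,4)[OF that(1)] hamiltonianD(3,4)[OF that(2)] in auto)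
  have bounds: "\<bar>af x\<bar> + \<bar>ag x\<bar> \<le> Bf + Bg + Bh" "\<bar>ag x\<bar> + \<bar>ah x\<bar> \<le> Bf + Bg + Bh"
    "\<bar>ah x\<bar> + \<bar>af x\<bar> \<le> Bf + Bg + Bh" for x
    using Bf(2)[of x] Bg(2)[of x] Bh(2)[of x] Bf(1) Bg(1) Bh(1) by linarith+
  interpret fg: perturbation A \<mu> af ag r by (rule pert[OF hf hg bounds(1)])
  interpret gh: perturbation A \<mu> ag ah r by (rule pert[OF hg hh bounds(2)])
  interpret hf: perturbation A \<mu> ah af r by (rule pert[OF hh hf bounds(3)])
  obtain \<epsilon> \<sigma> where \<sigma>: "\<epsilon> > 0" "smooth_on UNIV \<sigma>" "\<And>t. \<bar>\<sigma> t\<bar> < r" "\<And>t. \<bar>t - 0\<bar> < \<epsilon> \<Longrightarrow> \<sigma> t = t"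
    by (rule smooth_local_line[of 0 r]) (use r in simp, rule that)
  have \<sigma>_id: "\<sigma> t = t" if "\<bar>t\<bar> < \<epsilon>" for t using \<sigma>(4)[of t] that by simp
  have \<sigma>0: "\<sigma> 0 = 0" by (rule \<sigma>_id) (use \<sigma>(1) in simp)
  have \<sigma>1: "(\<sigma> has_real_derivative 1) (at 0)"
    by (rule has_field_derivative_transform_within_open[OF DERIV_ident, of "ball 0 \<epsilon>"])
      (use \<sigma>(1) \<sigma>_id in \<open>auto simp: dist_real_def\<close>)
  define c where "c a t = density \<mu> (\<lambda>x. ennreal (1 + \<sigma> t * a x))" for a t
  have r0: "\<bar>0::real\<bar> < r" using r by simp
  have z: "smooth_on UNIV (\<lambda>t::real. 0::real)" by (rule smooth_on_const[OF open_UNIV])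
  \<comment> \<open>Each curve is the first axis of one family and the second axis of another. This
    is what lets Hessian terms of different double brackets meet.\<close>
  have cf: "c af t = fg.perturb (\<sigma> t) 0" "c af t = hf.perturb 0 (\<sigma> t)"
    and cg: "c ag t = gh.perturb (\<sigma> t) 0" "c ag t = fg.perturb 0 (\<sigma> t)"
    and ch: "c ah t = hf.perturb (\<sigma> t) 0" "c ah t = gh.perturb 0 (\<sigma> t)" for t
    by (simp_all add: c_def fg.perturb_def gh.perturb_def hf.perturb_def)
  have curve: "Pinf_curve A (c af)" "Pinf_curve A (c ag)" "Pinf_curve A (c ah)"
    using fg.perturb_curve[OF \<sigma>(2,3) z r0] gh.perturb_curve[OF \<sigma>(2,3) z r0]
      hf.perturb_curve[OF \<sigma>(2,3) z r0] by (simp_all flip: cf(1) cg(1) ch(1))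
  have cP: "c af t \<in> Pinf A" "c ag t \<in> Pinf A" "c ah t \<in> Pinf A" for t
    unfolding cf(1) cg(1) ch(1)
    by (rule fg.perturb_Pinf gh.perturb_Pinf hf.perturb_Pinf, rule \<sigma>(3), rule r0)+
  have pos: "1 + \<sigma> t * af x > 0" "1 + \<sigma> t * ag x > 0" "1 + \<sigma> t * ah x > 0" for t x
    using fg.perturb_pos[OF \<sigma>(3) r0, of t x] gh.perturb_pos[OF \<sigma>(3) r0, of t x]
      hf.perturb_pos[OF \<sigma>(3) r0, of t x] by simp_all
  \<comment> \<open>Each function is followed along the Hamiltonian directions of the other two:
    \<open>Fg\<close> belongs to f along X_g, and so on.\<close>
  obtain Fg where Fg: "derivative_tower Fg" "\<And>t. represents f (c ag t) (Fg 0 t)"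
    by (rule Pinf_fun_represents_curve[OF f curve(2)]) (rule that)
  obtain Fh where Fh: "derivative_tower Fh" "\<And>t. represents f (c ah t) (Fh 0 t)"
    by (rule Pinf_fun_represents_curve[OF f curve(3)]) (rule that)
  obtain Gh where Gh: "derivative_tower Gh" "\<And>t. represents g (c ah t) (Gh 0 t)"
    by (rule Pinf_fun_represents_curve[OF g curve(3)]) (rule that)
  obtain Gf where Gf: "derivative_tower Gf" "\<And>t. represents g (c af t) (Gf 0 t)"
    by (rule Pinf_fun_represents_curve[OF g curve(1)]) (rule that)
  obtain Hf where Hf: "derivative_tower Hf" "\<And>t. represents h (c af t) (Hf 0 t)"
    by (rule Pinf_fun_represents_curve[OF h curve(1)]) (rule that)
  obtain Hg where Hg: "derivative_tower Hg" "\<And>t. represents h (c ag t) (Hg 0 t)"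
    by (rule Pinf_fun_represents_curve[OF h curve(2)]) (rule that)
  \<comment> \<open>The Hessians of f in X_g, X_h, of g in X_h, X_f and of h in X_f, X_g. Each
    occurs in two of the three double brackets, with opposite signs.\<close>
  have "(\<integral>x. Fh 1 0 x * ag x \<partial>\<mu>) = (\<integral>x. Fg 1 0 x * ah x \<partial>\<mu>)"
    by (rule gh.hessian_symmetric[OF f \<sigma>(2,3,1) \<sigma>_id Fg(1) _ Fh(1)])
      (simp_all add: Fg(2) Fh(2) flip: cg(1) ch(2))
  moreover have "(\<integral>x. Gf 1 0 x * ah x \<partial>\<mu>) = (\<integral>x. Gh 1 0 x * af x \<partial>\<mu>)"
    by (rule hf.hessian_symmetric[OF g \<sigma>(2,3,1) \<sigma>_id Gh(1) _ Gf(1)])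
      (simp_all add: Gh(2) Gf(2) flip: ch(1) cf(2))
  moreover have "(\<integral>x. Hg 1 0 x * af x \<partial>\<mu>) = (\<integral>x. Hf 1 0 x * ag x \<partial>\<mu>)"
    by (rule fg.hessian_symmetric[OF h \<sigma>(2,3,1) \<sigma>_id Hf(1) _ Hg(1)])
      (simp_all add: Hf(2) Hg(2) flip: cf(1) cg(2))
  moreover have "bracketP (bracketP f g) h \<mu> = (\<integral>x. Fh 1 0 x * ag x \<partial>\<mu>) - (\<integral>x. Gh 1 0 x * af x \<partial>\<mu>) -
      (\<integral>x. bracketM \<phi>h (bracketM \<phi>f \<phi>g) x \<partial>\<mu>)"
    by (rule bracketP_bracketP[OF \<mu> hf hg hh \<sigma>(2) \<sigma>1 \<sigma>0 pos(3) curve(3) cP(3) c_def Fh Gh])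
  moreover have "bracketP (bracketP g h) f \<mu> = (\<integral>x. Gf 1 0 x * ah x \<partial>\<mu>) - (\<integral>x. Hf 1 0 x * ag x \<partial>\<mu>) -
      (\<integral>x. bracketM \<phi>f (bracketM \<phi>g \<phi>h) x \<partial>\<mu>)"
    by (rule bracketP_bracketP[OF \<mu> hg hh hf \<sigma>(2) \<sigma>1 \<sigma>0 pos(1) curve(1) cP(1) c_def Gf Hf])
  moreover have "bracketP (bracketP h f) g \<mu> = (\<integral>x. Hg 1 0 x * af x \<partial>\<mu>) - (\<integral>x. Fg 1 0 x * ah x \<partial>\<mu>) -
      (\<integral>x. bracketM \<phi>g (bracketM \<phi>h \<phi>f) x \<partial>\<mu>)"
    by (rule bracketP_bracketP[OF \<mu> hh hf hg \<sigma>(2) \<sigma>1 \<sigma>0 pos(2) curve(2) cP(2) c_def Hg Fg])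
  moreover have "(\<integral>x. bracketM \<phi>h (bracketM \<phi>f \<phi>g) x \<partial>\<mu>) + (\<integral>x. bracketM \<phi>f (bracketM \<phi>g \<phi>h) x \<partial>\<mu>) +
      (\<integral>x. bracketM \<phi>g (bracketM \<phi>h \<phi>f) x \<partial>\<mu>) = 0"
  proof -
    note sf = represents_smooth[OF hamiltonianD(2)[OF hf]]
      and sg = represents_smooth[OF hamiltonianD(2)[OF hg]]
      and sh = represents_smooth[OF hamiltonianD(2)[OF hh]]
    note br = bracketM_smooth and int = Pinf_integrable[OF \<mu>]
    have "bracketM \<phi>h (bracketM \<phi>f \<phi>g) x + bracketM \<phi>f (bracketM \<phi>g \<phi>h) x +
        bracketM \<phi>g (bracketM \<phi>h \<phi>f) x = 0" for x
      using bracketM_jacobi[OF sf sg sh, of x] bracketM_skew[OF sh br[OF sf sg], of x]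
        bracketM_skew[OF sf br[OF sg sh], of x] bracketM_skew[OF sg br[OF sh sf], of x] by linarith
    then have "(\<integral>x. bracketM \<phi>h (bracketM \<phi>f \<phi>g) x + bracketM \<phi>f (bracketM \<phi>g \<phi>h) x +
        bracketM \<phi>g (bracketM \<phi>h \<phi>f) x \<partial>\<mu>) = 0" by simp
    then show ?thesis
      using int[OF br[OF sh br[OF sf sg]]] int[OF br[OF sf br[OF sg sh]]] int[OF br[OF sg br[OF sh sf]]]
      by simp
  qed
  ultimately show ?thesis by linarith
qed

text \<open>The zero form is the velocity of the constant curve at \<mu>, and the zero function is
  F_\<phi> for \<phi> = 0.\<close>

lemma skew_trivector_zero: "skew_trivector_field (Pinf_space A) (\<lambda>x \<alpha> \<beta> \<gamma>. 0)"
proof -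
  have "tangent_form (Pinf_space A) \<mu> (\<lambda>\<gamma>. 0)" if \<mu>: "\<mu> \<in> Pinf A" for \<mu>
    unfolding tangent_form_def
  proof (intro bexI[of _ "\<lambda>t. \<mu>"] conjI ballI)
    show "0 = \<beta> (\<lambda>t. \<mu>)" if "\<beta> \<in> cotangent_space (Pinf_space A) \<mu>" for \<beta>
      using that by (auto simp: cotangent_space_def differential_def comp_def)
  qed (simp_all add: Pinf_curve_const[OF \<mu>])
  moreover have "Pinf_fun A (\<lambda>\<mu>. 0)"
    using F_fun_Pinf_fun[OF smooth_fun_const[of 0]] by (simp add: F_fun_def[abs_def])
  ultimately show ?thesis
    by (auto simp: skew_trivector_field_def linear_form_def)
qed

lemma poisson_structure_P: "poisson_structure (Pinf_space A) P"
  using skew_P skew_trivector_zero bracketP_jacobi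
  by (auto simp: poisson_structure_def is_boundary_def)

end

theorem proposition6p4:
  fixes A :: "('a::t2_space, 'e::euclidean_space) chart set"
    and p :: "'a bivector_field"
    and P :: "'a measure bivector_field"
  assumes "closed_connected_manifold A"
    and "poisson_structure (manifold_space A) p"
    and "skew_bivector_field (Pinf_space A) P"
    and "\<And>\<phi>\<^sub>1 \<phi>\<^sub>2 \<mu>. smooth_fun A \<phi>\<^sub>1 \<Longrightarrow> smooth_fun A \<phi>\<^sub>2 \<Longrightarrow> \<mu> \<in> Pinf A \<Longrightarrow>
           bracket (Pinf_space A) P (F_fun \<phi>\<^sub>1) (F_fun \<phi>\<^sub>2) \<mu> =
             (\<integral>x. bracket (manifold_space A) p \<phi>\<^sub>1 \<phi>\<^sub>2 x \<partial>\<mu>)"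
  shows "poisson_structure (Pinf_space A) P"
proof -
  interpret poisson_measures A p P
    by unfold_locales (rule assms, assumption?)+
  show ?thesis by (rule poisson_structure_P)
qed

end
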